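(* Let $\alpha\in(1,2]$, $d\ge 1$, let $X$, $Z$, $c_\alpha$ and $B_p$ be as in the context, and let $\alpha'$ be defined by $1/\alpha+1/\alpha'=1$ (so $\alpha'\in[2,\infty)$). Then for all convex bodies $K_1,\ldots,K_{d-1}\subset\mathbb{R}^d$, $$\mathbb{E}\, V(K_1,\ldots,K_{d-1},Z)=c_\alpha\, V(K_1,\ldots,K_{d-1},B_{\alpha'}).$$
   Context: Fix $\alpha\in(1,2]$ and an integer $d\ge1$. $X=(X(t))_{t\ge0}=(X_1(t),\ldots,X_d(t))_{t\ge0}$ is an $\mathbb{R}^d$-valued process on a probability space $(\Omega,\mathcal{A},\mathbb{P})$ with right-continuous paths having left limits, whose components $X_1,\ldots,X_d$ are independent symmetric $\alpha$-stable Lévy processes with scale parameter $1$ started at $0$, i.e. $\mathbb{E}\exp[isX_j(t)]=\exp[-t|s|^\alpha]$ for $s\in\mathbb{R}$, $t\ge0$. For $t\ge0$, $S_t$ is the closure of $\{X(s):0\le s\le t\}$ and $Z_t$ is the convex hull of $S_t$; $Z:=Z_1$. The constant $c_\alpha:=\frac{\alpha}{2}\mathbb{E}|X_1(1)|$ (finite since $\alpha>1$). A convex body is a nonempty compact convex subset of $\mathbb{R}^d$. $V(K_1,\ldots,K_d)$ denotes the mixed volume of convex bodies $K_1,\ldots,K_d$ in $\mathbb{R}^d$. For $p\ge1$, $B_p:=\{u\in\mathbb{R}^d:\|u\|_p\le1\}$ where $\|(u_1,\ldots,u_d)\|_p=(|u_1|^p+\cdots+|u_d|^p)^{1/p}$.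 *)

theory Defs
  imports "HOL-Analysis.Analysis" "HOL-Probability.Probability"
begin

definition convex_body :: "('a::euclidean_space) set \<Rightarrow> bool" where
  "convex_body K \<longleftrightarrow> K \<noteq> {} \<and> compact K \<and> convex K"

definition msum :: "nat set \<Rightarrow> (nat \<Rightarrow> ('a::real_vector) set) \<Rightarrow> 'a set" where
  "msum S K = {(\<Sum>i\<in>S. f i) | f. \<forall>i\<in>S. f i \<in> K i}"

text \<open>Mixed volume V(K 0, ..., K (d-1)) of d convex bodies in R^d, given by the
  standard polarization formula
  d! V(K_1,...,K_d) = sum over nonempty S of (-1)^(d-|S|) vol(sum_{i in S} K_i).\<close>
definition mixed_volume :: "(nat \<Rightarrow> (real^'n) set) \<Rightarrow> real" where
  "mixed_volume K =
     (1 / fact CARD('n)) *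
     (\<Sum>S\<in>Pow {0..<CARD('n)} - {{}}.
        (-1) ^ (CARD('n) - card S) * measure lebesgue (msum S K))"

definition lp_ball :: "real \<Rightarrow> (real^'n) set" where
  "lp_ball p = {u. (\<Sum>j\<in>UNIV. \<bar>u $ j\<bar> powr p) powr (1 / p) \<le> 1}"

text \<open>A real-valued process Y (indexed by t \<ge> 0) is a symmetric alpha-stable Levy process
  with scale parameter 1 started at 0: Y(0)=0, cadlag paths, independent increments,
  and Y(t)-Y(s) (s \<le> t) has characteristic function exp(-(t-s)|u|^alpha)
  (which also gives stationarity of increments).\<close>
definition sym_stable_levy :: "'w measure \<Rightarrow> real \<Rightarrow> (real \<Rightarrow> 'w \<Rightarrow> real) \<Rightarrow> bool" where
  "sym_stable_levy M \<alpha> Y \<longleftrightarrow>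
     (\<forall>t\<ge>0. Y t \<in> borel_measurable M) \<and>
     (\<forall>\<omega>\<in>space M. Y 0 \<omega> = 0) \<and>
     (\<forall>\<omega>\<in>space M. \<forall>t\<ge>0. continuous (at_right t) (\<lambda>s. Y s \<omega>)) \<and>
     (\<forall>\<omega>\<in>space M. \<forall>t>0. \<exists>l. ((\<lambda>s. Y s \<omega>) \<longlongrightarrow> l) (at_left t)) \<and>
     (\<forall>n (t::nat \<Rightarrow> real). t 0 \<ge> 0 \<and> (\<forall>k<n. t k \<le> t (Suc k)) \<longrightarrow>
        prob_space.indep_vars M (\<lambda>_. borel) (\<lambda>k \<omega>. Y (t (Suc k)) \<omega> - Y (t k) \<omega>) {..<n}) \<and>
     (\<forall>s t u. 0 \<le> s \<and> s \<le> t \<longrightarrow>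
        char (distr M borel (\<lambda>\<omega>. Y t \<omega> - Y s \<omega>)) u
          = complex_of_real (exp (- (t - s) * \<bar>u\<bar> powr \<alpha>)))"

end

theory Submission
  imports Defs "HOL-Real_Asymp.Real_Asymp"
begin

text \<open>For fixed \<open>K\<^sub>1, \<dots>, K\<^sub>d\<^sub>-\<^sub>1\<close> the mixed volume is a Minkowski additive, homogeneous and monotone
  functional of its last argument, so taking expectations of it amounts to taking the expectation of
  the support function of the random body: a random body with mean support function \<open>h\<^sub>L\<close> has the
  same mean mixed volume as \<open>L\<close>.

  These properties of the mixed volume come from the log-sum-exp function of a finite point set: its
  gradient maps the space bijectively onto the interior of the convex hull. Summing such functions,
  the volume of a Minkowski sum is the integral of the determinant of a sum of Hessians, so the mixed
  volume is the integral of the mixed discriminant of the Hessians, which is multilinear and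
  nonnegative. Monotonicity follows from Fatou's lemma, because the weights in the log-sum-exp
  function do not affect the image of the gradient.

  The support function of \<open>Z\<close> in direction \<open>u\<close> is the supremum over the time interval from 0 to 1 of
  the process \<open>X(t) \<bullet> u\<close>, a symmetric stable process with scale the \<open>\<alpha>\<close>-norm of \<open>u\<close>. Spitzer's identity
  on dyadic grids and the self-similarity of the process give its expectation \<open>c\<^sub>\<alpha>\<close> times this norm, and by
  Hoelder's inequality the \<open>\<alpha>\<close>-norm is the support function of the unit ball of the dual norm.\<close>

section \<open>Mixed discriminants\<close>

text \<open>The obstacle is the definition of the mixed volume: in an alternating sum of volumes
  neither the sign nor additivity nor monotonicity in an argument can be read off. Under the
  integral, sign and additivity become pointwise statements about matrices. Monotonicity does not,
  because nested bodies need not have comparable Hessians; this is why the freedom in the weights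
  matters. The representation demands smooth strictly convex functions, which excludes bodies
  without interior; outer polytopes with interior lift this restriction.

  On the probabilistic side, measurability of the mixed volume of the random hull is not
  established. The nonnegative integral of an arbitrary function is still monotone, so it suffices
  to enclose that function between measurable ones of nearly equal mean.

  The constant: half of E|X_1(1)| is the mean positive part of a standard variable, and the weights
  1/k in Spitzer's identity together with the scaling (k/n)^(1/\<alpha>) form a Riemann sum with
  limit \<alpha>.\<close>

lemma sum_minus_one_power_Pow:
  assumes "finite A"
  shows "(\<Sum>T\<in>Pow A. (-1) ^ card T) = (if A = {} then 1 else (0::real))"
  \<comment> \<open>Expand the product of -1 + 1 over \<open>A\<close>.\<close>
  using prod_add[OF assms, of "\<lambda>_. -1::real" "\<lambda>_. 1"] assms
  by (auto simp: card_gt_0_iff power_0_left)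

text \<open>Complementation in \<open>N\<close> reduces this to the full power set of
  \<open>N - R\<close>. It is the inclusion-exclusion step that removes all non-surjective row
  assignments below.\<close>

lemma sum_minus_one_power_supersets:
  assumes "finite N" "R \<subseteq> N"
  shows "(\<Sum>S | R \<subseteq> S \<and> S \<subseteq> N. (-1) ^ (card N - card S)) = (if R = N then 1 else (0::real))"
proof -
  have "(\<Sum>S | R \<subseteq> S \<and> S \<subseteq> N. (-1::real) ^ (card N - card S)) = (\<Sum>T\<in>Pow (N - R). (-1) ^ card T)"
    by (rule sum.reindex_bij_witness[where i = "\<lambda>T. N - T" and j = "\<lambda>S. N - S"])
       (use assms in \<open>auto simp: card_Diff_subset finite_subset\<close>)
  also have "\<dots> = (if R = N then 1 else 0)"
    using assms by (subst sum_minus_one_power_Pow) auto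
  finally show ?thesis .
qed

text \<open>Multilinearity in the rows: \<open>\<phi> j\<close> records the summand from which row
  \<open>j\<close> is taken.\<close>

lemma det_sum_rows:
  fixes A :: "'i \<Rightarrow> real^'n^'n"
  assumes "finite S"
  shows "det (\<Sum>i\<in>S. A i) = (\<Sum>\<phi>\<in>UNIV \<rightarrow>\<^sub>E S. det (\<chi> j. A (\<phi> j) $ j))"
proof -
  have "(\<Prod>i\<in>UNIV. (\<Sum>i\<in>S. A i) $ i $ p i) = (\<Sum>\<phi>\<in>UNIV \<rightarrow>\<^sub>E S. \<Prod>i\<in>UNIV. A (\<phi> i) $ i $ p i)" for p
    using prod_sum_PiE[of UNIV "\<lambda>_. S" "\<lambda>i k. A k $ i $ p i"] assms by simp
  then have "det (\<Sum>i\<in>S. A i) =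
     (\<Sum>p | p permutes UNIV. \<Sum>\<phi>\<in>UNIV \<rightarrow>\<^sub>E S. of_int (sign p) * (\<Prod>i\<in>UNIV. A (\<phi> i) $ i $ p i))"
    unfolding det_def by (simp add: sum_distrib_left)
  also have "\<dots> = (\<Sum>\<phi>\<in>UNIV \<rightarrow>\<^sub>E S. det (\<chi> j. A (\<phi> j) $ j))"
    unfolding det_def by (subst sum.swap) simp
  finally show ?thesis .
qed

text \<open>\<^term>\<open>fact CARD('n)\<close> times the usual mixed discriminant.\<close>
definition mixed_disc :: "(nat \<Rightarrow> real^'n^'n) \<Rightarrow> real" where
  "mixed_disc A = (\<Sum>S\<in>Pow {0..<CARD('n)} - {{}}.
     (-1) ^ (CARD('n) - card S) * det (\<Sum>i\<in>S. A i))"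

lemma mixed_disc_cong:
  "(\<And>i. i < CARD('n) \<Longrightarrow> A i = B i) \<Longrightarrow> mixed_disc A = mixed_disc (B :: nat \<Rightarrow> real^'n^'n)"
  unfolding mixed_disc_def
  by (intro sum.cong refl arg_cong2[where f="(*)"] arg_cong[where f=det]) auto

definition enumerations :: "('n::finite \<Rightarrow> nat) set" where
  "enumerations = {\<phi>. bij_betw \<phi> UNIV {0..<CARD('n)}}"

lemma finite_enumerations: "finite (enumerations :: ('n::finite \<Rightarrow> nat) set)"
proof (rule finite_subset)
  show "(enumerations :: ('n \<Rightarrow> nat) set) \<subseteq> UNIV \<rightarrow>\<^sub>E {0..<CARD('n)}"
    by (auto simp: enumerations_def bij_betw_def)
qed (auto intro: finite_PiE)

text \<open>After expansion by rows and exchange of the sums, an assignment \<open>\<phi>\<close>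
  carries the alternating sum over all \<open>S\<close> containing its range. This vanishes unless
  \<open>\<phi>\<close> is onto, hence bijective by cardinality. In the resulting form every matrix
  contributes exactly one row to each determinant.\<close>

lemma mixed_disc_eq:
  fixes A :: "nat \<Rightarrow> real^'n^'n"
  shows "mixed_disc A = (\<Sum>\<phi>\<in>enumerations. det (\<chi> j. A (\<phi> j) $ j))"
proof -
  let ?N = "{0..<CARD('n)}"
  define T where "T \<phi> = det (\<chi> j. A (\<phi> j) $ j)" for \<phi> :: "'n \<Rightarrow> nat"
  let ?F = "(UNIV::'n set) \<rightarrow>\<^sub>E ?N"
  have fin: "finite ?F" by (auto intro: finite_PiE)
  have "mixed_disc A = (\<Sum>S\<in>Pow ?N - {{}}. \<Sum>\<phi>\<in>UNIV \<rightarrow>\<^sub>E S. (-1) ^ (CARD('n) - card S) * T \<phi>)"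
    unfolding mixed_disc_def T_def
    by (intro sum.cong refl) (subst det_sum_rows, auto intro: finite_subset simp: sum_distrib_left)
  also have "\<dots> = (\<Sum>S\<in>Pow ?N - {{}}. \<Sum>\<phi>\<in>{\<phi>\<in>?F. range \<phi> \<subseteq> S}. (-1) ^ (CARD('n) - card S) * T \<phi>)"
    by (intro sum.cong refl) (auto simp: PiE_UNIV_domain)
  also have "\<dots> = (\<Sum>\<phi>\<in>?F. \<Sum>S\<in>{S\<in>Pow ?N - {{}}. range \<phi> \<subseteq> S}. (-1) ^ (CARD('n) - card S) * T \<phi>)"
    by (rule sum.swap_restrict) (use fin in auto)
  also have "\<dots> = (\<Sum>\<phi>\<in>?F. (if range \<phi> = ?N then 1 else 0) * T \<phi>)"
  proof (intro sum.cong refl)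
    fix \<phi> :: "'n \<Rightarrow> nat" assume "\<phi> \<in> ?F"
    then have sub: "range \<phi> \<subseteq> ?N" by auto
    \<comment> \<open>Excluding the empty set changes nothing, since a range is never empty.\<close>
    have "{S\<in>Pow ?N - {{}}. range \<phi> \<subseteq> S} = {S. range \<phi> \<subseteq> S \<and> S \<subseteq> ?N}"
      by auto
    then show "(\<Sum>S\<in>{S\<in>Pow ?N - {{}}. range \<phi> \<subseteq> S}. (-1) ^ (CARD('n) - card S) * T \<phi>)
        = (if range \<phi> = ?N then 1 else 0) * T \<phi>"
      using sum_minus_one_power_supersets[OF _ sub] by (simp flip: sum_distrib_right)
  qed
  also have "\<dots> = (\<Sum>\<phi>\<in>{\<phi>\<in>?F. range \<phi> = ?N}. T \<phi>)"
    by (intro sum.mono_neutral_cong_right) (use fin in auto)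
  also have "{\<phi>\<in>?F. range \<phi> = ?N} = enumerations"
    by (auto simp: bij_betw_def enumerations_def intro!: eq_card_imp_inj_on)
  finally show ?thesis by (simp add: T_def)
qed

lemma enumerations_obtain:
  assumes "\<phi> \<in> (enumerations :: ('n::finite \<Rightarrow> nat) set)" "k < CARD('n)"
  obtains j0 where "\<And>j. \<phi> j = k \<longleftrightarrow> j = j0"
proof -
  have "k \<in> \<phi> ` UNIV" using assms by (auto simp: enumerations_def bij_betw_def)
  then obtain j0 where "\<phi> j0 = k" by auto
  moreover have "inj \<phi>" using assms by (auto simp: enumerations_def bij_betw_def)
  ultimately have "\<And>j. \<phi> j = k \<longleftrightarrow> j = j0" by (auto dest: injD)
  then show ?thesis by (rule that)
qed

text \<open>A bijection takes exactly one row, \<open>j0\<close>, from the matrix with index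
  \<open>k\<close>, so every summand is linear in that matrix.\<close>

lemma mixed_disc_add:
  fixes A :: "nat \<Rightarrow> real^'n^'n"
  assumes "k < CARD('n)"
  shows "mixed_disc (A(k := B + C)) = mixed_disc (A(k := B)) + mixed_disc (A(k := C))"
  unfolding mixed_disc_eq sum.distrib[symmetric]
proof (intro sum.cong refl)
  fix \<phi> :: "'n \<Rightarrow> nat" assume "\<phi> \<in> enumerations"
  then obtain j0 where j0: "\<And>j. \<phi> j = k \<longleftrightarrow> j = j0" using assms by (metis enumerations_obtain)
  have *: "(\<chi> j. (A(k := D)) (\<phi> j) $ j) = (\<chi> j. if j = j0 then D $ j else A (\<phi> j) $ j)" for D
    using j0 by (auto simp: vec_eq_iff)
  show "det (\<chi> j. (A(k := B + C)) (\<phi> j) $ j) =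
         det (\<chi> j. (A(k := B)) (\<phi> j) $ j) + det (\<chi> j. (A(k := C)) (\<phi> j) $ j)"
    unfolding * vector_add_component by (rule det_row_add)
qed

lemma mixed_disc_scale:
  fixes A :: "nat \<Rightarrow> real^'n^'n"
  assumes "k < CARD('n)"
  shows "mixed_disc (A(k := c *\<^sub>R B)) = c * mixed_disc (A(k := B))"
  unfolding mixed_disc_eq sum_distrib_left
proof (intro sum.cong refl)
  fix \<phi> :: "'n \<Rightarrow> nat" assume "\<phi> \<in> enumerations"
  then obtain j0 where j0: "\<And>j. \<phi> j = k \<longleftrightarrow> j = j0" using assms by (metis enumerations_obtain)
  have *: "(\<chi> j. (A(k := D)) (\<phi> j) $ j) = (\<chi> j. if j = j0 then D $ j else A (\<phi> j) $ j)" for D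
    using j0 by (auto simp: vec_eq_iff)
  show "det (\<chi> j. (A(k := c *\<^sub>R B)) (\<phi> j) $ j) = c * det (\<chi> j. (A(k := B)) (\<phi> j) $ j)"
    unfolding * vector_scaleR_component scalar_mult_eq_scaleR[symmetric] by (rule det_row_mul)
qed

section \<open>Positive semidefinite matrices and the sign of the mixed discriminant\<close>

definition outer :: "real^'n \<Rightarrow> real^'n^'n" where
  "outer w = (\<chi> i j. w $ i * w $ j)"

text \<open>These are the positive semidefinite matrices, encoded by a decomposition into rank-one
  pieces: Hessians arise in this form, and rule induction together with multilinearity reduces sign
  questions to rank one.\<close>

inductive gram :: "real^'n^'n \<Rightarrow> bool" where
  gram_zero: "gram 0"
| gram_outer: "gram (outer w)"
| gram_add: "gram A \<Longrightarrow> gram B \<Longrightarrow> gram (A + B)"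

lemma outer_scale: "0 \<le> c \<Longrightarrow> outer (sqrt c *\<^sub>R w) = c *\<^sub>R outer w"
  by (simp add: outer_def vec_eq_iff algebra_simps flip: power2_eq_square)

lemma gram_scale: "gram A \<Longrightarrow> 0 \<le> c \<Longrightarrow> gram (c *\<^sub>R A)"
  by (induction rule: gram.induct)
     (auto simp: scaleR_add_right gram_zero gram_add outer_scale[symmetric] gram_outer)

lemma gram_sum: "(\<And>i. i \<in> S \<Longrightarrow> gram (A i)) \<Longrightarrow> gram (\<Sum>i\<in>S. A i)"
  by (induction S rule: infinite_finite_induct) (auto intro: gram.intros)

text \<open>Row \<open>j\<close> of \<open>outer w\<close> is a multiple of \<open>w\<close>, so
  each summand is a product times a determinant of the vectors \<open>w i\<close> in some order.
  Sorting these determinants produces the signs that assemble the products to a second determinant,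
  and the sum is a square.\<close>

lemma mixed_disc_outer:
  fixes w :: "nat \<Rightarrow> real^'n"
  shows "mixed_disc (\<lambda>i. outer (w i)) \<ge> 0"
proof -
  obtain \<psi> :: "'n \<Rightarrow> nat" where \<psi>: "bij_betw \<psi> UNIV {0..<CARD('n)}"
    using ex_bij_betw_finite_nat[of "UNIV :: 'n set"] by auto
  define W :: "real^'n^'n" where "W = (\<chi> j. w (\<psi> j))"
  have det_row: "det (\<chi> j. outer (w (\<phi> j)) $ j) = (\<Prod>j\<in>UNIV. w (\<phi> j) $ j) * det (\<chi> j. w (\<phi> j))"
    for \<phi> :: "'n \<Rightarrow> nat"
  proof -
    have "(\<chi> j. outer (w (\<phi> j)) $ j) = (\<chi> j. w (\<phi> j) $ j *s w (\<phi> j))"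
      by (simp add: outer_def vec_eq_iff)
    then show ?thesis by (simp only: det_rows_mul)
  qed
  have "mixed_disc (\<lambda>i. outer (w i)) =
      (\<Sum>\<phi>\<in>enumerations. (\<Prod>j\<in>UNIV. w (\<phi> j) $ j) * det (\<chi> j. w (\<phi> j)))"
    unfolding mixed_disc_eq det_row ..
  \<comment> \<open>Relative to one fixed enumeration \<open>\<psi>\<close>, all others are
    \<open>\<psi> \<circ> p\<close> for a permutation \<open>p\<close>.\<close>
  also have "\<dots> = (\<Sum>p | p permutes UNIV. (\<Prod>j\<in>UNIV. w (\<psi> (p j)) $ j) * det (\<chi> j. w (\<psi> (p j))))"
  proof (rule sum.reindex_bij_witness[where j = "\<lambda>\<phi>. inv \<psi> \<circ> \<phi>" and i = "\<lambda>p. \<psi> \<circ> p"])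
    fix \<phi> :: "'n \<Rightarrow> nat" assume "\<phi> \<in> enumerations"
    then have \<phi>: "bij_betw \<phi> UNIV {0..<CARD('n)}" by (simp add: enumerations_def)
    have inv: "\<psi> (inv \<psi> (\<phi> j)) = \<phi> j" for j
      using bij_betw_inv_into_right[OF \<psi>] bij_betwE[OF \<phi>] by auto
    show "\<psi> \<circ> (inv \<psi> \<circ> \<phi>) = \<phi>" using inv by (simp add: fun_eq_iff)
    have "bij_betw (inv \<psi>) {0..<CARD('n)} UNIV" by (rule bij_betw_inv_into[OF \<psi>])
    then have "bij (inv \<psi> \<circ> \<phi>)" using \<phi> by (rule bij_betw_trans[rotated])
    then show "inv \<psi> \<circ> \<phi> \<in> {p. p permutes UNIV}" by (auto simp: permutes_def bij_iff)
    show "(\<Prod>j\<in>UNIV. w (\<psi> ((inv \<psi> \<circ> \<phi>) j)) $ j) * det (\<chi> j. w (\<psi> ((inv \<psi> \<circ> \<phi>) j))) =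
          (\<Prod>j\<in>UNIV. w (\<phi> j) $ j) * det (\<chi> j. w (\<phi> j))"
      using inv by simp
  next
    fix p :: "'n \<Rightarrow> 'n" assume p: "p \<in> {p. p permutes UNIV}"
    have "inj \<psi>" using \<psi> by (auto simp: bij_betw_def)
    then show "inv \<psi> \<circ> (\<psi> \<circ> p) = p" by (simp add: fun_eq_iff)
    show "\<psi> \<circ> p \<in> enumerations"
      using p \<psi> by (auto simp: enumerations_def intro: bij_betw_trans permutes_bij)
  qed
  also have "\<dots> = (\<Sum>p | p permutes UNIV. (\<Prod>j\<in>UNIV. W $ p j $ j) * (of_int (sign p) * det W))"
    by (intro sum.cong refl arg_cong2[where f="(*)"])
       (simp_all add: W_def flip: det_permute_rows)
  also have "\<dots> = det (transpose W) * det W"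
  proof -
    have "det (transpose W) = (\<Sum>p | p permutes UNIV. of_int (sign p) * (\<Prod>j\<in>UNIV. W $ p j $ j))"
      by (simp add: det_def transpose_def)
    then show ?thesis by (simp add: sum_distrib_right mult_ac)
  qed
  also have "\<dots> = (det W)\<^sup>2" by (simp add: power2_eq_square)
  finally show ?thesis by simp
qed

lemma mixed_disc_nonneg:
  fixes A :: "nat \<Rightarrow> real^'n^'n"
  assumes "\<And>i. i < CARD('n) \<Longrightarrow> gram (A i)"
  shows "mixed_disc A \<ge> 0"
proof -
  \<comment> \<open>Induction on the number \<open>m\<close> of leading arguments not yet reduced to
    rank one; the inner rule induction breaks up the argument at position \<open>m\<close> by
    linearity.\<close>
  have "mixed_disc A \<ge> 0" if "m \<le> CARD('n)" "\<And>i. i < m \<Longrightarrow> gram (A i)"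
    "\<And>i. m \<le> i \<Longrightarrow> i < CARD('n) \<Longrightarrow> \<exists>w. A i = outer w" for m and A :: "nat \<Rightarrow> real^'n^'n"
    using that
  proof (induction m arbitrary: A)
    case 0
    then have "\<forall>i. \<exists>w. i < CARD('n) \<longrightarrow> A i = outer w" by auto
    then obtain w where w: "\<And>i. i < CARD('n) \<Longrightarrow> A i = outer (w i)" by metis
    have "mixed_disc A = mixed_disc (\<lambda>i. outer (w i))"
      by (rule mixed_disc_cong) (rule w)
    then show ?case using mixed_disc_outer[of w] by simp
  next
    case (Suc m)
    have m: "m < CARD('n)" using Suc.prems by simp
    have "mixed_disc (A(m := B)) \<ge> 0" if "gram B" for B
      using that
    proof (induction rule: gram.induct)
      case gram_zero
      have "mixed_disc (A(m := 0)) = 0" using mixed_disc_scale[OF m, of A 0 0] by simp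
      then show ?case by (simp del: fun_upd_apply)
    next
      case (gram_outer w)
      show ?case
      proof (rule Suc.IH)
        show "\<exists>v. (A(m := outer w)) i = outer v" if "m \<le> i" "i < CARD('n)" for i
          using that Suc.prems(3)[of i] by (cases "i = m") auto
      qed (use Suc.prems in auto)
    next
      case (gram_add B C)
      then show ?case unfolding mixed_disc_add[OF m] by (simp del: fun_upd_apply)
    qed
    from this[of "A m"] show ?case using Suc.prems by simp
  qed
  from this[of "CARD('n)" A] show ?thesis using assms by auto
qed

text \<open>The diagonal case: with all arguments equal, the mixed discriminant is a positive
  multiple of the determinant.\<close>

lemma gram_det_nonneg:
  assumes "gram (A :: real^'n^'n)"
  shows "det A \<ge> 0"
proof -
  obtain \<psi> :: "'n \<Rightarrow> nat" where "bij_betw \<psi> UNIV {0..<CARD('n)}"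
    using ex_bij_betw_finite_nat[of "UNIV :: 'n set"] by auto
  then have "enumerations \<noteq> ({} :: ('n \<Rightarrow> nat) set)" by (auto simp: enumerations_def)
  then have "card (enumerations :: ('n \<Rightarrow> nat) set) > 0"
    using finite_enumerations by (simp add: card_gt_0_iff)
  moreover have "0 \<le> mixed_disc (\<lambda>_. A)" by (rule mixed_disc_nonneg) (rule assms)
  moreover have "(\<chi> j. A $ j) = A" by (simp add: vec_eq_iff)
  ultimately show ?thesis by (simp add: mixed_disc_eq zero_le_mult_iff)
qed

section \<open>Change of variables for arbitrary finite index types\<close>

text \<open>The change of variables theorem of the library requires a well-ordered index type for the
  coordinates; reindexing by this ordered copy of a finite type removes that restriction.\<close>
typedef ('a::finite) index = "{..<CARD('a)}"
  by (auto intro!: exI[of _ 0])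

instantiation index :: (finite) "{finite, wellorder}"
begin

definition "i \<le> j \<longleftrightarrow> Rep_index i \<le> Rep_index j"
definition "i < j \<longleftrightarrow> Rep_index i < Rep_index j"

instance
proof
  fix P :: "'a index \<Rightarrow> bool" and a
  assume *: "\<And>x. (\<And>y. y < x \<Longrightarrow> P y) \<Longrightarrow> P x"
  show "P a" by (induction a rule: measure_induct_rule[where f = Rep_index])
    (rule *, simp add: less_index_def)
next
  show "finite (UNIV :: 'a index set)"
    by (rule finite_imageD[where f = Rep_index])
       (auto simp: inj_on_def Rep_index_inject type_definition.Rep_range[OF type_definition_index])
qed (auto simp: less_eq_index_def less_index_def Rep_index_inject)

end

lemma card_index: "CARD('a::finite index) = CARD('a)"
  using type_definition.card[OF type_definition_index] by simp

text \<open>Rows and columns are relabelled by the same bijection, so each permutation is conjugated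
  and keeps its sign.\<close>

lemma det_reindex:
  fixes A :: "real^'n^'n" and e :: "'m::finite \<Rightarrow> 'n::finite"
  assumes e: "bij e"
  shows "det (\<chi> i j. A $ e i $ e j) = det A"
proof -
  let ?f = "inv e"
  have f: "bij ?f" using e by (rule bij_imp_bij_inv)
  then have range: "?f x \<in> range ?f" "x' \<in> range ?f" for x x' by (auto simp: bij_def)
  have inv: "inv ?f = e" using e by (rule inv_inv_eq)
  have "det A = (\<Sum>p | p permutes UNIV. of_int (sign (map_permutation UNIV ?f p)) *
      (\<Prod>i\<in>UNIV. A $ e i $ e (map_permutation UNIV ?f p i)))"
    unfolding det_def
  proof (intro sum.cong refl arg_cong2[where f="(*)"])
    fix p :: "'n \<Rightarrow> 'n" assume p: "p \<in> {p. p permutes UNIV}"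
    show "real_of_int (sign p) = of_int (sign (map_permutation UNIV ?f p))"
      using p f by (subst sign_map_permutation) (auto simp: bij_def)
    have "e (map_permutation UNIV ?f p i) = p (e i)" for i
      using e range by (simp add: map_permutation_def inv bij_is_surj surj_f_inv_f)
    then show "(\<Prod>i\<in>UNIV. A $ i $ p i) = (\<Prod>i\<in>UNIV. A $ e i $ e (map_permutation UNIV ?f p i))"
      using prod.reindex_bij_betw[OF e, of "\<lambda>i. A $ i $ p i"] by simp
  qed
  also have "\<dots> = (\<Sum>p | p permutes UNIV. of_int (sign p) * (\<Prod>i\<in>UNIV. A $ e i $ e (p i)))"
    using sum.reindex_bij_betw[OF bij_betw_permutations[of ?f UNIV UNIV],
        of "\<lambda>p. of_int (sign p) * (\<Prod>i\<in>UNIV. A $ e i $ e (p i))"] f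
    by (simp add: map_permutation_def restrict_id_def bij_is_surj)
  also have "\<dots> = det (\<chi> i j. A $ e i $ e j)" by (simp add: det_def)
  finally show ?thesis ..
qed

lemma prod_Basis_cart: "(\<Prod>b\<in>Basis. v \<bullet> b) = (\<Prod>i\<in>UNIV. v $ i)" for v :: "real^'k"
proof -
  have "bij_betw (\<lambda>i. axis i (1::real) :: real^'k) UNIV Basis"
    by (auto simp: bij_betw_def inj_on_def axis_eq_axis Basis_vec_def)
  from prod.reindex_bij_betw[OF this, of "\<lambda>b. v \<bullet> b"]
  show ?thesis by (simp add: inner_axis)
qed

text \<open>Lebesgue measure is determined by boxes, and relabelling the coordinates only permutes
  the side lengths of a box.\<close>

lemma lborel_distr_reindex:
  fixes e :: "'m::finite \<Rightarrow> 'n::finite"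
  assumes e: "bij e"
  shows "distr lborel borel (\<lambda>x::real^'n. (\<chi> i. x $ e i) :: real^'m) = lborel"
proof (rule lborel_eqI[symmetric])
  fix l u :: "real^'m" assume "\<And>b. b \<in> Basis \<Longrightarrow> l \<bullet> b \<le> u \<bullet> b"
  then have le: "l $ i \<le> u $ i" for i
    by (metis axis_in_Basis_iff Basis_real_def cart_eq_inner_axis insertI1)
  have inv: "e (inv e j) = j" "inv e (e i) = i" for i j
    using e by (auto simp: bij_def surj_f_inv_f)
  have [measurable]: "(\<lambda>x::real^'n. (\<chi> i. x $ e i) :: real^'m) \<in> borel_measurable borel"
    by (intro borel_measurable_continuous_onI continuous_intros)
  have vim: "(\<lambda>x::real^'n. (\<chi> i. x $ e i) :: real^'m) -` box l u =
      box (\<chi> j. l $ inv e j) (\<chi> j. u $ inv e j)"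
  proof -
    have "(\<forall>i. P (e i) i) = (\<forall>j. P j (inv e j))" for P by (metis inv)
    from this[of "\<lambda>j i. l $ i < x $ j \<and> x $ j < u $ i" for x]
    show ?thesis by (auto simp: mem_box_cart)
  qed
  have "(\<Prod>j\<in>UNIV. u $ inv e j - l $ inv e j) = (\<Prod>i\<in>UNIV. u $ i - l $ i)"
    using prod.reindex_bij_betw[OF e, of "\<lambda>j. u $ inv e j - l $ inv e j"] by (simp add: inv)
  moreover have "emeasure lborel (box (\<chi> j. l $ inv e j) (\<chi> j. u $ inv e j :: real^'n))
      = ennreal (\<Prod>b\<in>Basis. ((\<chi> j. u $ inv e j) - (\<chi> j. l $ inv e j)) \<bullet> b)"
    by (rule emeasure_lborel_box) (auto simp: Basis_vec_def inner_axis le)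
  ultimately show "emeasure (distr lborel borel (\<lambda>x::real^'n. (\<chi> i. x $ e i) :: real^'m)) (box l u) =
      ennreal (\<Prod>b\<in>Basis. (u - l) \<bullet> b)"
    by (subst emeasure_distr) (simp_all add: vim prod_Basis_cart)
qed simp

text \<open>The space is a countable union of compact balls, and their images are compact.\<close>

lemma range_in_borel:
  fixes f :: "'a::euclidean_space \<Rightarrow> 'b::euclidean_space"
  assumes "continuous_on UNIV f"
  shows "range f \<in> sets borel"
proof -
  have "(UNIV :: 'a set) = (\<Union>n. cball 0 (real n))" by (auto simp: real_arch_simple)
  then have "range f = (\<Union>n. f ` cball 0 (real n))" by (metis image_UN)
  also have "\<dots> \<in> sets borel"
    by (intro sets.countable_UN image_subsetI borel_closed compact_imp_closed compact_continuous_image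
        continuous_on_subset[OF assms]) auto
  finally show ?thesis .
qed

lemma continuous_on_det:
  fixes A :: "'a::topological_space \<Rightarrow> real^'n^'n"
  assumes "continuous_on S A"
  shows "continuous_on S (\<lambda>x. det (A x))"
  unfolding det_def by (intro continuous_intros assms)

text \<open>The change of variables formula for an injective map. Boundedness of the range makes its
  measure finite, as required to pass from the gauge integral to the Lebesgue integral.\<close>

lemma nn_integral_jacobian_wellorder:
  fixes f :: "real^'n::{finite,wellorder} \<Rightarrow> real^'n::_"
  assumes der: "\<And>x. (f has_derivative (\<lambda>h. H x *v h)) (at x)"
    and "inj f" and H: "continuous_on UNIV H" and "bounded (range f)"
  shows "(\<integral>\<^sup>+x. ennreal \<bar>det (H x)\<bar> \<partial>lborel) = emeasure lborel (range f)"
proof -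
  have "continuous_on UNIV f"
    by (meson der has_derivative_continuous continuous_at_imp_continuous_on)
  then have borel: "range f \<in> sets borel" by (rule range_in_borel)
  then have lm: "range f \<in> lmeasurable"
    using \<open>bounded (range f)\<close> by (auto intro: bounded_set_imp_lmeasurable)
  have "((\<lambda>x. \<bar>det (matrix ((*v) (H x)))\<bar>) has_integral measure lebesgue (range f)) UNIV"
    using has_measure_differentiable_image[of UNIV f "\<lambda>x. (*v) (H x)" "measure lebesgue (range f)"]
      der \<open>inj f\<close> lm by (auto simp: has_derivative_at_withinI)
  then have "((\<lambda>x. \<bar>det (H x)\<bar>) has_integral measure lebesgue (range f)) UNIV"
    by simp
  then have "(\<integral>\<^sup>+x. ennreal \<bar>det (H x)\<bar> \<partial>lborel) = measure lebesgue (range f)"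
    by (intro nn_integral_has_integral_lborel borel_measurable_continuous_onI continuous_intros
        continuous_on_det H) auto
  also have "\<dots> = emeasure lborel (range f)"
  proof -
    have "emeasure lebesgue (range f) = ennreal (measure lebesgue (range f))"
      by (rule emeasure_eq_ennreal_measure) (use fmeasurableD2[OF lm] in \<open>simp add: top.not_eq_extremum\<close>)
    moreover have "emeasure lebesgue (range f) = emeasure lborel (range f)"
      using borel by simp
    ultimately show ?thesis by simp
  qed
  finally show ?thesis .
qed

lemma nn_integral_jacobian:
  fixes f :: "real^'n \<Rightarrow> real^'n"
  assumes der: "\<And>x. (f has_derivative (\<lambda>h. H x *v h)) (at x)"
    and "inj f" and H: "continuous_on UNIV H" and bdd: "bounded (range f)"
  shows "(\<integral>\<^sup>+x. ennreal \<bar>det (H x)\<bar> \<partial>lborel) = emeasure lborel (range f)"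
proof -
  obtain e :: "'n index \<Rightarrow> 'n" where e: "bij e"
    using finite_same_card_bij[of "UNIV :: 'n index set" "UNIV :: 'n set"] card_index by auto
  have inv[simp]: "e (inv e j) = j" "inv e (e i) = i" for i j
    using e by (auto simp: bij_def surj_f_inv_f)
  define T :: "real^'n \<Rightarrow> real^'n index" where "T x = (\<chi> i. x $ e i)" for x
  define T' :: "real^'n index \<Rightarrow> real^'n" where "T' y = (\<chi> j. y $ inv e j)" for y
  have TT'[simp]: "T (T' y) = y" "T' (T x) = x" for x y
    by (simp_all add: T_def T'_def vec_eq_iff)
  have lin: "bounded_linear T" "bounded_linear T'"
    unfolding linear_conv_bounded_linear[symmetric]
    by (auto intro!: linearI simp: T_def T'_def vec_eq_iff)
  note cont = linear_continuous_on[OF lin(1)] linear_continuous_on[OF lin(2)]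
  have meas[measurable]: "T \<in> borel_measurable borel" "T' \<in> borel_measurable borel"
    by (intro borel_measurable_continuous_onI cont)+
  have distr: "distr lborel borel T = lborel"
    unfolding T_def by (rule lborel_distr_reindex[OF e])
  \<comment> \<open>The Jacobian matrix of \<open>T \<circ> f \<circ> T'\<close>; rows and columns
    are relabelled alike, so its determinant is the old one.\<close>
  define H' :: "real^'n index \<Rightarrow> real^'n index^'n index" where
    "H' y = (\<chi> i j. H (T' y) $ e i $ e j)" for y
  have H'_mult: "H' y *v h = T (H (T' y) *v T' h)" for y h
    using sum.reindex_bij_betw[OF e, of "\<lambda>j. H (T' y) $ e i $ j * h $ inv e j" for i]
    by (simp add: T_def T'_def H'_def vec_eq_iff matrix_vector_mult_def)
  have der': "((T \<circ> f \<circ> T') has_derivative (\<lambda>h. H' y *v h)) (at y)" for y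
  proof -
    have "(T' has_derivative T') (at y)"
      using lin(2) by (rule bounded_linear_imp_has_derivative)
    from has_derivative_compose[OF this der]
    have "((\<lambda>y. f (T' y)) has_derivative (\<lambda>h. H (T' y) *v T' h)) (at y)" .
    from bounded_linear.has_derivative[OF lin(1) this]
    have "((\<lambda>y. T (f (T' y))) has_derivative (\<lambda>h. T (H (T' y) *v T' h))) (at y)" .
    then show ?thesis by (simp add: H'_mult o_def)
  qed
  have H_T': "continuous_on UNIV (\<lambda>y. H (T' y))"
    by (rule continuous_on_compose2[OF H cont(2)]) simp
  have H': "continuous_on UNIV H'"
    unfolding H'_def by (intro continuous_intros H_T')
  have rng: "range (T \<circ> f \<circ> T') = T ` range f"
  proof -
    have "range T' = UNIV" using TT'(2) by (metis surjI)
    then show ?thesis by (simp only: image_comp[symmetric])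
  qed
  have "(\<integral>\<^sup>+x. ennreal \<bar>det (H x)\<bar> \<partial>lborel) = (\<integral>\<^sup>+x. ennreal \<bar>det (H' (T x))\<bar> \<partial>lborel)"
    using det_reindex[OF e] by (simp add: H'_def)
  also have "\<dots> = (\<integral>\<^sup>+y. ennreal \<bar>det (H' y)\<bar> \<partial>distr lborel borel T)"
    by (subst nn_integral_distr)
       (auto intro!: borel_measurable_continuous_onI continuous_intros continuous_on_det H' measurable_compose[OF _ measurable_ennreal])
  also have "\<dots> = (\<integral>\<^sup>+y. ennreal \<bar>det (H' y)\<bar> \<partial>lborel)" by (simp only: distr)
  also have "\<dots> = emeasure lborel (range (T \<circ> f \<circ> T'))"
  proof (rule nn_integral_jacobian_wellorder[OF der' _ H'])
    show "inj (T \<circ> f \<circ> T')"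
    proof (intro inj_compose \<open>inj f\<close>)
      show "inj T" using TT'(2) by (rule inj_on_inverseI)
      show "inj T'" using TT'(1) by (rule inj_on_inverseI)
    qed
    show "bounded (range (T \<circ> f \<circ> T'))"
      unfolding rng using bdd lin(1) by (rule bounded_linear_image)
  qed
  also have "\<dots> = emeasure (distr lborel borel T) (T ` range f)"
    by (simp only: distr rng)
  also have "\<dots> = emeasure lborel (range f)"
  proof (subst emeasure_distr)
    have "continuous_on UNIV (T \<circ> f)"
      by (intro continuous_on_compose continuous_on_subset[OF cont(1)] continuous_at_imp_continuous_on)
         (use der has_derivative_continuous in blast)+
    from range_in_borel[OF this] show "T ` range f \<in> sets borel" by (simp add: image_comp)
    have "T -` (T ` range f) = range f" 
    proof -
      have "inj T" using TT'(2) by (rule inj_on_inverseI)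
      then show ?thesis by (rule inj_vimage_image_eq)
    qed
    then show "emeasure lborel (T -` (T ` range f) \<inter> space lborel) = emeasure lborel (range f)"
      by simp
  qed simp
  finally show ?thesis .
qed

section \<open>Convex potentials\<close>

definition mink_sum :: "'a::real_vector set \<Rightarrow> 'a set \<Rightarrow> 'a set" where
  "mink_sum K L = {x + y | x y. x \<in> K \<and> y \<in> L}"

lemma mink_sumI: "x \<in> K \<Longrightarrow> y \<in> L \<Longrightarrow> x + y \<in> mink_sum K L"
  by (auto simp: mink_sum_def)

lemma mink_sumE:
  assumes "z \<in> mink_sum K L" obtains x y where "z = x + y" "x \<in> K" "y \<in> L"
  using assms by (auto simp: mink_sum_def)

lemma convex_mink_sum:
  assumes "convex K" "convex L" shows "convex (mink_sum K L)"
proof -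
  have "mink_sum K L = (\<Union>x\<in>K. \<Union>y\<in>L. {x + y})" by (auto simp: mink_sum_def)
  then show ?thesis using convex_sums[OF assms] by simp
qed

lemma convex_body_mink_sum: "convex_body K \<Longrightarrow> convex_body L \<Longrightarrow> convex_body (mink_sum K L)"
  unfolding convex_body_def by (auto intro: convex_mink_sum) (auto simp: mink_sum_def intro!: compact_sums)

lemma convex_body_scaleR:
  "convex_body K \<Longrightarrow> convex_body ((*\<^sub>R) c ` K)"
  by (auto simp: convex_body_def intro: convex_scaling compact_scaling)

lemma msum_empty: "msum {} K = {0}"
  by (auto simp: msum_def)

lemma msum_insert:
  assumes "finite S" "a \<notin> S"
  shows "msum (insert a S) K = mink_sum (K a) (msum S K)"
proof (intro equalityI subsetI)
  fix z assume "z \<in> msum (insert a S) K"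
  then obtain f where "z = (\<Sum>i\<in>insert a S. f i)" "\<forall>i\<in>insert a S. f i \<in> K i"
    by (auto simp: msum_def)
  then show "z \<in> mink_sum (K a) (msum S K)"
    using assms by (auto simp: msum_def intro!: mink_sumI)
next
  fix z assume "z \<in> mink_sum (K a) (msum S K)"
  then obtain x y where z: "z = x + y" "x \<in> K a" "y \<in> msum S K" by (auto elim: mink_sumE)
  then obtain f where f: "y = (\<Sum>i\<in>S. f i)" "\<forall>i\<in>S. f i \<in> K i" by (auto simp: msum_def)
  have "(\<Sum>i\<in>S. (f(a := x)) i) = (\<Sum>i\<in>S. f i)" using assms by (intro sum.cong) auto
  then have "z = (\<Sum>i\<in>insert a S. (f(a := x)) i)"
    using assms z f by simp
  moreover have "\<forall>i\<in>insert a S. (f(a := x)) i \<in> K i" using z f by auto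
  ultimately show "z \<in> msum (insert a S) K" unfolding msum_def by blast
qed

lemma convex_body_msum:
  assumes "finite S" "\<And>i. i \<in> S \<Longrightarrow> convex_body (K i)"
  shows "convex_body (msum S K)"
  using assms
  by (induction S rule: finite_induct)
     (auto simp: msum_empty msum_insert intro: convex_body_mink_sum, simp add: convex_body_def)

text \<open>\<open>\<phi>\<close> is a smooth strictly convex function with gradient \<open>g\<close> and Hessian \<open>H\<close> which agrees
  with the support function of \<open>K\<close> up to a bounded error; then \<open>g\<close> maps the whole space
  injectively onto \<open>K\<close> up to boundary points.\<close>
definition potential ::
    "(real^'n \<Rightarrow> real) \<Rightarrow> (real^'n \<Rightarrow> real^'n) \<Rightarrow> (real^'n \<Rightarrow> real^'n^'n) \<Rightarrow> (real^'n) set \<Rightarrow> bool" where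
  "potential \<phi> g H K \<longleftrightarrow>
     (\<forall>x. (\<phi> has_derivative (\<lambda>h. g x \<bullet> h)) (at x)) \<and>
     (\<forall>x. (g has_derivative (\<lambda>h. H x *v h)) (at x)) \<and>
     continuous_on UNIV H \<and> (\<forall>x. gram (H x)) \<and> (\<forall>x h. h \<noteq> 0 \<longrightarrow> h \<bullet> (H x *v h) > 0) \<and>
     (\<forall>x. g x \<in> K) \<and> (\<exists>C. \<forall>x. \<forall>k\<in>K. k \<bullet> x - C \<le> \<phi> x)"

text \<open>The bounded errors simply add up. Hence sums of Hessians belong to Minkowski sums of
  bodies.\<close>

lemma potential_add:
  assumes "potential \<phi> g H K" "potential \<phi>' g' H' K'"
  shows "potential (\<lambda>x. \<phi> x + \<phi>' x) (\<lambda>x. g x + g' x) (\<lambda>x. H x + H' x) (mink_sum K K')"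
proof -
  obtain C C' where C: "\<And>x k. k \<in> K \<Longrightarrow> k \<bullet> x - C \<le> \<phi> x" "\<And>x k. k \<in> K' \<Longrightarrow> k \<bullet> x - C' \<le> \<phi>' x"
    using assms unfolding potential_def by metis
  have "(k + k') \<bullet> x - (C + C') \<le> \<phi> x + \<phi>' x" if "k \<in> K" "k' \<in> K'" for k k' x
    using C(1)[OF that(1), of x] C(2)[OF that(2), of x] by (simp add: inner_add_left)
  then have "\<exists>C. \<forall>x. \<forall>k\<in>mink_sum K K'. k \<bullet> x - C \<le> \<phi> x + \<phi>' x"
    by (intro exI[of _ "C + C'"]) (auto elim!: mink_sumE)
  moreover have "((\<lambda>x. \<phi> x + \<phi>' x) has_derivative (\<lambda>h. (g x + g' x) \<bullet> h)) (at x)" for x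
    using assms unfolding potential_def inner_add_left by (intro has_derivative_add) auto
  moreover have "((\<lambda>x. g x + g' x) has_derivative (\<lambda>h. (H x + H' x) *v h)) (at x)" for x
    using assms unfolding potential_def matrix_vector_mult_add_rdistrib
    by (intro has_derivative_add) auto
  moreover have "h \<bullet> ((H x + H' x) *v h) > 0" if "h \<noteq> 0" for x h
    using assms that unfolding potential_def
    by (simp add: matrix_vector_mult_add_rdistrib inner_add_right add_pos_pos)
  moreover have "continuous_on UNIV (\<lambda>x. H x + H' x)"
    using assms unfolding potential_def by (intro continuous_intros) auto
  moreover have "gram (H x + H' x)" "g x + g' x \<in> mink_sum K K'" for x
    using assms unfolding potential_def by (auto intro: gram_add mink_sumI)
  ultimately show ?thesis unfolding potential_def by blast
qed

lemma potential_scale: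
  assumes "potential \<phi> g H K" "0 < c"
  shows "potential (\<lambda>x. c * \<phi> x) (\<lambda>x. c *\<^sub>R g x) (\<lambda>x. c *\<^sub>R H x) ((*\<^sub>R) c ` K)"
proof -
  obtain C where C: "\<And>x k. k \<in> K \<Longrightarrow> k \<bullet> x - C \<le> \<phi> x"
    using assms unfolding potential_def by metis
  have "(c *\<^sub>R k) \<bullet> x - c * C \<le> c * \<phi> x" if "k \<in> K" for k x
    using mult_left_mono[OF C[OF that, of x], of c] \<open>0 < c\<close> by (simp add: algebra_simps)
  then have "\<exists>C. \<forall>x. \<forall>k\<in>(*\<^sub>R) c ` K. k \<bullet> x - C \<le> c * \<phi> x"
    by (intro exI[of _ "c * C"]) auto
  moreover have "((\<lambda>x. c * \<phi> x) has_derivative (\<lambda>h. (c *\<^sub>R g x) \<bullet> h)) (at x)" for x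
    using assms unfolding potential_def inner_scaleR_left by (intro has_derivative_mult_right) auto
  moreover have "((\<lambda>x. c *\<^sub>R g x) has_derivative (\<lambda>h. (c *\<^sub>R H x) *v h)) (at x)" for x
    using assms unfolding potential_def scaleR_matrix_vector_assoc[symmetric]
    by (intro has_derivative_scaleR_right) auto
  moreover have "h \<bullet> ((c *\<^sub>R H x) *v h) > 0" if "h \<noteq> 0" for x h
    using assms that unfolding potential_def by (simp add: scaleR_matrix_vector_assoc[symmetric])
  moreover have "continuous_on UNIV (\<lambda>x. c *\<^sub>R H x)"
    using assms unfolding potential_def by (intro continuous_intros) auto
  moreover have "gram (c *\<^sub>R H x)" "c *\<^sub>R g x \<in> (*\<^sub>R) c ` K" for x
    using assms unfolding potential_def by (auto intro: gram_scale)
  ultimately show ?thesis unfolding potential_def by blast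
qed

text \<open>An empty sum would have Hessian 0, which is not definite; the polarization formula omits
  the empty set as well.\<close>

lemma potential_msum:
  assumes "finite S" "S \<noteq> {}" "\<And>i. i \<in> S \<Longrightarrow> potential (\<phi> i) (g i) (H i) (K i)"
  shows "potential (\<lambda>x. \<Sum>i\<in>S. \<phi> i x) (\<lambda>x. \<Sum>i\<in>S. g i x) (\<lambda>x. \<Sum>i\<in>S. H i x) (msum S K)"
  using assms
proof (induction S rule: finite_ne_induct)
  case (singleton a)
  have "msum {a} K = K a" by (auto simp: msum_def)
  then show ?case using singleton by simp
next
  case (insert a S)
  then show ?case using potential_add[of "\<phi> a" "g a" "H a" "K a"] by (simp add: msum_insert)
qed

text \<open>Along the segment from \<open>x\<close> to \<open>y\<close> the component of
  \<open>g\<close> in direction \<open>y - x\<close> has positive derivative, so it differs at the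
  two ends.\<close>

lemma potential_inj:
  assumes "potential \<phi> g H K" shows "inj g"
proof (rule injI, rule ccontr)
  fix x y assume "g x = g y" "x \<noteq> y"
  define \<psi> where "\<psi> t = g (x + t *\<^sub>R (y - x)) \<bullet> (y - x)" for t :: real
  have "\<exists>D. DERIV \<psi> t :> D \<and> D > 0" for t
  proof (intro exI conjI)
    have "((\<lambda>t. x + t *\<^sub>R (y - x)) has_derivative (\<lambda>s. s *\<^sub>R (y - x))) (at t)"
      by (auto intro!: derivative_eq_intros)
    moreover have "(g has_derivative (\<lambda>h. H z *v h)) (at z)" for z
      using assms by (simp add: potential_def)
    ultimately have "((\<lambda>t. g (x + t *\<^sub>R (y - x))) has_derivative
        (\<lambda>s. H (x + t *\<^sub>R (y - x)) *v (s *\<^sub>R (y - x)))) (at t)"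
      by (rule has_derivative_compose)
    from has_derivative_inner_left[OF this]
    show "DERIV \<psi> t :> (H (x + t *\<^sub>R (y - x)) *v (y - x)) \<bullet> (y - x)"
      unfolding \<psi>_def has_field_derivative_def
      by (simp add: matrix_vector_mult_scaleR mult_commute_abs)
    show "(H (x + t *\<^sub>R (y - x)) *v (y - x)) \<bullet> (y - x) > 0"
      using assms \<open>x \<noteq> y\<close> unfolding potential_def by (subst inner_commute) simp
  qed
  then have "\<psi> 0 < \<psi> 1" using DERIV_pos_imp_increasing[of 0 1 \<psi>] by simp
  then show False using \<open>g x = g y\<close> by (simp add: \<psi>_def)
qed

text \<open>A minimum point of \<open>\<phi> x - y \<bullet> x\<close> has gradient
  \<open>g x = y\<close>. It exists because a ball of radius \<open>r\<close> around
  \<open>y\<close> inside \<open>K\<close> forces this function to grow at least like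
  \<open>r * norm x\<close>.\<close>

lemma potential_surj:
  assumes pot: "potential \<phi> g H K" and "y \<in> interior K"
  shows "y \<in> range g"
proof -
  obtain C where C: "\<And>x k. k \<in> K \<Longrightarrow> k \<bullet> x - C \<le> \<phi> x"
    using pot unfolding potential_def by metis
  obtain r where r: "r > 0" "cball y r \<subseteq> K"
    using \<open>y \<in> interior K\<close> mem_interior_cball by blast
  define F where "F x = \<phi> x - y \<bullet> x" for x
  have F_lower: "r * norm x - C \<le> F x" for x
  proof -
    \<comment> \<open>The point of the ball farthest in direction \<open>x\<close>; for
      \<open>x = 0\<close> division by zero gives \<open>y\<close> itself.\<close>
    have "y + (r / norm x) *\<^sub>R x \<in> cball y r" using r by (auto simp: dist_norm)
    from C[OF subsetD[OF r(2) this], of x] show ?thesis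
      by (cases "x = 0") (auto simp: F_def inner_add_left power2_norm_eq_inner[symmetric] power2_eq_square)
  qed
  have dF: "(F has_derivative (\<lambda>h. g x \<bullet> h - y \<bullet> h)) (at x)" for x
    using pot unfolding F_def potential_def by (auto intro!: derivative_eq_intros)
  \<comment> \<open>Outside this ball the linear lower bound already exceeds \<open>F 0\<close>; the
    summand 1 makes the radius positive.\<close>
  define R where "R = (\<bar>F 0\<bar> + \<bar>C\<bar>) / r + 1"
  have "R > 0" using r by (auto simp: R_def add_nonneg_pos)
  have "continuous_on (cball 0 R) F"
    by (intro continuous_at_imp_continuous_on ballI has_derivative_continuous[OF dF])
  then obtain z where z: "z \<in> cball 0 R" "\<And>x. x \<in> cball 0 R \<Longrightarrow> F z \<le> F x"
    using continuous_attains_inf[of "cball 0 R" F] \<open>R > 0\<close> by auto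
  have "F z \<le> F x" for x
  proof (cases "x \<in> cball 0 R")
    case False
    then have "r * R \<le> r * norm x" using r by simp
    moreover have "r * R = \<bar>F 0\<bar> + \<bar>C\<bar> + r" using r by (simp add: R_def field_simps)
    ultimately have "F 0 \<le> F x" using F_lower[of x] r by linarith
    then show ?thesis using z(2)[of 0] \<open>R > 0\<close> by simp
  qed (use z in auto)
  then have "(\<lambda>h. g z \<bullet> h - y \<bullet> h) = (\<lambda>h. 0)"
    by (intro has_derivative_local_min[OF dF]) auto
  then have "(g z - y) \<bullet> (g z - y) = 0" by (metis inner_diff_left)
  then show ?thesis by auto
qed

lemma potential_det_nonneg: "potential \<phi> g H K \<Longrightarrow> 0 \<le> det (H x)"
  using gram_det_nonneg by (auto simp: potential_def)

text \<open>The range of the gradient lies between the interior of \<open>K\<close> and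
  \<open>K\<close>, and the frontier of a convex set is a null set.\<close>

lemma emeasure_potential:
  assumes pot: "potential \<phi> g H K" and K: "convex_body K"
  shows "(\<integral>\<^sup>+x. ennreal (det (H x)) \<partial>lborel) = emeasure lborel K"
proof -
  have der: "(g has_derivative (\<lambda>h. H x *v h)) (at x)" for x using pot by (simp add: potential_def)
  have sub: "range g \<subseteq> K" using pot by (auto simp: potential_def)
  have K': "compact K" "convex K" using K by (auto simp: convex_body_def)
  have "continuous_on UNIV g"
    by (intro continuous_at_imp_continuous_on ballI has_derivative_continuous[OF der])
  then have borel: "range g \<in> sets borel" by (rule range_in_borel)
  have "(\<integral>\<^sup>+x. ennreal (det (H x)) \<partial>lborel) = (\<integral>\<^sup>+x. ennreal \<bar>det (H x)\<bar> \<partial>lborel)"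
    by (simp add: potential_det_nonneg[OF pot])
  also have "\<dots> = emeasure lborel (range g)"
    using pot sub compact_imp_bounded[OF K'(1)]
    by (intro nn_integral_jacobian der potential_inj[OF pot]) (auto simp: potential_def bounded_subset)
  also have "\<dots> = emeasure lborel K"
  proof (rule antisym)
    have "emeasure lborel K \<le> emeasure lborel (range g \<union> frontier K)"
    proof (rule emeasure_mono)
      show "K \<subseteq> range g \<union> frontier K"
        using potential_surj[OF pot] K' by (auto simp: frontier_def compact_imp_closed)
    qed (use borel in auto)
    also have "\<dots> = emeasure lborel (range g)"
      using borel negligible_convex_frontier[OF K'(2)]
      by (intro emeasure_Un_null_set)
         (auto simp: negligible_iff_null_sets null_sets_completion_iff)
    finally show "emeasure lborel K \<le> emeasure lborel (range g)" .
  qed (use sub K' in \<open>auto intro!: emeasure_mono borel_compact\<close>)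
  finally show ?thesis .
qed

lemma integral_potential:
  assumes pot: "potential \<phi> g H K" and K: "convex_body K"
  shows "has_bochner_integral lborel (\<lambda>x. det (H x)) (measure lebesgue K)"
proof (rule has_bochner_integral_nn_integral)
  show "(\<lambda>x. det (H x)) \<in> borel_measurable lborel"
    using pot by (auto simp: potential_def intro!: borel_measurable_continuous_onI continuous_on_det)
  show "AE x in lborel. 0 \<le> det (H x)" by (simp add: potential_det_nonneg[OF pot])
  have "compact K" using K by (simp add: convex_body_def)
  then have "emeasure lborel K = ennreal (measure lborel K)"
    using emeasure_compact_finite[of K] by (intro emeasure_eq_ennreal_measure) auto
  then show "(\<integral>\<^sup>+ x. ennreal (det (H x)) \<partial>lborel) = ennreal (measure lebesgue K)"
    using emeasure_potential[OF assms] borel_compact[OF \<open>compact K\<close>] by simp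
qed simp

text \<open>Every Minkowski sum in the polarization formula has the sum of the Hessians at its
  disposal, so the alternating sum moves under one integral and becomes a pointwise mixed
  discriminant.\<close>

lemma mixed_volume_potential:
  fixes K :: "nat \<Rightarrow> (real^'n) set"
  assumes "\<And>i. i < CARD('n) \<Longrightarrow> potential (\<phi> i) (g i) (H i) (K i)"
    and "\<And>i. i < CARD('n) \<Longrightarrow> convex_body (K i)"
  shows "has_bochner_integral lborel (\<lambda>x. mixed_disc (\<lambda>i. H i x)) (fact CARD('n) * mixed_volume K)"
proof -
  have "has_bochner_integral lborel (\<lambda>x. mixed_disc (\<lambda>i. H i x))
     (\<Sum>S\<in>Pow {0..<CARD('n)} - {{}}. (-1) ^ (CARD('n) - card S) * measure lebesgue (msum S K))"
    unfolding mixed_disc_def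
  proof (intro has_bochner_integral_sum has_bochner_integral_mult_right)
    fix S assume "S \<in> Pow {0..<CARD('n)} - {{}}"
    then have "finite S" "S \<noteq> {}" "\<And>i. i \<in> S \<Longrightarrow> i < CARD('n)" by (auto intro: finite_subset)
    then show "has_bochner_integral lborel (\<lambda>x. det (\<Sum>i\<in>S. H i x)) (measure lebesgue (msum S K))"
      using assms
      by (intro integral_potential[OF potential_msum[where \<phi>=\<phi> and g=g]] convex_body_msum) auto
  qed
  then show ?thesis by (simp add: mixed_volume_def)
qed

section \<open>Log-sum-exp potentials of finite point sets\<close>

definition lse_wt :: "'a::real_inner set \<Rightarrow> ('a \<Rightarrow> real) \<Rightarrow> 'a \<Rightarrow> 'a \<Rightarrow> real" where
  "lse_wt A c x v = c v * exp (v \<bullet> x) / (\<Sum>u\<in>A. c u * exp (u \<bullet> x))"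

definition lse :: "'a::real_inner set \<Rightarrow> ('a \<Rightarrow> real) \<Rightarrow> 'a \<Rightarrow> real" where
  "lse A c x = ln (\<Sum>u\<in>A. c u * exp (u \<bullet> x))"

definition lse_grad :: "'a::real_inner set \<Rightarrow> ('a \<Rightarrow> real) \<Rightarrow> 'a \<Rightarrow> 'a" where
  "lse_grad A c x = (\<Sum>v\<in>A. lse_wt A c x v *\<^sub>R v)"

text \<open>The covariance matrix of the points under the softmax weights \<open>lse_wt\<close>,
  with mean \<open>lse_grad\<close>. Written as a weighted sum of outer products it is a Gram matrix
  at sight.\<close>

definition lse_hess :: "(real^'n) set \<Rightarrow> (real^'n \<Rightarrow> real) \<Rightarrow> real^'n \<Rightarrow> real^'n^'n" where
  "lse_hess A c x = (\<Sum>v\<in>A. lse_wt A c x v *\<^sub>R outer (v - lse_grad A c x))"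

text \<open>Equivalently, the affine hull (not just the span) of \<open>A\<close> is the whole space.\<close>
definition spanning :: "'a::real_inner set \<Rightarrow> bool" where
  "spanning A \<longleftrightarrow> (\<forall>h. h \<noteq> 0 \<longrightarrow> (\<exists>v\<in>A. \<exists>w\<in>A. v \<bullet> h \<noteq> w \<bullet> h))"

abbreviation hull_potential :: "(real^'n) set \<Rightarrow> bool" where
  "hull_potential A \<equiv>
    potential (lse A (\<lambda>_. 1)) (lse_grad A (\<lambda>_. 1)) (lse_hess A (\<lambda>_. 1)) (convex hull A)"

lemma outer_mult_vec: "outer w *v h = (w \<bullet> h) *\<^sub>R w"
  by (simp add: outer_def vec_eq_iff matrix_vector_mult_def inner_vec_def sum_distrib_left mult_ac)

lemma continuous_on_outer: "continuous_on S f \<Longrightarrow> continuous_on S (\<lambda>x. outer (f x))"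
  unfolding outer_def by (intro continuous_intros)

lemma sum_mult_vec: "(\<Sum>i\<in>S. M i) *v h = (\<Sum>i\<in>S. M i *v h)"
  by (induction S rule: infinite_finite_induct) (auto simp: matrix_vector_mult_add_rdistrib)

text \<open>Differentiating the softmax weights yields the covariance. The variance in direction
  \<open>h\<close> vanishes only if all points have the same component along \<open>h\<close>, which
  \<open>spanning\<close> excludes. The logarithm of the sum dominates the logarithm of each term,
  so the error against the support function is at most the maximum of
  \<open>- ln (c v)\<close>.\<close>

lemma potential_lse:
  fixes A :: "(real^'n) set"
  assumes A: "finite A" "spanning A" and c: "\<And>v. v \<in> A \<Longrightarrow> c v > 0"
  shows "potential (lse A c) (lse_grad A c) (lse_hess A c) (convex hull A)"
proof -
  define Z where "Z x = (\<Sum>u\<in>A. c u * exp (u \<bullet> x))" for x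
  let ?p = "lse_wt A c" and ?g = "lse_grad A c"
  have "A \<noteq> {}" using A(2) by (auto simp: spanning_def dest!: spec[of _ 1])
  then have Z: "Z x > 0" for x unfolding Z_def using A c by (intro sum_pos) auto
  have p_eq: "?p x v = c v * exp (v \<bullet> x) / Z x" for x v by (simp add: lse_wt_def Z_def)
  have p_pos: "v \<in> A \<Longrightarrow> ?p x v > 0" for x v using Z c by (simp add: p_eq)
  have p_sum: "(\<Sum>v\<in>A. ?p x v) = 1" for x
    using Z[of x] by (simp add: p_eq sum_divide_distrib[symmetric]) (simp add: Z_def)
  have g_inner: "?g x \<bullet> h = (\<Sum>v\<in>A. ?p x v * (v \<bullet> h))" for x h
    by (simp add: lse_grad_def inner_sum_left)
  have dZ: "(Z has_derivative (\<lambda>h. Z x * (?g x \<bullet> h))) (at x)" for x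
  proof -
    have "(Z has_derivative (\<lambda>h. \<Sum>u\<in>A. c u * (exp (u \<bullet> x) * (u \<bullet> h)))) (at x)"
      unfolding Z_def by (auto intro!: derivative_eq_intros simp: mult_ac)
    moreover have "(\<Sum>u\<in>A. c u * (exp (u \<bullet> x) * (u \<bullet> h))) = Z x * (?g x \<bullet> h)" for h
      using Z[of x] by (simp add: g_inner p_eq sum_distrib_left mult_ac)
    ultimately show ?thesis by simp
  qed
  have d\<phi>: "(lse A c has_derivative (\<lambda>h. ?g x \<bullet> h)) (at x)" for x
  proof -
    have "((\<lambda>x. ln (Z x)) has_derivative (\<lambda>h. Z x * (?g x \<bullet> h) / Z x)) (at x)"
      using Z[of x] dZ[of x] by (auto intro!: derivative_eq_intros)
    then show ?thesis using Z[of x] by (simp add: lse_def[abs_def] Z_def)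
  qed
  have dp: "((\<lambda>x. ?p x v) has_derivative (\<lambda>h. ?p x v * ((v - ?g x) \<bullet> h))) (at x)" for x v
    unfolding p_eq using Z[of x] dZ[of x]
    by (auto intro!: derivative_eq_intros simp: inner_diff_left field_simps)
  \<comment> \<open>The outer factor of the covariance need not be centred, because the weighted
    deviations from the mean sum to zero.\<close>
  have Hh: "lse_hess A c x *v h = (\<Sum>v\<in>A. (?p x v * ((v - ?g x) \<bullet> h)) *\<^sub>R v)" for x h
  proof -
    have "(\<Sum>v\<in>A. ?p x v * ((v - ?g x) \<bullet> h)) = 0"
      using p_sum[of x]
      by (simp add: inner_diff_left right_diff_distrib sum_subtractf g_inner[symmetric] sum_distrib_right[symmetric])
    then have "(\<Sum>v\<in>A. (?p x v * ((v - ?g x) \<bullet> h)) *\<^sub>R ?g x) = 0"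
      by (simp add: scaleR_sum_left[symmetric])
    then show ?thesis
      by (simp add: lse_hess_def sum_mult_vec scaleR_matrix_vector_assoc[symmetric] outer_mult_vec
          scaleR_diff_right sum_subtractf)
  qed
  have dg: "(?g has_derivative (\<lambda>h. lse_hess A c x *v h)) (at x)" for x
    unfolding Hh unfolding lse_grad_def[abs_def]
    by (intro has_derivative_sum has_derivative_scaleR_left dp[unfolded lse_grad_def])
  have cg: "continuous_on UNIV ?g"
    by (intro continuous_at_imp_continuous_on ballI has_derivative_continuous[OF dg])
  have cp: "continuous_on UNIV (\<lambda>x. ?p x v)" for v
    by (intro continuous_at_imp_continuous_on ballI has_derivative_continuous[OF dp])
  have cH: "continuous_on UNIV (lse_hess A c)"
    unfolding lse_hess_def[abs_def] by (intro continuous_intros continuous_on_outer cg cp)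
  have gramH: "gram (lse_hess A c x)" for x
    unfolding lse_hess_def using p_pos by (intro gram_sum gram_scale gram_outer) (auto intro: less_imp_le)
  have pd: "h \<bullet> (lse_hess A c x *v h) > 0" if "h \<noteq> 0" for x h
  proof -
    have eq: "h \<bullet> (lse_hess A c x *v h) = (\<Sum>v\<in>A. ?p x v * ((v - ?g x) \<bullet> h)\<^sup>2)"
      by (simp add: lse_hess_def sum_mult_vec scaleR_matrix_vector_assoc[symmetric] outer_mult_vec
          inner_sum_right power2_eq_square inner_commute[of h] mult.assoc)
    obtain v w where vw: "v \<in> A" "w \<in> A" "v \<bullet> h \<noteq> w \<bullet> h"
      using A(2) \<open>h \<noteq> 0\<close> by (auto simp: spanning_def)
    then obtain u where "u \<in> A" "(u - ?g x) \<bullet> h \<noteq> 0"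
      by (metis inner_diff_left right_minus_eq)
    then show ?thesis unfolding eq
      using A p_pos by (intro sum_pos2[of _ u] mult_pos_pos mult_nonneg_nonneg less_imp_le[OF p_pos]) auto
  qed
  have g_in: "?g x \<in> convex hull A" for x
    unfolding convex_hull_finite[OF A(1)]
    using p_pos p_sum by (auto simp: lse_grad_def intro!: exI[of _ "?p x"] less_imp_le)
  have "\<exists>C. \<forall>x. \<forall>k\<in>convex hull A. k \<bullet> x - C \<le> lse A c x"
  proof (intro exI allI ballI)
    fix x k assume k: "k \<in> convex hull A"
    let ?C = "Max ((\<lambda>v. - ln (c v)) ` A)"
    have "A \<subseteq> {k. k \<bullet> x \<le> lse A c x + ?C}"
    proof
      fix v assume v: "v \<in> A"
      have "c v * exp (v \<bullet> x) \<le> Z x"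
        unfolding Z_def using A c v by (intro member_le_sum) (auto intro: less_imp_le)
      then have "ln (c v * exp (v \<bullet> x)) \<le> ln (Z x)" using c[OF v] Z by simp
      then have "ln (c v) + v \<bullet> x \<le> lse A c x" using c[OF v] by (simp add: ln_mult lse_def Z_def)
      moreover have "- ln (c v) \<le> ?C" using A v by (intro Max_ge) auto
      ultimately show "v \<in> {k. k \<bullet> x \<le> lse A c x + ?C}" by simp
    qed
    moreover have "convex {k. k \<bullet> x \<le> lse A c x + ?C}"
      using convex_halfspace_le[of x "lse A c x + ?C"] by (simp add: inner_commute)
    ultimately have "k \<in> {k. k \<bullet> x \<le> lse A c x + ?C}" using k hull_minimal by blast
    then show "k \<bullet> x - ?C \<le> lse A c x" by simp
  qed
  then show ?thesis
    unfolding potential_def using d\<phi> dg cH gramH pd g_in by blast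
qed

section \<open>Mixed volumes of polytopes\<close>

lemma convex_body_hull: "finite A \<Longrightarrow> A \<noteq> {} \<Longrightarrow> convex_body (convex hull A)"
  by (simp add: convex_body_def finite_imp_compact_convex_hull)

lemma spanning_nonempty: "spanning (A :: (real^'n) set) \<Longrightarrow> A \<noteq> {}"
  by (auto simp: spanning_def dest!: spec[of _ 1])

lemma spanning_mono: "spanning A \<Longrightarrow> A \<subseteq> B \<Longrightarrow> spanning B"
  unfolding spanning_def by blast

definition mv_last :: "(nat \<Rightarrow> (real^'n) set) \<Rightarrow> (real^'n) set \<Rightarrow> real" where
  "mv_last K L = mixed_volume (\<lambda>i. if i < CARD('n) - 1 then K i else L)"

lemma mv_last_potential:
  fixes K :: "nat \<Rightarrow> (real^'n) set"
  assumes "\<And>i. i < CARD('n) - 1 \<Longrightarrow> potential (\<phi> i) (g i) (H i) (K i)"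
    and "\<And>i. i < CARD('n) - 1 \<Longrightarrow> convex_body (K i)"
    and "potential \<phi>' g' H' L" "convex_body L"
  shows "has_bochner_integral lborel (\<lambda>x. mixed_disc ((\<lambda>i. H i x)(CARD('n) - 1 := H' x)))
     (fact CARD('n) * mv_last K L)"
proof -
  let ?k = "CARD('n) - 1"
  have "has_bochner_integral lborel (\<lambda>x. mixed_disc (\<lambda>i. (if i < ?k then H i else H') x))
      (fact CARD('n) * mv_last K L)"
    unfolding mv_last_def
    by (rule mixed_volume_potential[where \<phi> = "\<lambda>i. if i < ?k then \<phi> i else \<phi>'" and g = "\<lambda>i. if i < ?k then g i else g'"])
       (use assms in auto)
  also have "(\<lambda>x. mixed_disc (\<lambda>i. (if i < ?k then H i else H') x)) =
      (\<lambda>x. mixed_disc ((\<lambda>i. H i x)(?k := H' x)))"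
    by (intro ext mixed_disc_cong) auto
  finally show ?thesis .
qed

lemma mv_last_add_potential:
  fixes K :: "nat \<Rightarrow> (real^'n) set"
  assumes K: "\<And>i. i < CARD('n) - 1 \<Longrightarrow> potential (\<phi> i) (g i) (H i) (K i)"
    "\<And>i. i < CARD('n) - 1 \<Longrightarrow> convex_body (K i)"
    and L: "potential \<phi>1 g1 H1 L" "convex_body L" and M: "potential \<phi>2 g2 H2 M" "convex_body M"
  shows "mv_last K (mink_sum L M) = mv_last K L + mv_last K M"
proof -
  let ?D = "\<lambda>B x. mixed_disc ((\<lambda>i. H i x)(CARD('n) - 1 := B x))"
  have sum: "has_bochner_integral lborel (?D (\<lambda>x. H1 x + H2 x)) (fact CARD('n) * mv_last K (mink_sum L M))"
    by (rule mv_last_potential) (fact K potential_add[OF L(1) M(1)] convex_body_mink_sum[OF L(2) M(2)])+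
  have "has_bochner_integral lborel (?D H1) (fact CARD('n) * mv_last K L)"
    by (rule mv_last_potential) (fact K L)+
  moreover have "has_bochner_integral lborel (?D H2) (fact CARD('n) * mv_last K M)"
    by (rule mv_last_potential) (fact K M)+
  ultimately have "has_bochner_integral lborel (\<lambda>x. ?D H1 x + ?D H2 x)
     (fact CARD('n) * mv_last K L + fact CARD('n) * mv_last K M)"
    by (rule has_bochner_integral_add)
  then have "has_bochner_integral lborel (?D (\<lambda>x. H1 x + H2 x))
     (fact CARD('n) * mv_last K L + fact CARD('n) * mv_last K M)"
    by (subst mixed_disc_add) simp_all
  from has_bochner_integral_eq[OF sum this]
  have "fact CARD('n) * mv_last K (mink_sum L M) =
     fact CARD('n) * (mv_last K L + mv_last K M)"
    by (simp only: distrib_left)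
  then show ?thesis by simp
qed

lemma mv_last_scale_potential:
  fixes K :: "nat \<Rightarrow> (real^'n) set"
  assumes K: "\<And>i. i < CARD('n) - 1 \<Longrightarrow> potential (\<phi> i) (g i) (H i) (K i)"
    "\<And>i. i < CARD('n) - 1 \<Longrightarrow> convex_body (K i)"
    and L: "potential \<phi>1 g1 H1 L" "convex_body L" and "0 < c"
  shows "mv_last K ((*\<^sub>R) c ` L) = c * mv_last K L"
proof -
  let ?D = "\<lambda>B x. mixed_disc ((\<lambda>i. H i x)(CARD('n) - 1 := B x))"
  have scale: "has_bochner_integral lborel (?D (\<lambda>x. c *\<^sub>R H1 x)) (fact CARD('n) * mv_last K ((*\<^sub>R) c ` L))"
    by (rule mv_last_potential) (fact K potential_scale[OF L(1) \<open>0 < c\<close>] convex_body_scaleR[OF L(2)])+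
  have "has_bochner_integral lborel (?D H1) (fact CARD('n) * mv_last K L)"
    by (rule mv_last_potential) (fact K L)+
  then have "has_bochner_integral lborel (\<lambda>x. c * ?D H1 x) (c * (fact CARD('n) * mv_last K L))"
    by (intro has_bochner_integral_mult_right) simp
  then have "has_bochner_integral lborel (?D (\<lambda>x. c *\<^sub>R H1 x)) (c * (fact CARD('n) * mv_last K L))"
    by (subst mixed_disc_scale) simp_all
  from has_bochner_integral_eq[OF scale this]
  have "fact CARD('n) * mv_last K ((*\<^sub>R) c ` L) = fact CARD('n) * (c * mv_last K L)"
    by simp
  then show ?thesis by simp
qed

lemma mv_last_nonneg_potential:
  fixes K :: "nat \<Rightarrow> (real^'n) set"
  assumes K: "\<And>i. i < CARD('n) - 1 \<Longrightarrow> potential (\<phi> i) (g i) (H i) (K i)"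
    "\<And>i. i < CARD('n) - 1 \<Longrightarrow> convex_body (K i)"
    and L: "potential \<phi>1 g1 H1 L" "convex_body L"
  shows "0 \<le> mv_last K L"
proof -
  have gram: "gram (((\<lambda>i. H i x)(CARD('n) - 1 := H1 x)) i)" if "i < CARD('n)" for i x
    using K(1)[of i] L(1) that by (auto simp: potential_def)
  have disc_nonneg: "0 \<le> mixed_disc ((\<lambda>i. H i x)(CARD('n) - 1 := H1 x))" for x
    by (rule mixed_disc_nonneg) (rule gram)
  have "has_bochner_integral lborel (\<lambda>x. mixed_disc ((\<lambda>i. H i x)(CARD('n) - 1 := H1 x)))
     (fact CARD('n) * mv_last K L)"
    by (rule mv_last_potential) (fact K L)+
  from has_bochner_integral_integral_eq[OF this]
  have "0 \<le> fact CARD('n) * mv_last K L"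
    using Bochner_Integration.integral_nonneg[of lborel "\<lambda>x. mixed_disc ((\<lambda>i. H i x)(CARD('n) - 1 := H1 x))"]
      disc_nonneg by simp
  then show ?thesis using fact_gt_zero[of "CARD('n)", where 'a=real] by (simp only: zero_le_mult_iff) linarith
qed

section \<open>Monotonicity for polytopes by degenerating weights\<close>

lemma tendsto_mixed_disc:
  fixes A :: "'b \<Rightarrow> nat \<Rightarrow> real^'n^'n"
  assumes "\<And>i. ((\<lambda>m. A m i) \<longlongrightarrow> B i) F"
  shows "((\<lambda>m. mixed_disc (A m)) \<longlongrightarrow> mixed_disc B) F"
  unfolding mixed_disc_def det_def by (intro tendsto_intros assms)

lemma tendsto_outer: "(f \<longlongrightarrow> w) F \<Longrightarrow> ((\<lambda>m. outer (f m)) \<longlongrightarrow> outer w) F"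
  unfolding outer_def by (intro tendsto_intros)

lemma tendsto_lse_hess:
  fixes A :: "(real^'n) set"
  assumes "\<And>v. v \<in> A \<Longrightarrow> ((\<lambda>m. c m v) \<longlongrightarrow> b v) F"
    and nz: "(\<Sum>u\<in>A. b u * exp (u \<bullet> x)) \<noteq> 0"
  shows "((\<lambda>m. lse_hess A (c m) x) \<longlongrightarrow> lse_hess A b x) F"
proof -
  have wt: "((\<lambda>m. lse_wt A (c m) x v) \<longlongrightarrow> lse_wt A b x v) F" if "v \<in> A" for v
    unfolding lse_wt_def by (intro tendsto_intros assms nz that)
  then have "((\<lambda>m. lse_grad A (c m) x) \<longlongrightarrow> lse_grad A b x) F"
    unfolding lse_grad_def by (intro tendsto_intros)
  then show ?thesis
    unfolding lse_hess_def by (intro tendsto_intros tendsto_outer wt)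
qed

text \<open>Points of weight zero drop out of all sums. This identifies the limit of the Hessians
  when the weights on \<open>C - B\<close> tend to zero.\<close>

lemma lse_hess_indicator:
  fixes B C :: "(real^'n) set"
  assumes "finite C" "B \<subseteq> C"
  shows "lse_hess C (indicator B) x = lse_hess B (\<lambda>_. 1) x"
proof -
  have wt: "lse_wt C (indicator B) x v = indicator B v * lse_wt B (\<lambda>_. 1) x v" for v
  proof -
    have "(\<Sum>u\<in>C. indicator B u * exp (u \<bullet> x)) = (\<Sum>u\<in>B. exp (u \<bullet> x))"
      using assms by (intro sum.mono_neutral_cong_right) (auto simp: indicator_def)
    then show ?thesis by (simp add: lse_wt_def)
  qed
  have "lse_grad C (indicator B) x = lse_grad B (\<lambda>_. 1) x"
    unfolding lse_grad_def wt using assms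
    by (intro sum.mono_neutral_cong_right) (auto simp: indicator_def)
  then show ?thesis
    unfolding lse_hess_def wt using assms
    by (intro sum.mono_neutral_cong_right) (auto simp: indicator_def)
qed

text \<open>Giving the points of \<open>C - B\<close> the weight \<open>1 / (m + 1)\<close> in the potential of \<open>convex hull C\<close>
  does not change its mixed volumes, while the Hessians converge to those of the potential of
  \<open>convex hull B\<close>; Fatou's lemma yields monotonicity.\<close>
lemma mv_last_mono_hull:
  fixes K :: "nat \<Rightarrow> (real^'n) set"
  assumes K: "\<And>i. i < CARD('n) - 1 \<Longrightarrow> potential (\<phi> i) (g i) (H i) (K i)"
    "\<And>i. i < CARD('n) - 1 \<Longrightarrow> convex_body (K i)"
    and C: "finite C" and B: "B \<subseteq> C" "spanning B"
  shows "mv_last K (convex hull B) \<le> mv_last K (convex hull C)"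
proof -
  let ?k = "CARD('n) - 1"
  have fB: "finite B" and sC: "spanning C" using B C by (auto intro: finite_subset spanning_mono)
  have ne: "B \<noteq> {}" "C \<noteq> {}" using B(2) sC by (auto dest: spanning_nonempty)
  \<comment> \<open>On \<open>B\<close> the weight is 1 + 1 / (m + 1), which still tends to 1; off
    \<open>B\<close> it is positive for every \<open>m\<close> but vanishes in the limit.\<close>
  define c :: "nat \<Rightarrow> real^'n \<Rightarrow> real" where "c m v = indicator B v + 1 / real (Suc m)" for m v
  have c_pos: "c m v > 0" for m v by (auto simp: c_def indicator_def add_pos_pos)
  define D where "D m x = mixed_disc ((\<lambda>i. H i x)(?k := lse_hess C (c m) x))" for m x
  define D' where "D' x = mixed_disc ((\<lambda>i. H i x)(?k := lse_hess B (\<lambda>_. 1) x))" for x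
  have potC: "potential (lse C (c m)) (lse_grad C (c m)) (lse_hess C (c m)) (convex hull C)" for m
    by (rule potential_lse[OF C sC c_pos])
  have potB: "hull_potential B"
    by (rule potential_lse[OF fB B(2)]) simp
  have intD: "has_bochner_integral lborel (D m) (fact CARD('n) * mv_last K (convex hull C))" for m
    unfolding D_def by (rule mv_last_potential) (fact K potC convex_body_hull[OF C ne(2)])+
  have intD': "has_bochner_integral lborel D' (fact CARD('n) * mv_last K (convex hull B))"
    unfolding D'_def by (rule mv_last_potential) (fact K potB convex_body_hull[OF fB ne(1)])+
  have D_nonneg: "D m x \<ge> 0" for m x
    unfolding D_def using K(1) potC[of m] by (intro mixed_disc_nonneg) (auto simp: potential_def)
  have D'_nonneg: "D' x \<ge> 0" for x
    unfolding D'_def using K(1) potB by (intro mixed_disc_nonneg) (auto simp: potential_def)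
  have lim: "(\<lambda>m. D m x) \<longlonglongrightarrow> D' x" for x
    unfolding D_def D'_def
  proof (intro tendsto_mixed_disc)
    fix i
    have "(\<Sum>u\<in>C. indicator B u * exp (u \<bullet> x)) = (\<Sum>u\<in>B. exp (u \<bullet> x))"
      using C B by (intro sum.mono_neutral_cong_right) auto
    also have "\<dots> > 0" using fB ne by (intro sum_pos) auto
    finally have nz: "(\<Sum>u\<in>C. indicator B u * exp (u \<bullet> x)) \<noteq> (0::real)" by simp
    have "(\<lambda>m. c m v) \<longlonglongrightarrow> indicator B v + 0" for v
      unfolding c_def using LIMSEQ_inverse_real_of_nat
      by (intro tendsto_add tendsto_const) (simp add: inverse_eq_divide)
    then have "(\<lambda>m. lse_hess C (c m) x) \<longlonglongrightarrow> lse_hess C (indicator B) x"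
      by (intro tendsto_lse_hess nz) simp
    then show "(\<lambda>m. ((\<lambda>i. H i x)(?k := lse_hess C (c m) x)) i) \<longlonglongrightarrow> ((\<lambda>i. H i x)(?k := lse_hess B (\<lambda>_. 1) x)) i"
      using C B by (simp add: lse_hess_indicator)
  qed
  have eqB: "(\<integral>\<^sup>+x. ennreal (D' x) \<partial>lborel) = ennreal (fact CARD('n) * mv_last K (convex hull B))"
    using intD' D'_nonneg by (auto simp: has_bochner_integral_iff nn_integral_eq_integral)
  have eqC: "(\<integral>\<^sup>+x. ennreal (D m x) \<partial>lborel) = ennreal (fact CARD('n) * mv_last K (convex hull C))" for m
    using intD[of m] D_nonneg by (auto simp: has_bochner_integral_iff nn_integral_eq_integral)
  have "(\<integral>\<^sup>+x. ennreal (D' x) \<partial>lborel) = (\<integral>\<^sup>+x. liminf (\<lambda>m. ennreal (D m x)) \<partial>lborel)"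
    using lim by (intro nn_integral_cong sym[OF lim_imp_Liminf]) (auto intro: tendsto_ennrealI)
  also have "\<dots> \<le> liminf (\<lambda>m. \<integral>\<^sup>+x. ennreal (D m x) \<partial>lborel)"
  proof (rule nn_integral_liminf)
    show "(\<lambda>x. ennreal (D m x)) \<in> borel_measurable lborel" for m
      using borel_measurable_has_bochner_integral[OF intD[of m]] by simp
  qed
  also have "\<dots> = ennreal (fact CARD('n) * mv_last K (convex hull C))"
    unfolding eqC by (simp add: Liminf_const)
  finally have "ennreal (fact CARD('n) * mv_last K (convex hull B))
      \<le> ennreal (fact CARD('n) * mv_last K (convex hull C))"
    unfolding eqB .
  \<comment> \<open>\<open>ennreal\<close> sends negative numbers to 0, so the inequality returns to
    the reals only once its right side is known to be nonnegative.\<close>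
  moreover have "0 \<le> mv_last K (convex hull C)"
    by (rule mv_last_nonneg_potential) (fact K potC[of 0] convex_body_hull[OF C ne(2)])+
  ultimately show ?thesis by (simp add: ennreal_le_iff)
qed

text \<open>Otherwise the hull would lie in a hyperplane, which contains no ball.\<close>

lemma spanning_if_cball:
  fixes A :: "(real^'n) set"
  assumes "cball x r \<subseteq> convex hull A" "0 < r"
  shows "spanning A"
  unfolding spanning_def
proof (intro allI impI, rule ccontr)
  fix h :: "real^'n" assume "h \<noteq> 0" and *: "\<not> (\<exists>v\<in>A. \<exists>w\<in>A. v \<bullet> h \<noteq> w \<bullet> h)"
  have "x \<in> convex hull A" using assms by auto
  then have "A \<noteq> {}" by auto
  then obtain a where a: "a \<in> A" by auto
  have "v \<bullet> h = a \<bullet> h" if "v \<in> A" for v using * a that by blast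
  then have "A \<subseteq> {v. h \<bullet> v = h \<bullet> a}" by (auto simp: inner_commute[of h])
  then have sub: "convex hull A \<subseteq> {v. h \<bullet> v = h \<bullet> a}"
    by (intro hull_minimal convex_hyperplane)
  have "x + (r / norm h) *\<^sub>R h \<in> cball x r" using assms by (auto simp: dist_norm)
  then have "x + (r / norm h) *\<^sub>R h \<in> {v. h \<bullet> v = h \<bullet> a}" using sub assms(1) by blast
  moreover have "x \<in> {v. h \<bullet> v = h \<bullet> a}" using sub \<open>x \<in> convex hull A\<close> by blast
  ultimately have "(r / norm h) * (h \<bullet> h) = 0"
    by (simp only: mem_Collect_eq inner_add_right inner_scaleR_right)
  then show False using \<open>h \<noteq> 0\<close> assms by simp
qed

section \<open>Approximation of convex bodies by polytopes from outside\<close>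

abbreviation nbhd :: "'a::real_normed_vector set \<Rightarrow> real \<Rightarrow> 'a set" where
  "nbhd K r \<equiv> mink_sum K (cball 0 r)"

text \<open>Cover \<open>K\<close> by finitely many small balls, put a cube around each, and take
  all vertices. The cubes have interior, so the polytope does too, even if \<open>K\<close> is
  lower-dimensional.\<close>

lemma outer_polytope:
  fixes K :: "(real^'n) set"
  assumes K: "convex_body K" and "0 < e"
  obtains A where "finite A" "spanning A" "K \<subseteq> convex hull A" "convex hull A \<subseteq> nbhd K e"
proof -
  \<comment> \<open>A cube of half side \<open>d\<close> stays within l1-distance
    \<open>CARD('n) * d = e\<close> of its centre.\<close>
  define d where "d = e / CARD('n)"
  have d: "d > 0" using \<open>0 < e\<close> by (simp add: d_def)
  define w :: "real^'n" where "w = (\<Sum>i\<in>Basis. d *\<^sub>R i)"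
  have v: "w $ i = d" for i
  proof -
    have "w = (\<chi> i. d)" unfolding w_def by (rule const_vector_cart[symmetric])
    then show ?thesis by simp
  qed
  have cball_sub: "cball x d \<subseteq> cbox (x - w) (x + w)" for x
  proof
    fix y assume "y \<in> cball x d"
    then have "\<bar>y $ i - x $ i\<bar> \<le> d" for i
      using component_le_norm_cart[of "y - x" i] by (simp add: dist_norm norm_minus_commute)
    then show "y \<in> cbox (x - w) (x + w)"
      by (auto simp: mem_box_cart v abs_le_iff algebra_simps)
  qed
  have cbox_sub: "y - x \<in> cball 0 e" if "y \<in> cbox (x - w) (x + w)" for x y
  proof -
    have "\<bar>(y - x) $ i\<bar> \<le> d" for i
      using that by (auto simp: mem_box_cart v abs_le_iff algebra_simps)
    then have "(\<Sum>i\<in>UNIV. \<bar>(y - x) $ i\<bar>) \<le> (\<Sum>i\<in>(UNIV::'n set). d)" by (intro sum_mono)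
    also have "\<dots> = e" by (simp add: d_def)
    finally show ?thesis using norm_le_l1_cart[of "y - x"] by (simp del: vector_minus_component)
  qed
  have "\<exists>S. finite S \<and> cbox (x - w) (x + w) = convex hull S" for x :: "real^'n"
    using cube_convex_hull[OF d, of x] unfolding w_def by metis
  then obtain S where S: "\<And>x. finite (S x)" "\<And>x. cbox (x - w) (x + w) = convex hull (S x)"
    by metis
  have comp: "compact K" "convex K" "K \<noteq> {}" using K by (auto simp: convex_body_def)
  have "K \<subseteq> (\<Union>x\<in>K. ball x d)" using d by auto
  then obtain T where T: "T \<subseteq> K" "finite T" "K \<subseteq> (\<Union>x\<in>T. ball x d)"
    using compactE_image[OF comp(1), of K "\<lambda>x. ball x d"] by auto
  define A where "A = (\<Union>x\<in>T. S x)"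
  have hull: "cball x d \<subseteq> convex hull A" if "x \<in> T" for x
    using cball_sub[of x] S(2)[of x] that hull_mono[of "S x" A] by (auto simp: A_def)
  show ?thesis
  proof
    show "finite A" using T S by (auto simp: A_def)
    obtain x where "x \<in> T" using T comp by auto
    then show "spanning A" using hull spanning_if_cball d by blast
    show "K \<subseteq> convex hull A" using T hull by fastforce
    show "convex hull A \<subseteq> nbhd K e"
    proof (rule hull_minimal)
      show "convex (nbhd K e)" using comp by (intro convex_mink_sum) auto
      show "A \<subseteq> nbhd K e"
      proof
        fix y assume "y \<in> A"
        then obtain x where "x \<in> T" "y \<in> S x" by (auto simp: A_def)
        then have "y - x \<in> cball 0 e" using S(2)[of x] cbox_sub[of y x] by (auto intro: hull_inc)
        then have "x + (y - x) \<in> nbhd K e" using \<open>x \<in> T\<close> T by (intro mink_sumI) auto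
        then show "y \<in> nbhd K e" by simp
      qed
    qed
  qed
qed

text \<open>The closed neighbourhoods decrease to the compact set, so continuity of the measure from
  above applies.\<close>

lemma tendsto_measure_nbhd:
  fixes T :: "'a::euclidean_space set"
  assumes "compact T" "T \<noteq> {}"
  shows "(\<lambda>k. measure lebesgue {x. infdist x T \<le> 1 / real (Suc k)}) \<longlonglongrightarrow> measure lebesgue T"
proof -
  let ?A = "\<lambda>k. {x. infdist x T \<le> 1 / real (Suc k)}"
  have comp: "compact (?A k)" for k using assms by (intro compact_infdist_le) auto
  have "(\<lambda>k. measure lborel (?A k)) \<longlonglongrightarrow> measure lborel (\<Inter>k. ?A k)"
  proof (rule Lim_measure_decseq)
    show "range ?A \<subseteq> sets lborel" using comp by (auto intro: borel_compact)
    show "decseq ?A"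
    proof (intro decseq_SucI Collect_mono impI)
      fix n x assume "infdist x T \<le> 1 / real (Suc (Suc n))"
      also have "\<dots> \<le> 1 / real (Suc n)" by (simp add: frac_le)
      finally show "infdist x T \<le> 1 / real (Suc n)" .
    qed
    show "emeasure lborel (?A i) \<noteq> \<infinity>" for i using emeasure_compact_finite[OF comp[of i]] by simp
  qed
  moreover have "(\<Inter>k. ?A k) = T"
  proof
    show "(\<Inter>k. ?A k) \<subseteq> T"
    proof
      fix x assume "x \<in> (\<Inter>k. ?A k)"
      then have "\<And>k. infdist x T \<le> 1 / real (Suc k)" by auto
      then have "infdist x T \<le> 0"
        using LIMSEQ_inverse_real_of_nat by (intro LIMSEQ_le_const[of _ 0]) (auto simp: inverse_eq_divide)
      then have "infdist x T = 0" using infdist_nonneg[of x T] by simp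
      then show "x \<in> T" using assms by (subst in_closed_iff_infdist_zero) (auto intro: compact_imp_closed)
    qed
  qed auto
  ultimately show ?thesis using comp assms by (simp add: borel_compact)
qed

lemma msum_mono: "(\<And>i. i \<in> S \<Longrightarrow> K i \<subseteq> L i) \<Longrightarrow> msum S K \<subseteq> msum S L"
  unfolding msum_def by blast

lemma msum_nbhd:
  fixes K :: "nat \<Rightarrow> 'a::real_normed_vector set" and r :: real
  assumes "finite S" "\<And>i. i \<in> S \<Longrightarrow> P i \<subseteq> nbhd (K i) r" "x \<in> msum S P"
  shows "infdist x (msum S K) \<le> card S * r"
proof -
  obtain f where f: "x = (\<Sum>i\<in>S. f i)" "\<forall>i\<in>S. f i \<in> P i" using assms(3) by (auto simp: msum_def)
  then have "\<forall>i\<in>S. \<exists>y z. f i = y + z \<and> y \<in> K i \<and> norm z \<le> r"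
    using assms(2) by (auto simp: mink_sum_def) blast
  then obtain y z where yz: "\<And>i. i \<in> S \<Longrightarrow> f i = y i + z i \<and> y i \<in> K i \<and> norm (z i) \<le> r" by metis
  have "(\<Sum>i\<in>S. y i) \<in> msum S K" using yz by (auto simp: msum_def)
  moreover have "x - (\<Sum>i\<in>S. y i) = (\<Sum>i\<in>S. z i)"
    using f yz by (simp add: sum_subtractf[symmetric])
  moreover have "norm (\<Sum>i\<in>S. z i) \<le> card S * r" using yz by (intro sum_norm_bound) auto
  ultimately show ?thesis by (intro infdist_le2[of "\<Sum>i\<in>S. y i"]) (auto simp: dist_norm)
qed

text \<open>Each Minkowski sum of the \<open>P m i\<close> contains that of the \<open>K i\<close>
  and lies within distance \<open>card S * r m\<close> of it, so every volume in the polarization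
  formula converges from above.\<close>

lemma tendsto_mixed_volume:
  fixes K :: "nat \<Rightarrow> (real^'n) set"
  assumes K: "\<And>i. i < CARD('n) \<Longrightarrow> convex_body (K i)"
    and P: "\<And>i m. i < CARD('n) \<Longrightarrow> convex_body (P m i)"
    and sub: "\<And>i m. i < CARD('n) \<Longrightarrow> K i \<subseteq> P m i"
      "\<And>i m. i < CARD('n) \<Longrightarrow> P m i \<subseteq> nbhd (K i) (r m)"
    and r: "r \<longlonglongrightarrow> 0"
  shows "(\<lambda>m. mixed_volume (P m)) \<longlonglongrightarrow> mixed_volume K"
  unfolding mixed_volume_def
proof (intro tendsto_mult tendsto_const tendsto_sum)
  fix S assume "S \<in> Pow {0..<CARD('n)} - {{}}"
  then have S: "finite S" "\<And>i. i \<in> S \<Longrightarrow> i < CARD('n)" by (auto intro: finite_subset)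
  let ?T = "msum S K"
  have T: "convex_body ?T" using S K by (intro convex_body_msum) auto
  then have T': "compact ?T" "?T \<noteq> {}" by (auto simp: convex_body_def)
  have PS: "compact (msum S (P m))" for m
    using convex_body_msum[of S "P m"] S P by (auto simp: convex_body_def)
  have nb: "compact {x. infdist x ?T \<le> e}" if "e > 0" for e
    using T' that by (intro compact_infdist_le) auto
  have lower: "measure lebesgue ?T \<le> measure lebesgue (msum S (P m))" for m
    using sub(1) S PS T' by (intro measure_mono_fmeasurable msum_mono)
      (auto intro: lmeasurable_compact fmeasurableD)
  show "(\<lambda>m. measure lebesgue (msum S (P m))) \<longlonglongrightarrow> measure lebesgue ?T"
  proof (rule order_tendstoI)
    fix a assume "a < measure lebesgue ?T"
    then show "\<forall>\<^sub>F m in sequentially. a < measure lebesgue (msum S (P m))"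
      using lower by (auto intro: less_le_trans always_eventually)
  next
    fix a assume "measure lebesgue ?T < a"
    from order_tendstoD(2)[OF tendsto_measure_nbhd[OF T'] this]
    obtain k where k: "measure lebesgue {x. infdist x ?T \<le> 1 / real (Suc k)} < a"
      by (auto simp: eventually_sequentially)
    have "(\<lambda>m. card S * r m) \<longlonglongrightarrow> real (card S) * 0" by (intro tendsto_intros r)
    then have "\<forall>\<^sub>F m in sequentially. card S * r m < 1 / real (Suc k)"
      by (rule order_tendstoD) simp
    then show "\<forall>\<^sub>F m in sequentially. measure lebesgue (msum S (P m)) < a"
    proof eventually_elim
      case (elim m)
      have "msum S (P m) \<subseteq> {x. infdist x ?T \<le> 1 / real (Suc k)}"
        using msum_nbhd[of S "P m" K "r m"] S sub(2) elim by fastforce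
      then have "measure lebesgue (msum S (P m)) \<le> measure lebesgue {x. infdist x ?T \<le> 1 / real (Suc k)}"
        using PS nb[of "1 / real (Suc k)"] by (intro measure_mono_fmeasurable)
          (auto intro: lmeasurable_compact fmeasurableD)
      then show ?case using k by simp
    qed
  qed
qed

section \<open>Mixed volumes of convex bodies\<close>

lemma mink_sum_mono: "K \<subseteq> K' \<Longrightarrow> L \<subseteq> L' \<Longrightarrow> mink_sum K L \<subseteq> mink_sum K' L'"
  unfolding mink_sum_def by blast

lemma tendsto_inverse_Suc: "(\<lambda>m. 1 / real (Suc m)) \<longlonglongrightarrow> 0"
  by (rule LIMSEQ_Suc[OF lim_1_over_n])

lemma outer_polytope_seq:
  fixes L :: "(real^'n) set"
  assumes "convex_body L"
  shows "\<exists>A. \<forall>m. finite (A m) \<and> spanning (A m) \<and> L \<subseteq> convex hull (A m) \<and>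
    convex hull (A m) \<subseteq> nbhd L (1 / real (Suc m)) \<and> convex_body (convex hull (A m)) \<and>
    hull_potential (A m)"
proof -
  have "\<exists>A. finite A \<and> spanning A \<and> L \<subseteq> convex hull A \<and>
      convex hull A \<subseteq> nbhd L (1 / real (Suc m))" for m
    by (rule outer_polytope[OF assms, of "1 / real (Suc m)"]) auto
  then have "\<exists>A. \<forall>m. finite (A m) \<and> spanning (A m) \<and> L \<subseteq> convex hull (A m) \<and>
      convex hull (A m) \<subseteq> nbhd L (1 / real (Suc m))"
    by (intro choice allI)
  then obtain A where A: "\<And>m. finite (A m)" "\<And>m. spanning (A m)" "\<And>m. L \<subseteq> convex hull (A m)"
    "\<And>m. convex hull (A m) \<subseteq> nbhd L (1 / real (Suc m))" by blast
  show ?thesis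
    by (intro exI[of _ A] allI conjI convex_body_hull potential_lse spanning_nonempty A zero_less_one)
qed

text \<open>Packages polytopes \<open>P m i\<close> around the fixed bodies \<open>K i\<close> with
  the convergence used later. The quantifier over \<open>L\<close> and \<open>Q\<close> lets one
  choice of \<open>P\<close> serve several last arguments at once, as additivity and monotonicity
  require.\<close>

definition outer_approx where
  "outer_approx K P \<phi> g H \<longleftrightarrow>
    (\<forall>m i. i < CARD('n) - 1 \<longrightarrow> convex_body (P m i)) \<and>
    (\<forall>m i. i < CARD('n) - 1 \<longrightarrow> potential (\<phi> m i) (g m i) (H m i) (P m i)) \<and>
    (\<forall>(L :: (real^'n) set) Q r. convex_body L \<longrightarrow>
       (\<forall>m :: nat. convex_body (Q m) \<and> L \<subseteq> Q m \<and> Q m \<subseteq> nbhd L (r m)) \<longrightarrow>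
       r \<longlonglongrightarrow> 0 \<longrightarrow> (\<lambda>m. mv_last (P m) (Q m)) \<longlonglongrightarrow> mv_last K L)"

lemma
  fixes K :: "nat \<Rightarrow> (real^'n) set"
  assumes "outer_approx K P \<phi> g H"
  shows outer_approx_convex_body: "i < CARD('n) - 1 \<Longrightarrow> convex_body (P m i)"
    and outer_approx_potential: "i < CARD('n) - 1 \<Longrightarrow> potential (\<phi> m i) (g m i) (H m i) (P m i)"
    and outer_approx_tendsto: "convex_body L \<Longrightarrow> (\<And>m. convex_body (Q m)) \<Longrightarrow> (\<And>m. L \<subseteq> Q m) \<Longrightarrow>
       (\<And>m. Q m \<subseteq> nbhd L (r m)) \<Longrightarrow> r \<longlonglongrightarrow> 0 \<Longrightarrow>
       (\<lambda>m. mv_last (P m) (Q m)) \<longlonglongrightarrow> mv_last K L"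
  using assms unfolding outer_approx_def by blast+

context
  fixes K :: "nat \<Rightarrow> (real^'n) set"
  assumes K: "\<And>i. i < CARD('n) - 1 \<Longrightarrow> convex_body (K i)"
begin

text \<open>All the properties of the mixed volume used below are inherited from polytopes, through
  simultaneous outer approximation of all its arguments.\<close>
lemma outer_polytopes:
  "\<exists>P \<phi> g H. outer_approx K P \<phi> g H"
proof -
  have "\<exists>A. i < CARD('n) - 1 \<longrightarrow> finite A \<and> spanning A \<and> K i \<subseteq> convex hull A \<and>
      convex hull A \<subseteq> nbhd (K i) (1 / real (Suc m))" for i m :: nat
  proof (cases "i < CARD('n) - 1")
    case True
    show ?thesis by (rule outer_polytope[OF K[OF True], of "1 / real (Suc m)"]) auto
  qed auto
  then have "\<exists>A. \<forall>m i. i < CARD('n) - 1 \<longrightarrow> finite (A m i) \<and> spanning (A m i) \<and> K i \<subseteq> convex hull (A m i) \<and>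
      convex hull (A m i) \<subseteq> nbhd (K i) (1 / real (Suc m))"
    by (intro choice allI)
  then obtain A where A: "\<And>i m :: nat. i < CARD('n) - 1 \<Longrightarrow> finite (A m i) \<and> spanning (A m i) \<and>
      K i \<subseteq> convex hull (A m i) \<and> convex hull (A m i) \<subseteq> nbhd (K i) (1 / real (Suc m))"
    by blast
  let ?P = "\<lambda>m i. convex hull (A m i)"
  show ?thesis
    unfolding outer_approx_def
  proof (intro exI conjI allI impI)
    show conv: "convex_body (?P m i)" if "i < CARD('n) - 1" for i m
      using A[OF that, of m] by (intro convex_body_hull) (auto dest: spanning_nonempty)
    show "potential (lse (A m i) (\<lambda>_. 1)) (lse_grad (A m i) (\<lambda>_. 1)) (lse_hess (A m i) (\<lambda>_. 1)) (?P m i)"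
      if "i < CARD('n) - 1" for i m
      using A[OF that, of m] by (intro potential_lse) auto
    fix L :: "(real^'n) set" and Q and r :: "nat \<Rightarrow> real"
    assume "convex_body L" "\<forall>m. convex_body (Q m) \<and> L \<subseteq> Q m \<and> Q m \<subseteq> nbhd L (r m)" "r \<longlonglongrightarrow> 0"
    then have L: "convex_body L" "\<And>m. convex_body (Q m)" "\<And>m. L \<subseteq> Q m"
      "\<And>m. Q m \<subseteq> nbhd L (r m)" "r \<longlonglongrightarrow> 0" by auto
    \<comment> \<open>A common radius for the fixed bodies and the last one; the absolute value
      keeps it above both radii whatever the sign of \<open>r m\<close>.\<close>
    have "(\<lambda>m. 1 / real (Suc m) + \<bar>r m\<bar>) \<longlonglongrightarrow> 0 + \<bar>0\<bar>"
      by (intro tendsto_intros tendsto_inverse_Suc L(5))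
    then have r': "(\<lambda>m. 1 / real (Suc m) + \<bar>r m\<bar>) \<longlonglongrightarrow> 0" by simp
    have c1: "nbhd M (1 / real (Suc m)) \<subseteq> nbhd M (1 / real (Suc m) + \<bar>r m\<bar>)"
      and c2: "nbhd M (r m) \<subseteq> nbhd M (1 / real (Suc m) + \<bar>r m\<bar>)"
      for M :: "(real^'n) set" and m
    proof -
      show "nbhd M (1 / real (Suc m)) \<subseteq> nbhd M (1 / real (Suc m) + \<bar>r m\<bar>)"
        by (intro mink_sum_mono) auto
      have "r m \<le> 1 / real (Suc m) + \<bar>r m\<bar>" by (smt (verit) divide_nonneg_nonneg of_nat_0_le_iff)
      then show "nbhd M (r m) \<subseteq> nbhd M (1 / real (Suc m) + \<bar>r m\<bar>)"
        by (intro mink_sum_mono) auto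
    qed
    show "(\<lambda>m. mv_last (?P m) (Q m)) \<longlonglongrightarrow> mv_last K L"
      unfolding mv_last_def
    proof (rule tendsto_mixed_volume[OF _ _ _ _ r'])
      show "(if i < CARD('n) - 1 then ?P m i else Q m) \<subseteq>
        nbhd (if i < CARD('n) - 1 then K i else L) (1 / real (Suc m) + \<bar>r m\<bar>)" for i m
        using A c1 c2 L(4) by (cases "i < CARD('n) - 1") (simp_all, blast+)
    qed (use A K L conv in auto)
  qed
qed

lemma mv_last_add:
  assumes "convex_body L" "convex_body M"
  shows "mv_last K (mink_sum L M) = mv_last K L + mv_last K M"
proof -
  obtain P \<phi> g H where approx: "outer_approx K P \<phi> g H" using outer_polytopes by blast
  note P = outer_approx_convex_body[OF approx] and pot = outer_approx_potential[OF approx]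
    and lim = outer_approx_tendsto[OF approx]
  obtain A where A: "\<And>m. finite (A m)" "\<And>m. spanning (A m)" "\<And>m. L \<subseteq> convex hull (A m)"
    "\<And>m. convex hull (A m) \<subseteq> nbhd L (1 / real (Suc m))"
    and cbA: "\<And>m. convex_body (convex hull (A m))"
    and potA: "\<And>m. hull_potential (A m)"
    using outer_polytope_seq[OF assms(1)] by blast
  obtain B where B: "\<And>m. finite (B m)" "\<And>m. spanning (B m)" "\<And>m. M \<subseteq> convex hull (B m)"
    "\<And>m. convex hull (B m) \<subseteq> nbhd M (1 / real (Suc m))"
    and cbB: "\<And>m. convex_body (convex hull (B m))"
    and potB: "\<And>m. hull_potential (B m)"
    using outer_polytope_seq[OF assms(2)] by blast
  note cb = cbA cbB
  have "(\<lambda>m. 2 * (1 / real (Suc m))) \<longlonglongrightarrow> 2 * 0" by (intro tendsto_intros tendsto_inverse_Suc)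
  then have r2: "(\<lambda>m. 2 * (1 / real (Suc m))) \<longlonglongrightarrow> 0" by simp
  have eq: "mv_last (P m) (mink_sum (convex hull (A m)) (convex hull (B m))) =
     mv_last (P m) (convex hull (A m)) + mv_last (P m) (convex hull (B m))" for m
    by (rule mv_last_add_potential) (fact pot P potA potB cb)+
  have sub: "mink_sum (convex hull (A m)) (convex hull (B m)) \<subseteq>
      nbhd (mink_sum L M) (2 * (1 / real (Suc m)))" for m
  proof
    fix z assume "z \<in> mink_sum (convex hull (A m)) (convex hull (B m))"
    then have "z \<in> mink_sum (nbhd L (1 / real (Suc m))) (nbhd M (1 / real (Suc m)))"
      using mink_sum_mono[OF A(4) B(4)] by (rule subsetD[rotated])
    then obtain x y where z: "z = x + y" "x \<in> nbhd L (1 / real (Suc m))"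
      "y \<in> nbhd M (1 / real (Suc m))"
      by (rule mink_sumE)
    then obtain l s t u where "x = l + s" "l \<in> L" "norm s \<le> 1 / real (Suc m)"
      "y = t + u" "t \<in> M" "norm u \<le> 1 / real (Suc m)"
      by (auto elim!: mink_sumE)
    moreover from this have "norm (s + u) \<le> 2 * (1 / real (Suc m))"
      using norm_triangle_ineq[of s u] by linarith
    ultimately have "(l + t) + (s + u) \<in> nbhd (mink_sum L M) (2 * (1 / real (Suc m)))"
      by (intro mink_sumI) auto
    then show "z \<in> nbhd (mink_sum L M) (2 * (1 / real (Suc m)))"
      using z \<open>x = l + s\<close> \<open>y = t + u\<close> by (simp add: algebra_simps)
  qed
  have "(\<lambda>m. mv_last (P m) (mink_sum (convex hull (A m)) (convex hull (B m))))
      \<longlonglongrightarrow> mv_last K (mink_sum L M)"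
    using A B assms cb by (intro lim[OF _ _ _ sub r2] convex_body_mink_sum mink_sum_mono) auto
  moreover have "(\<lambda>m. mv_last (P m) (convex hull (A m)) + mv_last (P m) (convex hull (B m)))
      \<longlonglongrightarrow> mv_last K L + mv_last K M"
    using A B assms cb by (intro tendsto_add lim[OF _ _ _ _ tendsto_inverse_Suc]) auto
  ultimately show ?thesis unfolding eq by (rule LIMSEQ_unique)
qed

text \<open>Polytopes chosen separately for \<open>L\<close> and \<open>M\<close> need not be
  nested. The hull of both vertex sets restores the inclusion and still lies close to
  \<open>M\<close>, since \<open>L \<subseteq> M\<close>.\<close>

lemma mv_last_mono:
  assumes "convex_body L" "convex_body M" "L \<subseteq> M"
  shows "mv_last K L \<le> mv_last K M"
proof -
  obtain P \<phi> g H where approx: "outer_approx K P \<phi> g H" using outer_polytopes by blast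
  note P = outer_approx_convex_body[OF approx] and pot = outer_approx_potential[OF approx]
    and lim = outer_approx_tendsto[OF approx]
  obtain A where A: "\<And>m. finite (A m)" "\<And>m. spanning (A m)" "\<And>m. L \<subseteq> convex hull (A m)"
    "\<And>m. convex hull (A m) \<subseteq> nbhd L (1 / real (Suc m))"
    and cbA: "\<And>m. convex_body (convex hull (A m))"
    and potA: "\<And>m. hull_potential (A m)"
    using outer_polytope_seq[OF assms(1)] by blast
  obtain B where B: "\<And>m. finite (B m)" "\<And>m. spanning (B m)" "\<And>m. M \<subseteq> convex hull (B m)"
    "\<And>m. convex hull (B m) \<subseteq> nbhd M (1 / real (Suc m))"
    using outer_polytope_seq[OF assms(2)] by blast
  let ?AB = "\<lambda>m. convex hull (A m \<union> B m)"
  have cb: "convex_body (convex hull (A m))" "convex_body (?AB m)" for m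
    using A B by (auto intro!: convex_body_hull dest: spanning_nonempty)
  have le: "mv_last (P m) (convex hull (A m)) \<le> mv_last (P m) (?AB m)" for m
    by (rule mv_last_mono_hull) (fact pot P, fact pot P, use A B in auto)
  have sub: "?AB m \<subseteq> nbhd M (1 / real (Suc m))" for m
  proof (rule hull_minimal)
    have "A m \<subseteq> nbhd L (1 / real (Suc m))" by (rule subset_trans[OF hull_subset A(4)])
    also have "\<dots> \<subseteq> nbhd M (1 / real (Suc m))" by (intro mink_sum_mono assms order_refl)
    finally show "A m \<union> B m \<subseteq> nbhd M (1 / real (Suc m))"
      by (rule Un_least[OF _ subset_trans[OF hull_subset B(4)]])
    show "convex (nbhd M (1 / real (Suc m)))"
      using assms by (intro convex_mink_sum) (auto simp: convex_body_def)
  qed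
  have "M \<subseteq> ?AB m" for m by (rule subset_trans[OF B(3) hull_mono[OF Un_upper2]])
  then have "(\<lambda>m. mv_last (P m) (?AB m)) \<longlonglongrightarrow> mv_last K M"
    using assms cb by (intro lim[OF _ _ _ sub tendsto_inverse_Suc]) auto
  moreover have "(\<lambda>m. mv_last (P m) (convex hull (A m))) \<longlonglongrightarrow> mv_last K L"
    using A assms cb by (intro lim[OF _ _ _ _ tendsto_inverse_Suc]) auto
  ultimately show ?thesis using le by (intro LIMSEQ_le) auto
qed

lemma mv_last_scale:
  assumes "convex_body L" "0 \<le> c"
  shows "mv_last K ((*\<^sub>R) c ` L) = c * mv_last K L"
proof (cases "c = 0")
  case True
  have "(*\<^sub>R) 0 ` L = {0}" using assms by (auto simp: convex_body_def)
  \<comment> \<open>Scaling a potential by 0 destroys definiteness, so the value at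
    \<open>{0}\<close> comes from additivity instead.\<close>
  moreover have "mink_sum {0} {0} = {0 :: real^'n}" by (auto simp: mink_sum_def)
  then have "mv_last K {0} = 0"
    using mv_last_add[of "{0}" "{0}"] by (simp add: convex_body_def)
  ultimately show ?thesis using True by simp
next
  case False
  then have "0 < c" using assms by simp
  obtain P \<phi> g H where approx: "outer_approx K P \<phi> g H" using outer_polytopes by blast
  note P = outer_approx_convex_body[OF approx] and pot = outer_approx_potential[OF approx]
    and lim = outer_approx_tendsto[OF approx]
  obtain A where A: "\<And>m. finite (A m)" "\<And>m. spanning (A m)" "\<And>m. L \<subseteq> convex hull (A m)"
    "\<And>m. convex hull (A m) \<subseteq> nbhd L (1 / real (Suc m))"
    and cbA: "\<And>m. convex_body (convex hull (A m))"
    and potA: "\<And>m. hull_potential (A m)"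
    using outer_polytope_seq[OF assms(1)] by blast
  note cb = cbA
  have "(\<lambda>m. c * (1 / real (Suc m))) \<longlonglongrightarrow> c * 0" by (intro tendsto_intros tendsto_inverse_Suc)
  then have r2: "(\<lambda>m. c * (1 / real (Suc m))) \<longlonglongrightarrow> 0" by simp
  have eq: "mv_last (P m) ((*\<^sub>R) c ` (convex hull (A m))) =
     c * mv_last (P m) (convex hull (A m))" for m
    by (rule mv_last_scale_potential) (fact pot P potA cb \<open>0 < c\<close>)+
  have sub: "(*\<^sub>R) c ` (convex hull (A m)) \<subseteq> nbhd ((*\<^sub>R) c ` L) (c * (1 / real (Suc m)))" for m
  proof
    fix z assume "z \<in> (*\<^sub>R) c ` (convex hull (A m))"
    then obtain x y where "z = c *\<^sub>R (x + y)" "x \<in> L" "norm y \<le> 1 / real (Suc m)"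
      using A(4)[of m] by (auto elim!: mink_sumE) (metis (no_types, lifting) image_iff mem_cball_0 mink_sumE subsetD)
    then show "z \<in> nbhd ((*\<^sub>R) c ` L) (c * (1 / real (Suc m)))"
      using \<open>0 < c\<close> mult_left_mono[of "norm y" "1 / real (Suc m)" c]
      by (auto simp: scaleR_add_right intro!: mink_sumI)
  qed
  have "(\<lambda>m. mv_last (P m) ((*\<^sub>R) c ` (convex hull (A m))))
      \<longlonglongrightarrow> mv_last K ((*\<^sub>R) c ` L)"
    using A assms cb by (intro lim[OF _ _ _ sub r2] convex_body_scaleR image_mono) auto
  moreover have "(\<lambda>m. c * mv_last (P m) (convex hull (A m))) \<longlonglongrightarrow> c * mv_last K L"
    using A assms cb by (intro tendsto_mult tendsto_const lim[OF _ _ _ _ tendsto_inverse_Suc]) auto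
  ultimately show ?thesis unfolding eq by (rule LIMSEQ_unique)
qed

lemma mv_last_nonneg:
  assumes "convex_body L" shows "0 \<le> mv_last K L"
proof -
  obtain P \<phi> g H where approx: "outer_approx K P \<phi> g H" using outer_polytopes by blast
  note P = outer_approx_convex_body[OF approx] and pot = outer_approx_potential[OF approx]
    and lim = outer_approx_tendsto[OF approx]
  obtain A where A: "\<And>m. finite (A m)" "\<And>m. spanning (A m)" "\<And>m. L \<subseteq> convex hull (A m)"
    "\<And>m. convex hull (A m) \<subseteq> nbhd L (1 / real (Suc m))"
    and cbA: "\<And>m. convex_body (convex hull (A m))"
    and potA: "\<And>m. hull_potential (A m)"
    using outer_polytope_seq[OF assms] by blast
  note cb = cbA
  have nonneg: "0 \<le> mv_last (P m) (convex hull (A m))" for m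
    by (rule mv_last_nonneg_potential) (fact pot P potA cb)+
  have "(\<lambda>m. mv_last (P m) (convex hull (A m))) \<longlonglongrightarrow> mv_last K L"
    using A assms cb by (intro lim[OF _ _ _ _ tendsto_inverse_Suc]) auto
  then show ?thesis using nonneg by (intro LIMSEQ_le_const) auto
qed

end

section \<open>Support functions and random convex bodies\<close>

definition support_fun :: "'a::euclidean_space set \<Rightarrow> 'a \<Rightarrow> real" where
  "support_fun K u = (SUP x\<in>K. x \<bullet> u)"

lemma bounded_imp_bdd_above_inner:
  fixes K :: "'a::real_inner set"
  assumes "bounded K" shows "bdd_above ((\<lambda>x. x \<bullet> u) ` K)"
proof -
  obtain B where B: "\<And>x. x \<in> K \<Longrightarrow> norm x \<le> B" using assms by (auto simp: bounded_iff)
  show ?thesis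
  proof (rule bdd_aboveI2)
    fix x assume "x \<in> K"
    have "x \<bullet> u \<le> norm x * norm u" by (rule norm_cauchy_schwarz)
    also have "\<dots> \<le> B * norm u" using B[OF \<open>x \<in> K\<close>] by (intro mult_right_mono) auto
    finally show "x \<bullet> u \<le> B * norm u" .
  qed
qed

lemma support_fun_upper: "bounded K \<Longrightarrow> x \<in> K \<Longrightarrow> x \<bullet> u \<le> support_fun K u"
  unfolding support_fun_def by (intro cSUP_upper bounded_imp_bdd_above_inner)

lemma support_fun_least: "K \<noteq> {} \<Longrightarrow> (\<And>x. x \<in> K \<Longrightarrow> x \<bullet> u \<le> c) \<Longrightarrow> support_fun K u \<le> c"
  unfolding support_fun_def by (intro cSUP_least)

lemma convex_body_bounded: "convex_body K \<Longrightarrow> bounded K"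
  by (auto simp: convex_body_def compact_imp_bounded)

lemma convex_body_nonempty: "convex_body K \<Longrightarrow> K \<noteq> {}"
  by (simp add: convex_body_def)

lemma support_fun_mink_sum:
  assumes "convex_body K" "convex_body L"
  shows "support_fun (mink_sum K L) u = support_fun K u + support_fun L u"
proof (rule antisym)
  note K = convex_body_bounded[OF assms(1)] convex_body_nonempty[OF assms(1)]
  note L = convex_body_bounded[OF assms(2)] convex_body_nonempty[OF assms(2)]
  note S = convex_body_mink_sum[OF assms]
  show "support_fun (mink_sum K L) u \<le> support_fun K u + support_fun L u"
  proof (rule support_fun_least[OF convex_body_nonempty[OF S]])
    fix z assume "z \<in> mink_sum K L"
    then obtain x y where "z = x + y" "x \<in> K" "y \<in> L" by (rule mink_sumE)
    then show "z \<bullet> u \<le> support_fun K u + support_fun L u"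
      using support_fun_upper[OF K(1), of x u] support_fun_upper[OF L(1), of y u]
      by (simp add: inner_add_left)
  qed
  have "x \<bullet> u + y \<bullet> u \<le> support_fun (mink_sum K L) u" if "x \<in> K" "y \<in> L" for x y
    using support_fun_upper[OF convex_body_bounded[OF S] mink_sumI[OF that], of u]
    by (simp add: inner_add_left)
  then have "y \<bullet> u \<le> support_fun (mink_sum K L) u - support_fun K u" if "y \<in> L" for y
    using support_fun_least[OF K(2), of u "support_fun (mink_sum K L) u - y \<bullet> u"] that by fastforce
  then show "support_fun K u + support_fun L u \<le> support_fun (mink_sum K L) u"
    using support_fun_least[OF L(2), of u "support_fun (mink_sum K L) u - support_fun K u"] by fastforce
qed

lemma support_fun_scaleR:
  assumes "convex_body K" "0 \<le> c"
  shows "support_fun ((*\<^sub>R) c ` K) u = c * support_fun K u"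
proof (cases "c = 0")
  case True
  have "(*\<^sub>R) 0 ` K = {0}" using assms by (auto simp: convex_body_def)
  then show ?thesis using True by (simp add: support_fun_def)
next
  case False
  then have "0 < c" using assms by simp
  note K = convex_body_bounded[OF assms(1)] convex_body_nonempty[OF assms(1)]
  note cK = convex_body_bounded[OF convex_body_scaleR[OF assms(1)]]
  show ?thesis
  proof (rule antisym)
    show "support_fun ((*\<^sub>R) c ` K) u \<le> c * support_fun K u"
      using K \<open>0 < c\<close> by (intro support_fun_least) (auto intro: support_fun_upper)
    have "x \<bullet> u \<le> support_fun ((*\<^sub>R) c ` K) u / c" if "x \<in> K" for x
      using support_fun_upper[OF cK, of "c *\<^sub>R x" c u] that \<open>0 < c\<close> by (auto simp: field_simps)
    then have "support_fun K u \<le> support_fun ((*\<^sub>R) c ` K) u / c" using K by (intro support_fun_least)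
    then show "c * support_fun K u \<le> support_fun ((*\<^sub>R) c ` K) u"
      using \<open>0 < c\<close> by (simp add: field_simps)
  qed
qed

text \<open>A point of \<open>K\<close> outside the neighbourhood is strictly separated from it, and
  the unit normal of the separating hyperplane violates the inequality between the support
  functions.\<close>

lemma subset_nbhd_if_support_fun_le:
  fixes K L :: "'a::euclidean_space set"
  assumes K: "convex_body K" and L: "convex_body L" and "0 \<le> e"
    and le: "\<And>u. norm u = 1 \<Longrightarrow> support_fun K u \<le> support_fun L u + e"
  shows "K \<subseteq> nbhd L e"
proof (rule ccontr)
  let ?M = "nbhd L e"
  assume "\<not> K \<subseteq> ?M"
  then obtain x where x: "x \<in> K" "x \<notin> ?M" by auto
  have M: "convex_body ?M"
    using \<open>0 \<le> e\<close> by (intro convex_body_mink_sum L) (auto simp: convex_body_def)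
  then obtain a b where ab: "a \<bullet> x < b" "\<And>y. y \<in> ?M \<Longrightarrow> a \<bullet> y > b"
    using separating_hyperplane_closed_point[OF _ _ x(2)] by (auto simp: convex_body_def compact_imp_closed)
  obtain l0 where "l0 \<in> ?M" using convex_body_nonempty[OF M] by auto
  then have "a \<noteq> 0" using ab(1) ab(2)[of l0] by auto
  \<comment> \<open>The separation lets \<open>a\<close> point towards the neighbourhood, so the
    outer normal has the opposite sign.\<close>
  define u where "u = (- 1 / norm a) *\<^sub>R a"
  have nu: "norm u = 1" using \<open>a \<noteq> 0\<close> by (simp add: u_def)
  have "l \<bullet> u \<le> - b / norm a - e" if "l \<in> L" for l
  proof -
    have "l + e *\<^sub>R u \<in> ?M" using that nu \<open>0 \<le> e\<close> by (intro mink_sumI) auto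
    from ab(2)[OF this] have "a \<bullet> l + e * (a \<bullet> u) > b" by (simp add: inner_add_right)
    moreover have "a \<bullet> u = - norm a"
      using \<open>a \<noteq> 0\<close> by (simp add: u_def power2_norm_eq_inner[symmetric] power2_eq_square)
    ultimately have "b + e * norm a < a \<bullet> l" by simp
    moreover have "l \<bullet> u = - (a \<bullet> l) / norm a" by (simp add: u_def inner_commute[of l])
    ultimately show ?thesis using \<open>a \<noteq> 0\<close> by (simp add: field_simps)
  qed
  then have "support_fun L u \<le> - b / norm a - e"
    by (intro support_fun_least convex_body_nonempty[OF L])
  moreover have "- b / norm a < x \<bullet> u"
    using ab(1) \<open>a \<noteq> 0\<close> by (simp add: u_def inner_commute[of x] field_simps)
  moreover have "x \<bullet> u \<le> support_fun K u" by (intro support_fun_upper convex_body_bounded K x)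
  ultimately show False using le[OF nu] by linarith
qed

text \<open>A Lipschitz bound in the direction: values on a finite net of directions then control
  the whole support function.\<close>

lemma support_fun_abs_le:
  assumes "K \<subseteq> cball 0 R" "K \<noteq> {}"
  shows "\<bar>support_fun K u - support_fun K v\<bar> \<le> R * norm (u - v)"
proof -
  have "bounded K" using assms bounded_subset bounded_cball by blast
  have "support_fun K u \<le> support_fun K v + R * norm (u - v)" for u v
  proof (rule support_fun_least[OF assms(2)])
    fix x assume x: "x \<in> K"
    have "x \<bullet> (u - v) \<le> norm x * norm (u - v)" by (rule norm_cauchy_schwarz)
    also have "\<dots> \<le> R * norm (u - v)" using x assms by (intro mult_right_mono) auto
    finally show "x \<bullet> u \<le> support_fun K v + R * norm (u - v)"
      using support_fun_upper[OF \<open>bounded K\<close> x, of v] by (simp add: inner_diff_right)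
  qed
  from this[of u v] this[of v u] show ?thesis by (simp add: norm_minus_commute abs_le_iff)
qed

lemma sphere_net:
  assumes "0 < (d::real)"
  shows "\<exists>U :: 'a::euclidean_space set. finite U \<and> U \<subseteq> sphere 0 1 \<and>
    (\<forall>v. norm v = 1 \<longrightarrow> (\<exists>u\<in>U. norm (v - u) < d))"
proof -
  have "sphere (0::'a) 1 \<subseteq> (\<Union>u\<in>sphere 0 1. ball u d)" using assms by auto
  from compactE_image[OF compact_sphere _ this]
  obtain U where "U \<subseteq> sphere (0::'a) 1" "finite U" "sphere 0 1 \<subseteq> (\<Union>u\<in>U. ball u d)"
    by (metis open_ball)
  then show ?thesis
    by (intro exI[of _ U]) (force simp: dist_norm norm_minus_commute subset_iff)
qed

lemma (in prob_space) integral_tail_le: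
  fixes R :: "'a \<Rightarrow> real"
  assumes "integrable M R" "\<And>\<omega>. 0 \<le> R \<omega>" "0 < e"
  obtains n :: nat where "1 \<le> n" "(\<integral>\<omega>. indicator {\<omega>\<in>space M. R \<omega> > real n} \<omega> * R \<omega> \<partial>M) \<le> e"
proof -
  let ?f = "\<lambda>n \<omega>. indicator {\<omega>\<in>space M. R \<omega> > real n} \<omega> * R \<omega>"
  have [measurable]: "R \<in> borel_measurable M" using assms by auto
  have "(\<lambda>n. \<integral>\<omega>. ?f n \<omega> \<partial>M) \<longlonglongrightarrow> (\<integral>\<omega>. 0 \<partial>M)"
  proof (rule integral_dominated_convergence[where w = R])
    show "AE \<omega> in M. (\<lambda>n. ?f n \<omega>) \<longlonglongrightarrow> 0"
    proof (intro AE_I2 tendsto_eventually)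
      fix \<omega>
      obtain n where "R \<omega> \<le> real n" using real_arch_simple by blast
      then show "\<forall>\<^sub>F n in sequentially. ?f n \<omega> = 0"
        by (auto simp: eventually_sequentially indicator_def intro!: exI[of _ n])
    qed
  qed (use assms in \<open>auto simp: indicator_def\<close>)
  then have "\<forall>\<^sub>F n in sequentially. (\<integral>\<omega>. ?f n \<omega> \<partial>M) < e"
    using assms by (intro order_tendstoD) auto
  then obtain N where "\<And>n. n \<ge> N \<Longrightarrow> (\<integral>\<omega>. ?f n \<omega> \<partial>M) < e"
    by (auto simp: eventually_sequentially)
  \<comment> \<open>The threshold is kept at least 1 because the mesh of the net of directions will
    be obtained by dividing by it.\<close>
  from this[of "max N 1"] show ?thesis by (intro that[of "max N 1"]) auto
qed

lemma cball_eq_scaleR: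
  fixes r :: real
  assumes "0 \<le> r" shows "(*\<^sub>R) r ` cball (0 :: 'a::real_normed_vector) 1 = cball 0 r"
proof (cases "r = 0")
  case False
  then have "x \<in> (*\<^sub>R) r ` cball 0 1" if "norm x \<le> r" for x :: 'a
    using that assms by (intro image_eqI[of _ _ "x /\<^sub>R r"]) (auto simp: field_simps)
  moreover have "r * norm x \<le> r" if "norm x \<le> 1" for x :: 'a
    using that assms mult_left_mono[of "norm x" 1 r] by simp
  ultimately show ?thesis using assms by auto
next
  case True
  then show ?thesis by (auto intro!: image_eqI[where x = 0])
qed

text \<open>Abstracts \<open>mv_last K\<close>: the probabilistic argument uses the mixed volume
  only through these four properties.\<close>

locale monotone_additive_functional =
  fixes F :: "'a::euclidean_space set \<Rightarrow> real"
  assumes add: "convex_body K \<Longrightarrow> convex_body L \<Longrightarrow> F (mink_sum K L) = F K + F L"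
    and scale: "convex_body K \<Longrightarrow> 0 \<le> c \<Longrightarrow> F ((*\<^sub>R) c ` K) = c * F K"
    and mono: "convex_body K \<Longrightarrow> convex_body L \<Longrightarrow> K \<subseteq> L \<Longrightarrow> F K \<le> F L"
    and nonneg: "convex_body K \<Longrightarrow> 0 \<le> F K"
begin

lemma convex_body_cball: "0 \<le> r \<Longrightarrow> convex_body (cball (x :: 'a) r)"
  by (auto simp: convex_body_def)

lemma cball_eq: "0 \<le> r \<Longrightarrow> F (cball 0 r) = r * F (cball 0 1)"
  by (subst scale[symmetric]) (auto simp: convex_body_cball cball_eq_scaleR)

text \<open>The hypothesis places \<open>K\<close> in the \<open>e\<close>-neighbourhood of
  \<open>L\<close>, on which \<open>F\<close> is evaluated by additivity and homogeneity.\<close>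

lemma le_if_support_fun_le:
  assumes "convex_body K" "convex_body L" "0 \<le> e"
    "\<And>u. norm u = 1 \<Longrightarrow> support_fun K u \<le> support_fun L u + e"
  shows "F K \<le> F L + e * F (cball 0 1)"
proof -
  have "F K \<le> F (nbhd L e)"
    using assms by (intro mono convex_body_mink_sum convex_body_cball subset_nbhd_if_support_fun_le)
  also have "\<dots> = F L + e * F (cball 0 1)"
    using assms by (simp add: add convex_body_cball cball_eq[symmetric])
  finally show ?thesis .
qed

text \<open>For probabilities \<open>p k\<close> this is the Minkowski mean of a random body with
  finitely many values; both \<open>F\<close> and the support functions commute with it.\<close>

lemma weighted_sum:
  assumes "finite I" "\<And>k. k \<in> I \<Longrightarrow> 0 \<le> p k" "\<And>k. k \<in> I \<Longrightarrow> convex_body (D k)"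
  shows "\<exists>Q. convex_body Q \<and> F Q = (\<Sum>k\<in>I. p k * F (D k)) \<and>
    (\<forall>u. support_fun Q u = (\<Sum>k\<in>I. p k * support_fun (D k) u))"
  using assms
proof (induction I rule: finite_induct)
  case empty
  have "F {0} = 0" using scale[of "{0}" 0] by (simp add: convex_body_def)
  then show ?case by (intro exI[of _ "{0}"]) (simp add: convex_body_def support_fun_def)
next
  case (insert k I)
  then obtain Q where Q: "convex_body Q" "F Q = (\<Sum>k\<in>I. p k * F (D k))"
    "\<And>u. support_fun Q u = (\<Sum>k\<in>I. p k * support_fun (D k) u)" by auto
  have D: "convex_body (D k)" "0 \<le> p k" using insert by auto
  show ?case
    using insert.hyps Q D
    by (intro exI[of _ "mink_sum ((*\<^sub>R) (p k) ` D k) Q"])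
       (simp add: convex_body_mink_sum convex_body_scaleR add scale support_fun_mink_sum support_fun_scaleR)
qed

text \<open>The space is cut into finitely many cells on which the support function of \<open>Z\<close> is nearly
  constant on a net of directions, and a remainder of small mean. On each cell \<open>Z\<close> is replaced by
  one of its values; the resulting weighted Minkowski sum has nearly the support function of \<open>L\<close>.
  This squeezes \<open>F (Z \<omega>)\<close> between simple functions without using its measurability.\<close>
lemma nn_integral_random_body:
  fixes M :: "'w measure" and Z :: "'w \<Rightarrow> 'a set"
  assumes "prob_space M"
    and Z: "\<And>\<omega>. convex_body (Z \<omega>)" and L: "convex_body L"
    and int: "\<And>u. integrable M (\<lambda>\<omega>. support_fun (Z \<omega>) u)"
    and mean: "\<And>u. (\<integral>\<omega>. support_fun (Z \<omega>) u \<partial>M) = support_fun L u"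
  shows "(\<integral>\<^sup>+\<omega>. ennreal (F (Z \<omega>)) \<partial>M) = ennreal (F L)"
proof -
  interpret prob_space M by fact
  let ?h = "\<lambda>\<omega>. support_fun (Z \<omega>)"
  define b where "b = F (cball 0 1)"
  have b: "0 \<le> b" by (simp add: b_def nonneg convex_body_cball)
  have [measurable]: "(\<lambda>\<omega>. ?h \<omega> u) \<in> borel_measurable M" for u using int by auto
  \<comment> \<open>An integrable radius of a ball around 0 containing \<open>Z \<omega>\<close>:
    the coordinates of its points are bounded by the support values in the directions
    \<open>i\<close> and \<open>- i\<close>.\<close>
  define R where "R \<omega> = (\<Sum>i\<in>Basis. \<bar>?h \<omega> i\<bar> + \<bar>?h \<omega> (- i)\<bar>)" for \<omega>
  have intR: "integrable M R" unfolding R_def using int by auto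
  have R0: "0 \<le> R \<omega>" for \<omega> unfolding R_def by (intro sum_nonneg) auto
  have [measurable]: "R \<in> borel_measurable M" using intR by auto
  have ZR: "Z \<omega> \<subseteq> cball 0 (R \<omega>)" for \<omega>
  proof
    fix x assume x: "x \<in> Z \<omega>"
    have "\<bar>x \<bullet> i\<bar> \<le> \<bar>?h \<omega> i\<bar> + \<bar>?h \<omega> (- i)\<bar>" for i
      using support_fun_upper[OF convex_body_bounded[OF Z] x, of i]
        support_fun_upper[OF convex_body_bounded[OF Z] x, of "- i"] by simp
    then have "(\<Sum>i\<in>Basis. \<bar>x \<bullet> i\<bar>) \<le> R \<omega>" unfolding R_def by (intro sum_mono)
    then show "x \<in> cball 0 (R \<omega>)" using norm_le_l1[of x] by simp
  qed
  have hR: "\<bar>?h \<omega> u\<bar> \<le> R \<omega>" if "norm u = 1" for \<omega> u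
    using support_fun_abs_le[OF ZR[of \<omega>] convex_body_nonempty[OF Z], of u 0] that
      convex_body_nonempty[OF Z[of \<omega>]] by (simp add: support_fun_def)
  have FR: "F (Z \<omega>) \<le> R \<omega> * b" for \<omega>
    using mono[OF Z convex_body_cball[OF R0] ZR[of \<omega>]] unfolding cball_eq[OF R0[of \<omega>]] b_def .
  let ?I = "(\<integral>\<^sup>+\<omega>. ennreal (F (Z \<omega>)) \<partial>M)"
  \<comment> \<open>The constants are 8 = 4 + 3 + 1 and 7 = 4 + 3: 4 for the distance between the
    support functions of \<open>Q\<close> and \<open>L\<close>, 3 for the oscillation on a cell, 1
    for the remainder \<open>T\<close>. The lower estimate replaces \<open>F\<close> by 0 on the
    remainder.\<close>
  have main: "?I \<le> ennreal (F L + 8 * e * b) \<and>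
      ennreal (F L - 7 * e * b) \<le> ?I" if e: "0 < e" for e
  proof -
    obtain n where n: "1 \<le> n" "(\<integral>\<omega>. indicator {\<omega>\<in>space M. R \<omega> > real n} \<omega> * R \<omega> \<partial>M) \<le> e"
      using integral_tail_le[OF intR R0 e] .
    define T where "T = {\<omega>\<in>space M. R \<omega> > real n}"
    have [measurable]: "T \<in> sets M" unfolding T_def by measurable
    have intT: "integrable M (\<lambda>\<omega>. indicator T \<omega> * R \<omega>)"
      using integrable_mult_indicator[OF \<open>T \<in> sets M\<close> intR] by simp
    let ?t = "(\<integral>\<omega>. indicator T \<omega> * R \<omega> \<partial>M)"
    \<comment> \<open>Where \<open>R \<omega> \<le> n\<close> the support function has Lipschitz
      constant \<open>n\<close>, so moving to the nearest net direction costs at most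
      \<open>e\<close>.\<close>
    define d where "d = e / n"
    have d: "0 < d" "n * d = e" using e n by (auto simp: d_def)
    obtain U :: "'a set" where U: "finite U" "U \<subseteq> sphere 0 1"
      "\<And>v. norm v = 1 \<Longrightarrow> \<exists>u\<in>U. norm (v - u) < d"
      using sphere_net[OF d(1)] by blast
    \<comment> \<open>The label of a cell: the support values on the net, rounded down in units of
      \<open>e\<close>. Where \<open>R \<omega> \<le> n\<close> only finitely many labels
      occur.\<close>
    define \<kappa> where "\<kappa> \<omega> = (\<lambda>u\<in>U. \<lfloor>?h \<omega> u / e\<rfloor>)" for \<omega>
    define I where "I = (U \<rightarrow>\<^sub>E {- \<lceil>n / e\<rceil> - 1..\<lceil>n / e\<rceil>})"
    have finI: "finite I" using U by (auto simp: I_def intro: finite_PiE)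
    have \<kappa>I: "\<kappa> \<omega> \<in> I" if "R \<omega> \<le> n" for \<omega>
    proof -
      have "\<lfloor>?h \<omega> u / e\<rfloor> \<in> {- \<lceil>n / e\<rceil> - 1..\<lceil>n / e\<rceil>}" if "u \<in> U" for u
      proof -
        have "\<bar>?h \<omega> u\<bar> \<le> n" using hR[of u \<omega>] U \<open>R \<omega> \<le> n\<close> that by auto
        then have "\<bar>?h \<omega> u / e\<bar> \<le> n / e" using e by (simp add: abs_divide divide_right_mono)
        then have "- (n / e) \<le> ?h \<omega> u / e" "?h \<omega> u / e \<le> n / e" unfolding abs_le_iff by linarith+
        then show ?thesis unfolding atLeastAtMost_iff by linarith
      qed
      then show ?thesis by (auto simp: I_def \<kappa>_def)
    qed
    define A where "A k = {\<omega>\<in>space M. R \<omega> \<le> n \<and> (\<forall>u\<in>U. \<lfloor>?h \<omega> u / e\<rfloor> = k u)}" for k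
    have [measurable]: "A k \<in> sets M" for k
      unfolding A_def using U(1) by measurable
    have A_iff: "\<omega> \<in> A k \<longleftrightarrow> R \<omega> \<le> n \<and> \<kappa> \<omega> = k" if "\<omega> \<in> space M" "k \<in> I" for \<omega> k
      using that by (auto simp: A_def \<kappa>_def I_def PiE_def extensional_def fun_eq_iff)
    have sum_A: "(\<Sum>k\<in>I. indicator (A k) \<omega> * f k) = (if R \<omega> \<le> n then f (\<kappa> \<omega>) else 0)"
      if "\<omega> \<in> space M" for \<omega> and f :: "_ \<Rightarrow> real"
    proof -
      have "(\<Sum>k\<in>I. indicator (A k) \<omega> * f k) = (\<Sum>k\<in>I. if k = \<kappa> \<omega> then (if R \<omega> \<le> n then f k else 0) else 0)"
        using that by (intro sum.cong) (auto simp: A_iff indicator_def)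
      then show ?thesis using finI \<kappa>I[of \<omega>] by simp
    qed
    \<comment> \<open>A representative value of \<open>Z\<close> on the cell; \<open>{0}\<close> is
      a dummy for empty cells, which carry no weight.\<close>
    define D where "D k = (if A k = {} then {0} else Z (SOME \<omega>. \<omega> \<in> A k))" for k
    have D: "convex_body (D k)" for k using Z by (auto simp: D_def convex_body_def)
    \<comment> \<open>One \<open>e\<close> for the rounding at the net direction \<open>u\<close>,
      and one for each of the two moves between \<open>v\<close> and \<open>u\<close>.\<close>
    have close: "\<bar>?h \<omega> v - support_fun (D k) v\<bar> \<le> 3 * e"
      if mem: "\<omega> \<in> A k" and v: "norm v = 1" for \<omega> k v
    proof -
      define \<omega>' where "\<omega>' = (SOME \<omega>. \<omega> \<in> A k)"
      have \<omega>': "\<omega>' \<in> A k" unfolding \<omega>'_def using that(1) by (rule someI)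
      have Dk: "D k = Z \<omega>'" using that by (auto simp: D_def \<omega>'_def)
      obtain u where u: "u \<in> U" "norm (v - u) < d" using U(3)[OF v] by auto
      have "\<lfloor>?h \<omega> u / e\<rfloor> = \<lfloor>?h \<omega>' u / e\<rfloor>" using that(1) \<omega>' u by (simp add: A_def)
      then have "\<bar>?h \<omega> u / e - ?h \<omega>' u / e\<bar> \<le> 1" by linarith
      then have "\<bar>?h \<omega> u - ?h \<omega>' u\<bar> \<le> e"
        using e by (simp add: diff_divide_distrib[symmetric] abs_divide)
      moreover have "\<bar>?h \<omega> v - ?h \<omega> u\<bar> \<le> e" if "\<omega> \<in> A k" for \<omega>
      proof -
        have "\<bar>?h \<omega> v - ?h \<omega> u\<bar> \<le> R \<omega> * norm (v - u)"
          by (rule support_fun_abs_le[OF ZR convex_body_nonempty[OF Z]])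
        also have "\<dots> \<le> n * d" using that u R0 by (intro mult_mono) (auto simp: A_def)
        finally show ?thesis using d by simp
      qed
      from this[OF mem] this[OF \<omega>'] have "\<bar>?h \<omega> v - ?h \<omega> u\<bar> \<le> e" "\<bar>?h \<omega>' v - ?h \<omega>' u\<bar> \<le> e" by auto
      ultimately show ?thesis unfolding Dk by linarith
    qed
    have F_close: "F (Z \<omega>) \<le> F (D k) + 3 * e * b" "F (D k) \<le> F (Z \<omega>) + 3 * e * b" if "\<omega> \<in> A k" for \<omega> k
      using close[OF that] e unfolding b_def
      by (intro le_if_support_fun_le Z D; force simp: abs_le_iff)+
    define p where "p k = measure M (A k)" for k
    have p: "0 \<le> p k" for k by (simp add: p_def)
    obtain Q where Q: "convex_body Q" "F Q = (\<Sum>k\<in>I. p k * F (D k))"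
      "\<And>u. support_fun Q u = (\<Sum>k\<in>I. p k * support_fun (D k) u)"
      using weighted_sum[OF finI, of p D] p D by blast
    have int_sum: "integrable M (\<lambda>\<omega>. \<Sum>k\<in>I. indicator (A k) \<omega> * f k)"
      "(\<integral>\<omega>. (\<Sum>k\<in>I. indicator (A k) \<omega> * f k) \<partial>M) = (\<Sum>k\<in>I. p k * f k)" for f :: "_ \<Rightarrow> real"
      by (auto simp: p_def intro!: Bochner_Integration.integrable_sum integrable_mult_left
          integrable_real_indicator simp: emeasure_eq_measure)
    have sum_p: "(\<Sum>k\<in>I. p k) \<le> 1"
    proof -
      have "(\<Sum>k\<in>I. p k) = (\<integral>\<omega>. (\<Sum>k\<in>I. indicator (A k) \<omega> * 1) \<partial>M)" by (subst int_sum(2)) simp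
      also have "\<dots> \<le> (\<integral>\<omega>. 1 \<partial>M)"
      proof (intro integral_mono int_sum(1))
        fix \<omega> assume "\<omega> \<in> space M"
        then show "(\<Sum>k\<in>I. indicator (A k) \<omega> * 1) \<le> (1 :: real)" by (subst sum_A) auto
      qed simp
      finally show ?thesis by (simp add: prob_space)
    qed
    \<comment> \<open>On the cells the error is at most \<open>3 * e\<close>; on the remainder the
      sum is 0 and the error is at most \<open>R\<close>, whose mean there is at most
      \<open>e\<close>.\<close>
    have hQ: "\<bar>support_fun Q u - support_fun L u\<bar> \<le> 4 * e" if u: "norm u = 1" for u
    proof -
      let ?s = "\<lambda>\<omega>. \<Sum>k\<in>I. indicator (A k) \<omega> * support_fun (D k) u"
      have "support_fun Q u - support_fun L u = (\<integral>\<omega>. ?s \<omega> \<partial>M) - (\<integral>\<omega>. ?h \<omega> u \<partial>M)"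
        by (simp only: Q(3) int_sum(2) mean)
      also have "\<dots> = (\<integral>\<omega>. ?s \<omega> - ?h \<omega> u \<partial>M)"
        by (rule Bochner_Integration.integral_diff[symmetric]) (intro int_sum int)+
      finally have "\<bar>support_fun Q u - support_fun L u\<bar> \<le> (\<integral>\<omega>. \<bar>?s \<omega> - ?h \<omega> u\<bar> \<partial>M)"
        by (simp add: integral_abs_bound)
      also have "\<dots> \<le> (\<integral>\<omega>. 3 * e + indicator T \<omega> * R \<omega> \<partial>M)"
      proof (rule integral_mono)
        show "integrable M (\<lambda>\<omega>. \<bar>?s \<omega> - ?h \<omega> u\<bar>)"
          by (intro integrable_abs Bochner_Integration.integrable_diff int_sum int)
        show "integrable M (\<lambda>\<omega>. 3 * e + indicator T \<omega> * R \<omega>)"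
          using intT by (intro Bochner_Integration.integrable_add) auto
        fix \<omega> assume \<omega>: "\<omega> \<in> space M"
        show "\<bar>?s \<omega> - ?h \<omega> u\<bar> \<le> 3 * e + indicator T \<omega> * R \<omega>"
        proof (cases "R \<omega> \<le> n")
          case True
          then have "\<omega> \<in> A (\<kappa> \<omega>)" using A_iff[OF \<omega> \<kappa>I[OF True]] by simp
          from close[OF this u] show ?thesis
            using True by (simp add: sum_A[OF \<omega>] abs_minus_commute T_def)
        next
          case False
          then show ?thesis using hR[OF u, of \<omega>] e \<omega> by (simp add: sum_A[OF \<omega>] T_def)
        qed
      qed
      also have "\<dots> = 3 * e + ?t"
        using intT by (subst Bochner_Integration.integral_add) (auto simp: prob_space)
      also have "\<dots> \<le> 4 * e" using n(2) by (simp add: T_def)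
      finally show ?thesis .
    qed
    have FQ: "F Q \<le> F L + 4 * e * b" "F L \<le> F Q + 4 * e * b"
      using hQ e unfolding b_def by (intro le_if_support_fun_le Q L; force simp: abs_le_iff)+
    let ?up = "\<lambda>\<omega>. (\<Sum>k\<in>I. indicator (A k) \<omega> * (F (D k) + 3 * e * b)) + indicator T \<omega> * R \<omega> * b"
    have int_up: "integrable M ?up"
      using intT by (intro Bochner_Integration.integrable_add int_sum) auto
    have F_up: "F (Z \<omega>) \<le> ?up \<omega>" if \<omega>: "\<omega> \<in> space M" for \<omega>
    proof (cases "R \<omega> \<le> n")
      case True
      then have "\<omega> \<in> A (\<kappa> \<omega>)" using A_iff[OF \<omega> \<kappa>I[OF True]] by simp
      from F_close(1)[OF this] show ?thesis using True by (simp add: sum_A[OF \<omega>] T_def)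
    next
      case False
      then show ?thesis using FR[of \<omega>] \<omega> by (simp add: sum_A[OF \<omega>] T_def)
    qed
    have up_nonneg: "0 \<le> ?up \<omega>" if "\<omega> \<in> space M" for \<omega>
      using F_up[OF that] nonneg[OF Z[of \<omega>]] by linarith
    have "?I \<le> (\<integral>\<^sup>+\<omega>. ennreal (?up \<omega>) \<partial>M)"
      by (intro nn_integral_mono ennreal_leI F_up)
    also have "\<dots> = ennreal (\<integral>\<omega>. ?up \<omega> \<partial>M)"
      using up_nonneg by (intro nn_integral_eq_integral int_up) auto
    also have "(\<integral>\<omega>. ?up \<omega> \<partial>M) = (\<Sum>k\<in>I. p k * (F (D k) + 3 * e * b)) + ?t * b"
      using intT by (subst Bochner_Integration.integral_add) (auto intro!: int_sum(1) simp: int_sum(2))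
    also have "(\<Sum>k\<in>I. p k * (F (D k) + 3 * e * b)) = F Q + (\<Sum>k\<in>I. p k) * (3 * e * b)"
      by (simp add: Q(2) distrib_left sum.distrib sum_distrib_right)
    also have "ennreal (F Q + (\<Sum>k\<in>I. p k) * (3 * e * b) + ?t * b)
        \<le> ennreal (F L + 8 * e * b)"
    proof (rule ennreal_leI)
      have "(\<Sum>k\<in>I. p k) * (3 * e * b) \<le> 1 * (3 * e * b)"
        using sum_p e b by (intro mult_right_mono) auto
      moreover have "?t * b \<le> e * b"
        using n(2) b by (intro mult_right_mono) (auto simp: T_def)
      ultimately show "F Q + (\<Sum>k\<in>I. p k) * (3 * e * b) + ?t * b \<le> F L + 8 * e * b"
        using FQ(1) by (simp add: algebra_simps)
    qed
    finally have upper: "?I \<le> ennreal (F L + 8 * e * b)" .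
    let ?lo = "\<lambda>\<omega>. (\<Sum>k\<in>I. indicator (A k) \<omega> * (F (D k) - 3 * e * b))"
    have F_lo: "max 0 (?lo \<omega>) \<le> F (Z \<omega>)" if \<omega>: "\<omega> \<in> space M" for \<omega>
    proof (cases "R \<omega> \<le> n")
      case True
      then have "\<omega> \<in> A (\<kappa> \<omega>)" using A_iff[OF \<omega> \<kappa>I[OF True]] by simp
      from F_close(2)[OF this] show ?thesis using True nonneg[OF Z[of \<omega>]] by (simp add: sum_A[OF \<omega>])
    next
      case False
      then show ?thesis using nonneg[OF Z[of \<omega>]] by (simp add: sum_A[OF \<omega>])
    qed
    have int_lo: "integrable M (\<lambda>\<omega>. max 0 (?lo \<omega>))"
      by (intro integrable_max int_sum) auto
    have "F L - 7 * e * b \<le> F Q - 3 * e * b" using FQ(2) by (simp add: algebra_simps)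
    also have "\<dots> \<le> F Q - (\<Sum>k\<in>I. p k) * (3 * e * b)"
      using sum_p e b mult_right_mono[of "\<Sum>k\<in>I. p k" 1 "3 * e * b"] by simp
    also have "\<dots> = (\<Sum>k\<in>I. p k * (F (D k) - 3 * e * b))"
      by (simp add: Q(2) right_diff_distrib sum_subtractf sum_distrib_right)
    also have "\<dots> = (\<integral>\<omega>. ?lo \<omega> \<partial>M)" by (simp only: int_sum(2))
    also have "\<dots> \<le> (\<integral>\<omega>. max 0 (?lo \<omega>) \<partial>M)" by (intro integral_mono int_sum int_lo) simp
    finally have "ennreal (F L - 7 * e * b) \<le> ennreal (\<integral>\<omega>. max 0 (?lo \<omega>) \<partial>M)" by (rule ennreal_leI)
    also have "\<dots> = (\<integral>\<^sup>+\<omega>. ennreal (max 0 (?lo \<omega>)) \<partial>M)"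
      by (intro nn_integral_eq_integral[symmetric] int_lo) auto
    also have "\<dots> \<le> ?I"
      by (intro nn_integral_mono ennreal_leI F_lo)
    finally show ?thesis using upper by simp
  qed
  have "?I < top"
    using main[of 1] by (auto intro: le_less_trans)
  then obtain r where r: "0 \<le> r" "?I = ennreal r"
    by (auto simp: less_top_ennreal)
  have FL: "0 \<le> F L" by (rule nonneg[OF L])
  have le: "r \<le> F L + 8 * e * b" "F L - 7 * e * b \<le> r" if "0 < e" for e
  proof -
    have "0 \<le> F L + 8 * e * b" using FL b that by simp
    then show "r \<le> F L + 8 * e * b" "F L - 7 * e * b \<le> r"
      using main[OF that] unfolding r(2) by (simp_all only: ennreal_le_iff r(1))
  qed
  have "r \<le> F L"
  proof (rule field_le_epsilon)
    fix e :: real assume "0 < e"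
    \<comment> \<open>Since \<open>b\<close> may be 0, the division is by
      \<open>b + 1\<close>.\<close>
    then have "0 < e / (8 * (b + 1))" using b by simp
    from le(1)[OF this] have "r \<le> F L + e * (b / (b + 1))" using b by (simp add: field_simps)
    also have "\<dots> \<le> F L + e" using b \<open>0 < e\<close> by (simp add: field_simps)
    finally show "r \<le> F L + e" .
  qed
  moreover have "F L \<le> r"
  proof (rule field_le_epsilon)
    fix e :: real assume "0 < e"
    then have "0 < e / (7 * (b + 1))" using b by simp
    from le(2)[OF this] have "F L \<le> r + e * (b / (b + 1))" using b by (simp add: field_simps)
    also have "\<dots> \<le> r + e" using b \<open>0 < e\<close> by (simp add: field_simps)
    finally show "F L \<le> r + e" .
  qed
  ultimately show ?thesis using r by simp
qed

end

section \<open>Symmetric stable variables\<close>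

text \<open>For |x| > 1 choose k with 2^k \<le> |x| < 2^(k+1). Then |x| / 2^k lies between 1 and 2,
  where 1 - cos is at least 1 - cos 1, so this single term is at least |x|. The purpose is to bound
  a first moment by the characteristic function.\<close>

lemma abs_le_dyadic_cos_series:
  fixes x :: real
  shows "ennreal \<bar>x\<bar> \<le> 1 + (\<Sum>k. ennreal (2 / (1 - cos 1) * (2 ^ k * (1 - cos (1 / 2 ^ k * x)))))"
proof (cases "\<bar>x\<bar> \<le> 1")
  case True
  then have "ennreal \<bar>x\<bar> \<le> 1" by (simp add: ennreal_le_1)
  then show ?thesis by (rule add_increasing2[rotated]) simp
next
  case False
  define k where "k = nat \<lfloor>log 2 \<bar>x\<bar>\<rfloor>"
  have k: "2 powr k \<le> \<bar>x\<bar>" "\<bar>x\<bar> < 2 powr (k + 1)"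
  proof -
    have "0 \<le> log 2 \<bar>x\<bar>" using False by simp
    then have "real k \<le> log 2 \<bar>x\<bar>" "log 2 \<bar>x\<bar> < k + 1" unfolding k_def by linarith+
    then show "2 powr k \<le> \<bar>x\<bar>" "\<bar>x\<bar> < 2 powr (k + 1)"
      using False by (simp_all add: le_log_iff log_less_iff)
  qed
  then have k': "2 ^ k \<le> \<bar>x\<bar>" "\<bar>x\<bar> < 2 * 2 ^ k" by (simp_all add: powr_add powr_realpow)
  define y where "y = \<bar>x\<bar> / 2 ^ k"
  have y: "1 \<le> y" "y < 2" using k' by (simp_all add: y_def field_simps)
  have "cos y \<le> cos 1" using y pi_gt3 by (intro cos_monotone_0_pi_le) auto
  moreover have "cos (1 / 2 ^ k * x) = cos y"
    using cos_abs_real[of "1 / 2 ^ k * x"] by (simp add: y_def abs_mult abs_divide)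
  moreover have c1: "cos 1 < (1 :: real)" using cos_monotone_0_pi[of 0 1] pi_gt3 by simp
  ultimately have "1 \<le> (1 - cos (1 / 2 ^ k * x)) / (1 - cos 1)" by simp
  moreover have "\<bar>x\<bar> \<le> 2 * 2 ^ k" using k' by simp
  ultimately have *: "\<bar>x\<bar> * 1 \<le> (2 * 2 ^ k) * ((1 - cos (1 / 2 ^ k * x)) / (1 - cos 1))"
    by (intro mult_mono) auto
  have "ennreal \<bar>x\<bar> \<le> ennreal (2 / (1 - cos 1) * (2 ^ k * (1 - cos (1 / 2 ^ k * x))))"
  proof (intro ennreal_leI)
    have eq: "(2 * 2 ^ k) * (a / d) = 2 / d * (2 ^ k * a)" for a d :: real by simp
    show "\<bar>x\<bar> \<le> 2 / (1 - cos 1) * (2 ^ k * (1 - cos (1 / 2 ^ k * x)))"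
      by (rule ord_le_eq_trans[OF *[unfolded mult_1_right] eq])
  qed
  also have "\<dots> \<le> (\<Sum>k. ennreal (2 / (1 - cos 1) * (2 ^ k * (1 - cos (1 / 2 ^ k * x)))))"
  proof -
    have "f k \<le> (\<Sum>k. f k)" for f :: "nat \<Rightarrow> ennreal"
      using sum_le_suminf[of f "{k}"] by simp
    then show ?thesis .
  qed
  also have "\<dots> \<le> 1 + \<dots>" by simp
  finally show ?thesis .
qed

context prob_space
begin

lemma integral_cos_eq_Re_char:
  assumes [measurable]: "Y \<in> borel_measurable M"
  shows "(\<integral>\<omega>. cos (u * Y \<omega>) \<partial>M) = Re (char (distr M borel Y) u)"
proof -
  have int: "integrable M (\<lambda>\<omega>. iexp (u * Y \<omega>))"
    by (rule integrable_const_bound[where B=1]) auto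
  have "char (distr M borel Y) u = (\<integral>\<omega>. iexp (u * Y \<omega>) \<partial>M)"
    unfolding char_def by (subst integral_distr) auto
  also have "Re \<dots> = (\<integral>\<omega>. Re (iexp (u * Y \<omega>)) \<partial>M)"
    using int by (rule integral_Re[symmetric])
  finally show ?thesis by (simp add: Re_exp)
qed

text \<open>The mean of 1 - cos (Y / 2^k) is 1 - exp (- c 2^(-k \<alpha>)), at most c 2^(-k
  \<alpha>). The cosine series is therefore dominated in mean by a geometric series of ratio 2^(1 -
  \<alpha>), which converges as \<alpha> > 1.\<close>

lemma stable_integrable:
  assumes Y[measurable]: "Y \<in> borel_measurable M" and "1 < \<alpha>" "0 \<le> c"
    and char: "\<And>u. char (distr M borel Y) u = complex_of_real (exp (- c * \<bar>u\<bar> powr \<alpha>))"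
  shows "integrable M Y"
proof -
  let ?\<gamma> = "2 / (1 - cos 1) :: real"
  have \<gamma>: "0 \<le> ?\<gamma>" by simp
  have int: "integrable M (\<lambda>\<omega>. 1 - cos (u * Y \<omega>))" for u
    by (rule integrable_const_bound[where B=2]) (auto intro!: AE_I2 order_trans[OF abs_triangle_ineq4])
  have term_le: "(\<integral>\<^sup>+\<omega>. ennreal (?\<gamma> * (2 ^ k * (1 - cos (1 / 2 ^ k * Y \<omega>)))) \<partial>M)
      \<le> ennreal (?\<gamma> * c * (2 powr (1 - \<alpha>)) ^ k)" for k :: nat
  proof -
    have "(\<integral>\<^sup>+\<omega>. ennreal (?\<gamma> * (2 ^ k * (1 - cos (1 / 2 ^ k * Y \<omega>)))) \<partial>M)
        = ennreal (\<integral>\<omega>. ?\<gamma> * (2 ^ k * (1 - cos (1 / 2 ^ k * Y \<omega>))) \<partial>M)"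
      using \<gamma> by (intro nn_integral_eq_integral integrable_mult_right int) (auto intro!: AE_I2 mult_nonneg_nonneg)
    also have "(\<integral>\<omega>. ?\<gamma> * (2 ^ k * (1 - cos (1 / 2 ^ k * Y \<omega>))) \<partial>M)
        = ?\<gamma> * (2 ^ k * (\<integral>\<omega>. 1 - cos (1 / 2 ^ k * Y \<omega>) \<partial>M))"
      by (simp only: integral_mult_right_zero)
    also have "(\<integral>\<omega>. 1 - cos (1 / 2 ^ k * Y \<omega>) \<partial>M) = 1 - exp (- c * \<bar>1 / 2 ^ k\<bar> powr \<alpha>)"
    proof -
      have "integrable M (\<lambda>\<omega>. cos (1 / 2 ^ k * Y \<omega>))"
        by (rule integrable_const_bound[where B=1]) auto
      then have "(\<integral>\<omega>. 1 - cos (1 / 2 ^ k * Y \<omega>) \<partial>M) = 1 - (\<integral>\<omega>. cos (1 / 2 ^ k * Y \<omega>) \<partial>M)"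
        by (subst Bochner_Integration.integral_diff) (auto simp: prob_space)
      then show ?thesis by (simp only: integral_cos_eq_Re_char[OF Y] char Re_complex_of_real)
    qed
    also have "?\<gamma> * (2 ^ k * (1 - exp (- c * \<bar>1 / 2 ^ k\<bar> powr \<alpha>))) \<le> ?\<gamma> * (2 ^ k * (c * \<bar>1 / 2 ^ k\<bar> powr \<alpha>))"
      using exp_ge_add_one_self[of "- c * \<bar>1 / 2 ^ k\<bar> powr \<alpha>"] \<gamma>
      by (intro mult_left_mono) auto
    also have "2 ^ k * (c * \<bar>1 / 2 ^ k\<bar> powr \<alpha>) = c * (2 powr (1 - \<alpha>)) ^ k"
    proof -
      have "\<bar>1 / 2 ^ k :: real\<bar> = 2 powr (- real k)" by (simp add: powr_minus_divide powr_realpow)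
      moreover have "(2 :: real) ^ k = 2 powr k" by (simp add: powr_realpow)
      ultimately show ?thesis
        by (simp add: powr_powr powr_add[symmetric] powr_power algebra_simps)
    qed
    finally show ?thesis by (simp add: ennreal_leI mult.assoc)
  qed
  have "2 powr (1 - \<alpha>) < 2 powr (0 :: real)" using \<open>1 < \<alpha>\<close> by (intro powr_less_mono) auto
  then have geo: "summable (\<lambda>k. ?\<gamma> * c * (2 powr (1 - \<alpha>)) ^ k)"
    by (intro summable_mult summable_geometric) simp
  have "(\<integral>\<^sup>+\<omega>. ennreal \<bar>Y \<omega>\<bar> \<partial>M) \<le>
      (\<integral>\<^sup>+\<omega>. 1 + (\<Sum>k. ennreal (?\<gamma> * (2 ^ k * (1 - cos (1 / 2 ^ k * Y \<omega>))))) \<partial>M)"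
    by (intro nn_integral_mono abs_le_dyadic_cos_series)
  also have "\<dots> = 1 + (\<Sum>k. \<integral>\<^sup>+\<omega>. ennreal (?\<gamma> * (2 ^ k * (1 - cos (1 / 2 ^ k * Y \<omega>)))) \<partial>M)"
    by (subst nn_integral_add) (auto simp: nn_integral_suminf emeasure_space_1)
  also have "\<dots> \<le> 1 + (\<Sum>k. ennreal (?\<gamma> * c * (2 powr (1 - \<alpha>)) ^ k))"
    by (intro add_left_mono suminf_le term_le) auto
  also have "\<dots> < \<infinity>"
    using geo \<open>0 \<le> c\<close> \<gamma> by (subst suminf_ennreal2) (auto intro!: mult_nonneg_nonneg)
  finally show ?thesis by (intro integrableI_bounded) auto
qed

text \<open>A symmetric stable variable with scale \<open>c\<close> is distributed as \<open>c\<close> to the power \<open>1 / \<alpha>\<close>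
  times a standard one.\<close>
lemma stable_positive_part:
  assumes Y[measurable]: "Y \<in> borel_measurable M" and U[measurable]: "U \<in> borel_measurable M"
    and "1 < \<alpha>" "0 \<le> c"
    and charY: "\<And>u. char (distr M borel Y) u = complex_of_real (exp (- c * \<bar>u\<bar> powr \<alpha>))"
    and charU: "\<And>u. char (distr M borel U) u = complex_of_real (exp (- 1 * \<bar>u\<bar> powr \<alpha>))"
  shows "(\<integral>\<omega>. max 0 (Y \<omega>) \<partial>M) = c powr (1 / \<alpha>) * ((\<integral>\<omega>. \<bar>U \<omega>\<bar> \<partial>M) / 2)"
proof -
  have intU: "integrable M U" by (rule stable_integrable[OF U \<open>1 < \<alpha>\<close> _ charU]) simp
  have char_scale: "char (distr M borel (\<lambda>\<omega>. b * U \<omega>)) u = char (distr M borel U) (u * b)" for b u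
    unfolding char_def by (simp add: integral_distr mult.assoc)
  let ?b = "c powr (1 / \<alpha>)"
  have "distr M borel Y = distr M borel (\<lambda>\<omega>. ?b * U \<omega>)"
  proof (rule Levy_uniqueness)
    show "char (distr M borel Y) = char (distr M borel (\<lambda>\<omega>. ?b * U \<omega>))"
    proof
      fix u
      have "\<bar>u * ?b\<bar> powr \<alpha> = c * \<bar>u\<bar> powr \<alpha>"
        using \<open>1 < \<alpha>\<close> \<open>0 \<le> c\<close> by (simp add: abs_mult powr_mult powr_powr)
      then show "char (distr M borel Y) u = char (distr M borel (\<lambda>\<omega>. ?b * U \<omega>)) u"
        by (simp only: char_scale charY charU) simp
    qed
  qed (auto intro!: real_distribution_distr)
  then have "(\<integral>x. max 0 x \<partial>distr M borel Y) = (\<integral>x. max 0 x \<partial>distr M borel (\<lambda>\<omega>. ?b * U \<omega>))" by simp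
  then have "(\<integral>\<omega>. max 0 (Y \<omega>) \<partial>M) = (\<integral>\<omega>. max 0 (?b * U \<omega>) \<partial>M)"
    by (simp add: integral_distr)
  also have "\<dots> = (\<integral>\<omega>. ?b * max 0 (U \<omega>) \<partial>M)"
    by (intro Bochner_Integration.integral_cong refl) (simp add: max_mult_distrib_left)
  also have "\<dots> = ?b * (\<integral>\<omega>. max 0 (U \<omega>) \<partial>M)" by simp
  \<comment> \<open>By symmetry \<open>U\<close> has mean 0, and its positive part is half of
    \<open>\<bar>U\<bar> + U\<close>.\<close>
  also have "(\<integral>\<omega>. max 0 (U \<omega>) \<partial>M) = (\<integral>\<omega>. \<bar>U \<omega>\<bar> \<partial>M) / 2"
  proof -
    have "distr M borel U = distr M borel (\<lambda>\<omega>. - 1 * U \<omega>)"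
    proof (rule Levy_uniqueness)
      show "char (distr M borel U) = char (distr M borel (\<lambda>\<omega>. - 1 * U \<omega>))"
        by (intro ext) (simp only: char_scale charU, simp)
    qed (auto intro!: real_distribution_distr)
    then have "(\<integral>x. x \<partial>distr M borel U) = (\<integral>x. x \<partial>distr M borel (\<lambda>\<omega>. - 1 * U \<omega>))" by simp
    then have "(\<integral>\<omega>. U \<omega> \<partial>M) = 0" by (simp add: integral_distr)
    moreover have "(\<integral>\<omega>. max 0 (U \<omega>) \<partial>M) = (\<integral>\<omega>. (\<bar>U \<omega>\<bar> + U \<omega>) / 2 \<partial>M)"
      by (intro Bochner_Integration.integral_cong refl) (auto simp: max_def)
    ultimately show ?thesis using intU by (simp add: Bochner_Integration.integral_add)
  qed
  finally show ?thesis .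
qed

end

text \<open>A Riemann sum of x^(\<beta> - 1) over the unit interval. As this function is unbounded
  at 0 for \<beta> < 1, the sum is compared directly with increments of x^\<beta> by the mean value
  theorem. For \<beta> = 1 / \<alpha> the limit is the factor \<alpha> of the constant.\<close>

lemma sum_powr_mean:
  fixes \<beta> :: real
  assumes "0 < \<beta>" "\<beta> \<le> 1"
  shows "(\<lambda>n. (\<Sum>k=1..n. (1 / real k) * (real k / real n) powr \<beta>)) \<longlonglongrightarrow> 1 / \<beta>"
proof -
  have powr_deriv: "((\<lambda>x. x powr \<beta>) has_real_derivative \<beta> * x powr (\<beta> - 1)) (at x)" if "0 < x" for x
    using that by (auto intro!: derivative_eq_intros)
  have mvt: "\<exists>z. a < z \<and> z < a + 1 \<and> (a + 1) powr \<beta> - a powr \<beta> = \<beta> * z powr (\<beta> - 1)" if "0 \<le> a" for a :: real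
  proof -
    have "\<exists>l z. a < z \<and> z < a + 1 \<and> DERIV (\<lambda>x. x powr \<beta>) z :> l \<and>
        (a + 1) powr \<beta> - a powr \<beta> = (a + 1 - a) * l"
    proof (rule MVT)
      show "continuous_on {a..a + 1} (\<lambda>x. x powr \<beta>)"
        using that assms by (intro continuous_on_powr' continuous_intros) auto
      show "(\<lambda>x. x powr \<beta>) differentiable (at x)" if "a < x" for x
        using powr_deriv[of x] that \<open>0 \<le> a\<close> by (auto simp: real_differentiable_def)
    qed simp
    then obtain l z where z: "a < z" "z < a + 1" "DERIV (\<lambda>x. x powr \<beta>) z :> l"
      "(a + 1) powr \<beta> - a powr \<beta> = l" by auto
    have "l = \<beta> * z powr (\<beta> - 1)"
      using DERIV_unique[OF z(3) powr_deriv[of z]] z that by simp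
    then show ?thesis using z by auto
  qed
  have upper: "\<beta> * (\<Sum>k=1..n. real k powr (\<beta> - 1)) \<le> real n powr \<beta>" for n
  proof (induction n)
    case (Suc n)
    obtain z where z: "real n < z" "z < real n + 1" "(real n + 1) powr \<beta> - real n powr \<beta> = \<beta> * z powr (\<beta> - 1)"
      using mvt[of "real n"] by auto
    have "(real n + 1) powr (\<beta> - 1) \<le> z powr (\<beta> - 1)" using z assms by (intro powr_mono2') auto
    then have "\<beta> * (real n + 1) powr (\<beta> - 1) \<le> (real n + 1) powr \<beta> - real n powr \<beta>"
      unfolding z(3) using assms by (intro mult_left_mono) auto
    then show ?case using Suc by (simp add: distrib_left add.commute)
  qed simp
  have lower: "(real n + 1) powr \<beta> - 1 \<le> \<beta> * (\<Sum>k=1..n. real k powr (\<beta> - 1))" for n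
  proof (induction n)
    case (Suc n)
    obtain z where z: "real n + 1 < z" "z < real n + 1 + 1"
      "(real n + 1 + 1) powr \<beta> - (real n + 1) powr \<beta> = \<beta> * z powr (\<beta> - 1)"
      using mvt[of "real n + 1"] by auto
    have "z powr (\<beta> - 1) \<le> (real n + 1) powr (\<beta> - 1)" using z assms by (intro powr_mono2') auto
    then have "(real n + 1 + 1) powr \<beta> - (real n + 1) powr \<beta> \<le> \<beta> * (real n + 1) powr (\<beta> - 1)"
      unfolding z(3) using assms by (intro mult_left_mono) auto
    then show ?case using Suc by (simp add: distrib_left add.commute)
  qed simp
  have eq: "(\<Sum>k=1..n. (1 / real k) * (real k / real n) powr \<beta>) =
      (\<beta> * (\<Sum>k=1..n. real k powr (\<beta> - 1))) / real n powr \<beta> / \<beta>" for n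
  proof -
    have "(\<Sum>k=1..n. (1 / real k) * (real k / real n) powr \<beta>) = (\<Sum>k=1..n. real k powr (\<beta> - 1) / real n powr \<beta>)"
      by (intro sum.cong refl) (simp add: powr_divide powr_diff)
    also have "\<dots> = (\<beta> * (\<Sum>k=1..n. real k powr (\<beta> - 1))) / real n powr \<beta> / \<beta>"
      using assms by (simp add: sum_divide_distrib)
    finally show ?thesis .
  qed
  have "(\<lambda>n. (\<beta> * (\<Sum>k=1..n. real k powr (\<beta> - 1))) / real n powr \<beta>) \<longlonglongrightarrow> 1"
  proof (rule tendsto_sandwich)
    show "\<forall>\<^sub>F n in sequentially. ((real n + 1) powr \<beta> - 1) / real n powr \<beta> \<le>
        (\<beta> * (\<Sum>k=1..n. real k powr (\<beta> - 1))) / real n powr \<beta>"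
      using lower by (auto intro!: always_eventually divide_right_mono)
    show "\<forall>\<^sub>F n in sequentially. (\<beta> * (\<Sum>k=1..n. real k powr (\<beta> - 1))) / real n powr \<beta> \<le> 1"
      using upper by (auto intro!: always_eventually simp: divide_le_eq_1)
    show "(\<lambda>n. ((real n + 1) powr \<beta> - 1) / real n powr \<beta>) \<longlonglongrightarrow> 1"
      using assms by real_asymp
  qed auto
  from tendsto_divide[OF this tendsto_const[of \<beta>]] show ?thesis
    unfolding eq using assms by simp
qed

section \<open>Spitzer's identity for the expected maximum\<close>

definition psum :: "(nat \<Rightarrow> real) \<Rightarrow> nat \<Rightarrow> real" where
  "psum w k = (\<Sum>i<k. w i)"

primrec pmax :: "(nat \<Rightarrow> real) \<Rightarrow> nat \<Rightarrow> real" where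
  "pmax w 0 = 0"
| "pmax w (Suc k) = max (pmax w k) (psum w (Suc k))"

lemma psum_cong: "(\<And>i. i < k \<Longrightarrow> w i = w' i) \<Longrightarrow> psum w k = psum w' k"
  unfolding psum_def by (intro sum.cong) auto

lemma pmax_cong: "(\<And>i. i < k \<Longrightarrow> w i = w' i) \<Longrightarrow> pmax w k = pmax w' k"
proof (induction k)
  case (Suc k)
  then show ?case using psum_cong[of "Suc k" w w'] by simp
qed simp

lemma pmax_nonneg: "0 \<le> pmax w k"
  by (induction k) (auto simp: le_max_iff_disj)

lemma psum_le_pmax: "k \<le> n \<Longrightarrow> psum w k \<le> pmax w n"
proof (induction n)
  case (Suc n)
  then show ?case by (cases "k = Suc n") (auto simp: le_max_iff_disj)
qed (simp add: psum_def)

lemma pmax_least: "(\<And>k. k \<le> n \<Longrightarrow> psum w k \<le> c) \<Longrightarrow> pmax w n \<le> c"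
proof (induction n)
  case 0
  then show ?case using 0[of 0] by (simp add: psum_def)
qed simp

lemma psum_shift: "psum w (Suc k) = w 0 + psum (\<lambda>i. w (Suc i)) k"
  unfolding psum_def by (rule sum.lessThan_Suc_shift)

lemma pmax_shift: "pmax w (Suc m) = max 0 (w 0 + pmax (\<lambda>i. w (Suc i)) m)"
proof (induction m)
  case 0
  then show ?case by (simp add: psum_def)
next
  case (Suc m)
  have "pmax w (Suc (Suc m)) = max (pmax w (Suc m)) (psum w (Suc (Suc m)))" by simp
  then show ?case unfolding Suc.IH psum_shift[of w "Suc m"] by simp
qed

text \<open>A positive last sum makes the maximum positive, so it is attained after the first step;
  a last sum that is not positive cannot raise a maximum that includes 0.\<close>

lemma pmax_Suc_split:
  "pmax w (Suc m) = (if psum w (Suc m) > 0 then w 0 + pmax (\<lambda>i. w (Suc i)) m else pmax w m)"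
proof (cases "psum w (Suc m) > 0")
  case True
  then have "0 < pmax w (Suc m)" using psum_le_pmax[of "Suc m" "Suc m" w] by linarith
  then show ?thesis unfolding pmax_shift using True by (simp add: max_def split: if_splits)
next
  case False
  then show ?thesis using pmax_nonneg[of w m] by simp
qed

lemma measurable_psum:
  assumes "k \<le> n" shows "(\<lambda>w. psum w k) \<in> borel_measurable (PiM {..<n} (\<lambda>_. borel))"
  unfolding psum_def using assms by (intro borel_measurable_sum measurable_component_singleton) auto

lemma measurable_pmax:
  assumes "k \<le> n" shows "(\<lambda>w. pmax w k) \<in> borel_measurable (PiM {..<n} (\<lambda>_. borel))"
  using assms
proof (induction k)
  case (Suc k)
  then show ?case unfolding pmax.simps by (intro borel_measurable_max measurable_psum) auto
qed simp

context prob_space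
begin

text \<open>Exchangeability of every initial block, expressed by expectations of measurable
  functions of the block. The functions need not be integrable: for equal laws both Bochner
  integrals are then 0.\<close>

definition exchangeable :: "(nat \<Rightarrow> 'a \<Rightarrow> real) \<Rightarrow> bool" where
  "exchangeable W \<longleftrightarrow> (\<forall>n \<rho> \<phi>. bij_betw \<rho> {..<n} {..<n} \<longrightarrow> \<phi> \<in> borel_measurable (PiM {..<n} (\<lambda>_. borel)) \<longrightarrow>
    (\<integral>\<omega>. \<phi> (\<lambda>i\<in>{..<n}. W (\<rho> i) \<omega>) \<partial>M) = (\<integral>\<omega>. \<phi> (\<lambda>i\<in>{..<n}. W i \<omega>) \<partial>M :: real))"

lemma integrable_psum:
  "(\<And>i. integrable M (W i)) \<Longrightarrow> integrable M (\<lambda>\<omega>. psum (\<lambda>i. W i \<omega>) k)"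
  unfolding psum_def by (intro Bochner_Integration.integrable_sum)

lemma integrable_pmax:
  "(\<And>i. integrable M (W i)) \<Longrightarrow> integrable M (\<lambda>\<omega>. pmax (\<lambda>i. W i \<omega>) k)"
proof (induction k)
  case (Suc k)
  show ?case unfolding pmax.simps by (intro integrable_max integrable_psum Suc)
qed simp

text \<open>On the event that the last partial sum is positive, the maximum is the first step plus the
  maximum of the walk with the steps shifted by one; a cyclic rotation of the steps turns the
  latter into the previous maximum.\<close>
lemma spitzer_step:
  assumes int: "\<And>i. integrable M (W i)" and exch: "exchangeable W"
  shows "(\<integral>\<omega>. pmax (\<lambda>i. W i \<omega>) (Suc m) \<partial>M) = (\<integral>\<omega>. pmax (\<lambda>i. W i \<omega>) m \<partial>M) +
    1 / real (Suc m) * (\<integral>\<omega>. max 0 (psum (\<lambda>i. W i \<omega>) (Suc m)) \<partial>M)"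
proof -
  let ?n = "Suc m"
  let ?PM = "PiM {..<?n} (\<lambda>_. borel :: real measure)"
  \<comment> \<open>The cyclic rotation of the \<open>m + 1\<close> steps; it leaves their total
    \<open>S\<close> unchanged.\<close>
  define \<rho> where "\<rho> i = (if i < m then Suc i else 0)" for i :: nat
  have \<rho>: "bij_betw \<rho> {..<?n} {..<?n}"
  proof (rule bij_betw_byWitness[where f' = "\<lambda>i. if i = 0 then m else i - 1"])
  qed (auto simp: \<rho>_def)
  have rot: "(\<integral>\<omega>. \<phi> (\<lambda>i\<in>{..<?n}. W (\<rho> i) \<omega>) \<partial>M) = (\<integral>\<omega>. \<phi> (\<lambda>i\<in>{..<?n}. W i \<omega>) \<partial>M)"
    if "\<phi> \<in> borel_measurable ?PM" for \<phi> :: "_ \<Rightarrow> real"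
    using exch \<rho> that unfolding exchangeable_def by blast
  define S where "S \<omega> = psum (\<lambda>i. W i \<omega>) ?n" for \<omega>
  have [measurable]: "W i \<in> borel_measurable M" for i using int[of i] by auto
  have intS: "integrable M S" unfolding S_def by (rule integrable_psum[OF int])
  have [measurable]: "S \<in> borel_measurable M" using intS by auto
  have S1: "psum (\<lambda>i\<in>{..<?n}. W i \<omega>) ?n = S \<omega>" for \<omega>
    unfolding S_def by (intro psum_cong) auto
  have S2: "psum (\<lambda>i\<in>{..<?n}. W (\<rho> i) \<omega>) ?n = S \<omega>" for \<omega>
  proof -
    have "psum (\<lambda>i\<in>{..<?n}. W (\<rho> i) \<omega>) ?n = (\<Sum>i<?n. W (\<rho> i) \<omega>)"
      unfolding psum_def by (intro sum.cong) auto
    also have "\<dots> = S \<omega>"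
      unfolding S_def psum_def using sum.reindex_bij_betw[OF \<rho>, of "\<lambda>i. W i \<omega>"] .
    finally show ?thesis .
  qed
  note [measurable] = measurable_psum[OF order_refl, of ?n] measurable_pmax[of m ?n, OF le_SucI[OF order_refl]]
  have if_int: "integrable M (\<lambda>\<omega>. if S \<omega> > 0 then f \<omega> else 0)"
    "integrable M (\<lambda>\<omega>. if S \<omega> > 0 then 0 else f \<omega>)" if "integrable M f" for f :: "_ \<Rightarrow> real"
  proof -
    have [measurable]: "f \<in> borel_measurable M" using that by auto
    show "integrable M (\<lambda>\<omega>. if S \<omega> > 0 then f \<omega> else 0)"
      "integrable M (\<lambda>\<omega>. if S \<omega> > 0 then 0 else f \<omega>)"
      by (rule Bochner_Integration.integrable_bound[OF that]; auto)+
  qed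
  \<comment> \<open>Since \<open>S\<close> is invariant under rotation, all steps have the same mean
    on the event \<open>S \<omega> > 0\<close>. Summed over the steps these means give the mean
    positive part of \<open>S\<close>, which is the origin of the factor 1 / (m + 1).\<close>
  have W_eq: "(\<integral>\<omega>. (if S \<omega> > 0 then W i \<omega> else 0) \<partial>M) = (\<integral>\<omega>. (if S \<omega> > 0 then W 0 \<omega> else 0) \<partial>M)"
    if "i \<le> m" for i
    using that
  proof (induction i)
    case (Suc i)
    have [measurable]: "(\<lambda>w. w i) \<in> borel_measurable ?PM"
      using Suc.prems by (intro measurable_component_singleton) auto
    have "(\<lambda>w. if psum w ?n > 0 then w i else 0) \<in> borel_measurable ?PM" by measurable
    from rot[OF this] show ?case
      unfolding S1 S2 using Suc by (simp add: \<rho>_def Suc_le_eq cong: if_cong)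
  qed simp
  have "real ?n * (\<integral>\<omega>. (if S \<omega> > 0 then W 0 \<omega> else 0) \<partial>M) = (\<Sum>i<?n. \<integral>\<omega>. (if S \<omega> > 0 then W i \<omega> else 0) \<partial>M)"
  proof -
    have "(\<Sum>i<?n. \<integral>\<omega>. (if S \<omega> > 0 then W i \<omega> else 0) \<partial>M) = (\<Sum>i<?n. \<integral>\<omega>. (if S \<omega> > 0 then W 0 \<omega> else 0) \<partial>M)"
      by (intro sum.cong refl W_eq) auto
    then show ?thesis by (simp only: sum_constant card_lessThan)
  qed
  also have "\<dots> = (\<integral>\<omega>. (\<Sum>i<?n. if S \<omega> > 0 then W i \<omega> else 0) \<partial>M)"
    by (intro Bochner_Integration.integral_sum[symmetric] if_int int)
  also have "\<dots> = (\<integral>\<omega>. max 0 (S \<omega>) \<partial>M)"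
  proof (intro Bochner_Integration.integral_cong refl)
    fix \<omega>
    have "S \<omega> = (\<Sum>i<?n. W i \<omega>)" by (simp only: S_def psum_def)
    then show "(\<Sum>i<?n. if S \<omega> > 0 then W i \<omega> else 0) = max 0 (S \<omega>)"
      by (cases "S \<omega> > 0") (simp_all del: sum.lessThan_Suc)
  qed
  finally have W0: "(\<integral>\<omega>. (if S \<omega> > 0 then W 0 \<omega> else 0) \<partial>M) = 1 / real ?n * (\<integral>\<omega>. max 0 (S \<omega>) \<partial>M)"
    by (simp add: field_simps)
  \<comment> \<open>\<open>pmax _ m\<close> reads only the first \<open>m\<close> entries, which the
    rotation fills with the steps 1 to \<open>m\<close>.\<close>
  have shift: "(\<integral>\<omega>. (if S \<omega> > 0 then pmax (\<lambda>i. W (Suc i) \<omega>) m else 0) \<partial>M) =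
      (\<integral>\<omega>. (if S \<omega> > 0 then pmax (\<lambda>i. W i \<omega>) m else 0) \<partial>M)"
  proof -
    have "(\<lambda>w. if psum w ?n > 0 then pmax w m else 0) \<in> borel_measurable ?PM" by measurable
    moreover have "pmax (\<lambda>i\<in>{..<?n}. W (\<rho> i) \<omega>) m = pmax (\<lambda>i. W (Suc i) \<omega>) m" for \<omega>
      by (intro pmax_cong) (auto simp: \<rho>_def)
    moreover have "pmax (\<lambda>i\<in>{..<?n}. W i \<omega>) m = pmax (\<lambda>i. W i \<omega>) m" for \<omega>
      by (intro pmax_cong) auto
    ultimately show ?thesis using rot[of "\<lambda>w. if psum w ?n > 0 then pmax w m else 0"] by (simp only: S1 S2)
  qed
  have int1: "integrable M (\<lambda>\<omega>. pmax (\<lambda>i. W i \<omega>) m)" by (rule integrable_pmax[OF int])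
  have int2: "integrable M (\<lambda>\<omega>. pmax (\<lambda>i. W (Suc i) \<omega>) m)" by (rule integrable_pmax[OF int])
  have "(\<integral>\<omega>. pmax (\<lambda>i. W i \<omega>) ?n \<partial>M) = (\<integral>\<omega>. (if S \<omega> > 0 then W 0 \<omega> else 0) +
      ((if S \<omega> > 0 then pmax (\<lambda>i. W (Suc i) \<omega>) m else 0) + (if S \<omega> > 0 then 0 else pmax (\<lambda>i. W i \<omega>) m)) \<partial>M)"
    unfolding pmax_Suc_split S_def[symmetric]
    by (intro Bochner_Integration.integral_cong refl) auto
  also have "\<dots> = (\<integral>\<omega>. (if S \<omega> > 0 then W 0 \<omega> else 0) \<partial>M) +
      ((\<integral>\<omega>. (if S \<omega> > 0 then pmax (\<lambda>i. W i \<omega>) m else 0) \<partial>M) + (\<integral>\<omega>. (if S \<omega> > 0 then 0 else pmax (\<lambda>i. W i \<omega>) m) \<partial>M))"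
    unfolding shift[symmetric]
    by (simp only: Bochner_Integration.integral_add Bochner_Integration.integrable_add
        if_int(1)[OF int] if_int(1)[OF int2] if_int(2)[OF int1])
  also have "(\<integral>\<omega>. (if S \<omega> > 0 then pmax (\<lambda>i. W i \<omega>) m else 0) \<partial>M) + (\<integral>\<omega>. (if S \<omega> > 0 then 0 else pmax (\<lambda>i. W i \<omega>) m) \<partial>M)
      = (\<integral>\<omega>. pmax (\<lambda>i. W i \<omega>) m \<partial>M)"
    by (subst Bochner_Integration.integral_add[symmetric])
       (auto intro!: if_int int1 Bochner_Integration.integral_cong)
  finally show ?thesis unfolding W0 unfolding S_def by (simp only: add.commute)
qed

lemma spitzer:
  assumes int: "\<And>i. integrable M (W i)" and exch: "exchangeable W"
  shows "(\<integral>\<omega>. pmax (\<lambda>i. W i \<omega>) n \<partial>M) =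
    (\<Sum>k=1..n. 1 / real k * (\<integral>\<omega>. max 0 (psum (\<lambda>i. W i \<omega>) k) \<partial>M))"
proof (induction n)
  case (Suc n)
  then show ?case unfolding spitzer_step[OF assms] by simp
qed simp

end

text \<open>Each t < 1 is a limit of dyadic points from the right inside the unit interval; t = 1
  has none, but is a grid point itself.\<close>

lemma right_continuous_le_if_dyadic:
  fixes f :: "real \<Rightarrow> real"
  assumes cont: "\<And>t. 0 \<le> t \<Longrightarrow> continuous (at_right t) f"
    and le: "\<And>r k :: nat. k \<le> 2 ^ r \<Longrightarrow> f (real k / 2 ^ r) \<le> B" and t: "0 \<le> t" "t \<le> 1"
  shows "f t \<le> B"
proof (cases "t = 1")
  case True
  then show ?thesis using le[of 1 0] by simp
next
  case False
  then have "t < 1" using t by simp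
  \<comment> \<open>The floor plus 1, not the ceiling: the grid point must lie strictly to the right
    of \<open>t\<close> even if \<open>t\<close> is dyadic.\<close>
  define k where "k r = nat \<lfloor>t * 2 ^ r\<rfloor> + 1" for r :: nat
  have k: "t < real (k r) / 2 ^ r" "real (k r) / 2 ^ r \<le> t + 1 / 2 ^ r" "k r \<le> 2 ^ r" for r
  proof -
    have "0 \<le> t * 2 ^ r" using t by simp
    then have "real (k r) = of_int \<lfloor>t * 2 ^ r\<rfloor> + 1" by (simp add: k_def)
    then have *: "t * 2 ^ r < real (k r)" "real (k r) \<le> t * 2 ^ r + 1" by linarith+
    then show "t < real (k r) / 2 ^ r" "real (k r) / 2 ^ r \<le> t + 1 / 2 ^ r" by (simp_all add: field_simps)
    have "t * 2 ^ r < 2 ^ r" using \<open>t < 1\<close> by simp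
    then have "real (k r) < 2 ^ r + 1" using * by linarith
    then have "real (k r) < real (2 ^ r + 1)" by simp
    then have "k r < 2 ^ r + 1" by (simp only: of_nat_less_iff)
    then show "k r \<le> 2 ^ r" by simp
  qed
  have "(\<lambda>r. t + 1 / 2 ^ r) \<longlonglongrightarrow> t + 0"
    using LIMSEQ_inverse_realpow_zero[of 2] by (intro tendsto_add tendsto_const) (simp add: inverse_eq_divide)
  then have lim: "(\<lambda>r. t + 1 / 2 ^ r) \<longlonglongrightarrow> t" by simp
  have "(\<lambda>r. real (k r) / 2 ^ r) \<longlonglongrightarrow> t"
    by (rule tendsto_sandwich[OF _ _ tendsto_const lim])
       (simp_all only: k(2) less_imp_le[OF k(1)] eventually_True)
  then have "filterlim (\<lambda>r. real (k r) / 2 ^ r) (at_right t) sequentially"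
    unfolding filterlim_at using k(1) by (auto intro!: always_eventually)
  moreover have "(f \<longlongrightarrow> f t) (at_right t)" using cont[OF t(1)] by (simp add: continuous_within)
  ultimately have "(\<lambda>r. f (real (k r) / 2 ^ r)) \<longlonglongrightarrow> f t" by (rule filterlim_compose[rotated])
  then show ?thesis using le[OF k(3)] by (intro LIMSEQ_le_const2) auto
qed

section \<open>The supremum of a stable process\<close>

abbreviation powr_sum :: "real \<Rightarrow> real^'n \<Rightarrow> real" where
  "powr_sum p u \<equiv> \<Sum>j\<in>UNIV. \<bar>u $ j\<bar> powr p"

locale stable_levy = prob_space M for M :: "'w measure" +
  fixes \<alpha> :: real and X :: "real \<Rightarrow> 'w \<Rightarrow> real^'d"
  assumes alpha: "1 < \<alpha>" "\<alpha> \<le> 2"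
    and coord: "\<And>i. sym_stable_levy M \<alpha> (\<lambda>t \<omega>. X t \<omega> $ i)"
    and indep: "indep_vars (\<lambda>_. Pi\<^sub>M {0..} (\<lambda>_. borel)) (\<lambda>i \<omega>. restrict (\<lambda>t. X t \<omega> $ i) {0..}) UNIV"
begin

lemma measurable_coord [measurable]: "0 \<le> t \<Longrightarrow> (\<lambda>\<omega>. X t \<omega> $ i) \<in> borel_measurable M"
  using coord[of i] by (simp add: sym_stable_levy_def)

lemma measurable_inner [measurable]: "0 \<le> t \<Longrightarrow> (\<lambda>\<omega>. X t \<omega> \<bullet> u) \<in> borel_measurable M"
  unfolding inner_vec_def by measurable

lemma start: "\<omega> \<in> space M \<Longrightarrow> X 0 \<omega> = 0"
  using coord by (simp add: sym_stable_levy_def vec_eq_iff)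

lemma right_continuous: "\<omega> \<in> space M \<Longrightarrow> 0 \<le> t \<Longrightarrow> continuous (at_right t) (\<lambda>s. X s \<omega> \<bullet> u)"
  unfolding inner_vec_def using coord
  by (intro continuous_sum continuous_inner continuous_const) (auto simp: sym_stable_levy_def)

lemma char_increment:
  "0 \<le> s \<Longrightarrow> s \<le> t \<Longrightarrow> char (distr M borel (\<lambda>\<omega>. X t \<omega> $ i - X s \<omega> $ i)) v =
    complex_of_real (exp (- (t - s) * \<bar>v\<bar> powr \<alpha>))"
  using coord[of i] by (simp add: sym_stable_levy_def)

lemma char_coord:
  assumes "0 \<le> t"
  shows "char (distr M borel (\<lambda>\<omega>. X t \<omega> $ i)) v = complex_of_real (exp (- t * \<bar>v\<bar> powr \<alpha>))"
proof -
  have "distr M borel (\<lambda>\<omega>. X t \<omega> $ i) = distr M borel (\<lambda>\<omega>. X t \<omega> $ i - X 0 \<omega> $ i)"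
    by (intro distr_cong) (auto simp: start)
  then show ?thesis using char_increment[of 0 t i v] assms by simp
qed

definition alpha_sum :: "real^'d \<Rightarrow> real" where
  "alpha_sum u = powr_sum \<alpha> u"

lemma alpha_sum_nonneg: "0 \<le> alpha_sum u"
  unfolding alpha_sum_def by (intro sum_nonneg) auto

text \<open>Independence of the coordinates gives a product of exponentials, and homogeneity of the
  power function collects the exponents into one stable exponent.\<close>

lemma char_inner:
  assumes t: "0 \<le> t"
  shows "char (distr M borel (\<lambda>\<omega>. X t \<omega> \<bullet> u)) v = complex_of_real (exp (- (t * alpha_sum u) * \<bar>v\<bar> powr \<alpha>))"
proof -
  have "indep_vars (\<lambda>_. borel) (\<lambda>i \<omega>. (restrict (\<lambda>t. X t \<omega> $ i) {0..}) t * u $ i) UNIV"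
    using t by (intro indep_vars_compose2[OF indep] borel_measurable_times measurable_component_singleton) auto
  then have indep': "indep_vars (\<lambda>_. borel) (\<lambda>i \<omega>. X t \<omega> $ i * u $ i) UNIV"
    using t by simp
  have "char (distr M borel (\<lambda>\<omega>. X t \<omega> $ i * u $ i)) v = complex_of_real (exp (- t * \<bar>v * u $ i\<bar> powr \<alpha>))" for i
  proof -
    have "char (distr M borel (\<lambda>\<omega>. X t \<omega> $ i * u $ i)) v = char (distr M borel (\<lambda>\<omega>. X t \<omega> $ i)) (v * u $ i)"
      unfolding char_def using t by (simp add: integral_distr mult_ac)
    then show ?thesis by (simp only: char_coord[OF t])
  qed
  then have "char (distr M borel (\<lambda>\<omega>. X t \<omega> \<bullet> u)) v = (\<Prod>i\<in>UNIV. complex_of_real (exp (- t * \<bar>v * u $ i\<bar> powr \<alpha>)))"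
    unfolding inner_vec_def using char_distr_sum[OF indep', of v] by simp
  also have "\<dots> = complex_of_real (exp (\<Sum>i\<in>UNIV. - t * \<bar>v * u $ i\<bar> powr \<alpha>))"
    by (simp add: exp_sum)
  also have "(\<Sum>i\<in>UNIV. - t * \<bar>v * u $ i\<bar> powr \<alpha>) = - (t * alpha_sum u) * \<bar>v\<bar> powr \<alpha>"
    by (simp add: alpha_sum_def abs_mult powr_mult sum_negf sum_distrib_left sum_distrib_right mult_ac)
  finally show ?thesis .
qed

lemma integrable_inner: "0 \<le> t \<Longrightarrow> integrable M (\<lambda>\<omega>. X t \<omega> \<bullet> u)"
  by (rule stable_integrable[OF _ alpha(1) _ char_inner]) (auto simp: alpha_sum_nonneg)

text \<open>The coordinate \<open>j\<close> at time 1 serves as the standard variable; all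
  coordinates have the same law.\<close>

lemma positive_part_inner:
  assumes "0 \<le> t"
  shows "(\<integral>\<omega>. max 0 (X t \<omega> \<bullet> u) \<partial>M) = (t * alpha_sum u) powr (1 / \<alpha>) * ((\<integral>\<omega>. \<bar>X 1 \<omega> $ j\<bar> \<partial>M) / 2)"
  using assms
  by (intro stable_positive_part[OF _ _ alpha(1) _ char_inner char_coord]) (auto simp: alpha_sum_nonneg)

definition step :: "real \<Rightarrow> real^'d \<Rightarrow> nat \<Rightarrow> 'w \<Rightarrow> real" where
  "step h u i \<omega> = (X (real (Suc i) * h) \<omega> - X (real i * h) \<omega>) \<bullet> u"

lemma psum_step: "\<omega> \<in> space M \<Longrightarrow> psum (\<lambda>i. step h u i \<omega>) k = X (real k * h) \<omega> \<bullet> u"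
  unfolding psum_def step_def inner_diff_left
  by (subst sum_lessThan_telescope) (simp add: start)

text \<open>The increments of one coordinate are independent and identically distributed, so their
  joint law is a product of equal factors and forgets \<open>\<rho>\<close>. Writing the factor with
  a reference coordinate \<open>j0\<close> gives all coordinates literally the same product.\<close>

lemma distr_block:
  assumes h: "0 \<le> h" and \<rho>: "bij_betw \<rho> {..<n} {..<n}" and "n \<noteq> 0"
  shows "distr M (Pi\<^sub>M {..<n} (\<lambda>_. borel))
      (\<lambda>\<omega>. \<lambda>i\<in>{..<n}. X (real (Suc (\<rho> i)) * h) \<omega> $ j - X (real (\<rho> i) * h) \<omega> $ j) =
    Pi\<^sub>M {..<n} (\<lambda>_. distr M borel (\<lambda>\<omega>. X h \<omega> $ j0 - X 0 \<omega> $ j0))"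
proof -
  let ?I = "{..<n}"
  define D where "D i \<omega> = X (real (Suc i) * h) \<omega> $ j - X (real i * h) \<omega> $ j" for i \<omega>
  define N where "N = distr M borel (\<lambda>\<omega>. X h \<omega> $ j0 - X 0 \<omega> $ j0)"
  have D[measurable]: "D i \<in> borel_measurable M" for i
    unfolding D_def by (intro borel_measurable_diff measurable_coord mult_nonneg_nonneg h) auto
  have N: "prob_space N" unfolding N_def using h by (intro prob_space_distr) auto
  have distrD: "distr M borel (D i) = N" for i
    unfolding N_def
  proof (rule Levy_uniqueness)
    show "char (distr M borel (D i)) = char (distr M borel (\<lambda>\<omega>. X h \<omega> $ j0 - X 0 \<omega> $ j0))"
      unfolding D_def using h by (intro ext, subst (1 2) char_increment) (auto simp: algebra_simps)
  qed (use h D in \<open>auto intro!: real_distribution_distr\<close>)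
  have "indep_vars (\<lambda>_. borel) D ?I"
    using coord[of j] h unfolding sym_stable_levy_def D_def
    by (auto dest!: spec[of _ n] spec[of _ "\<lambda>i. real i * h"] intro: mult_right_mono)
  then have "distr M (Pi\<^sub>M ?I (\<lambda>_. borel)) (\<lambda>\<omega>. \<lambda>i\<in>?I. D i \<omega>) = Pi\<^sub>M ?I (\<lambda>i. distr M borel (D i))"
    using \<open>n \<noteq> 0\<close> by (subst (asm) indep_vars_iff_distr_eq_PiM') auto
  then have base: "distr M (Pi\<^sub>M ?I (\<lambda>_. borel)) (\<lambda>\<omega>. \<lambda>i\<in>?I. D i \<omega>) = Pi\<^sub>M ?I (\<lambda>i. N)"
    by (simp add: distrD)
  have sets_N: "sets (Pi\<^sub>M ?I (\<lambda>_. N)) = sets (Pi\<^sub>M ?I (\<lambda>_. borel))"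
    by (intro sets_PiM_cong) (auto simp: N_def)
  have \<rho>I: "\<rho> i \<in> ?I" if "i \<in> ?I" for i using \<rho> that by (auto simp: bij_betw_def)
  have "distr M (Pi\<^sub>M ?I (\<lambda>_. borel)) (\<lambda>\<omega>. \<lambda>i\<in>?I. D (\<rho> i) \<omega>) =
      distr (distr M (Pi\<^sub>M ?I (\<lambda>_. borel)) (\<lambda>\<omega>. \<lambda>i\<in>?I. D i \<omega>)) (Pi\<^sub>M ?I (\<lambda>_. borel)) (\<lambda>x. \<lambda>i\<in>?I. x (\<rho> i))"
  proof -
    have "(\<lambda>x. \<lambda>i\<in>?I. x (\<rho> i)) \<in> measurable (Pi\<^sub>M ?I (\<lambda>_. borel)) (Pi\<^sub>M ?I (\<lambda>_. borel))"
      by (intro measurable_restrict measurable_component_singleton \<rho>I)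
    moreover have "(\<lambda>\<omega>. \<lambda>i\<in>?I. D i \<omega>) \<in> measurable M (Pi\<^sub>M ?I (\<lambda>_. borel))"
      by (intro measurable_restrict D)
    ultimately show ?thesis
      using \<rho>I by (subst distr_distr) (auto intro!: distr_cong simp: fun_eq_iff restrict_def)
  qed
  also have "\<dots> = distr (Pi\<^sub>M ?I (\<lambda>_. N)) (Pi\<^sub>M ?I (\<lambda>_. N)) (\<lambda>x. \<lambda>i\<in>?I. x (\<rho> i))"
    unfolding base using sets_N by (intro distr_cong) auto
  also have "\<dots> = Pi\<^sub>M ?I (\<lambda>_. N)"
    using \<rho> N by (intro distr_PiM_reindex) (auto simp: bij_betw_def)
  finally show ?thesis unfolding D_def N_def .
qed

text \<open>Steps in direction \<open>u\<close> mix the coordinates, so the array of all coordinate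
  increments is considered: independent over the coordinates, and permutation invariant in each. Its
  law is a product measure in which \<open>\<rho>\<close> no longer occurs.\<close>

lemma exchangeable_step:
  assumes h: "0 \<le> h" shows "exchangeable (step h u)"
  unfolding exchangeable_def
proof (intro allI impI)
  fix n \<rho> and \<phi> :: "(nat \<Rightarrow> real) \<Rightarrow> real"
  assume \<rho>: "bij_betw \<rho> {..<n} {..<n}" and \<phi>[measurable]: "\<phi> \<in> borel_measurable (Pi\<^sub>M {..<n} (\<lambda>_. borel))"
  let ?I = "{..<n}"
  let ?B = "Pi\<^sub>M ?I (\<lambda>_. borel :: real measure)"
  define V where "V \<rho> j \<omega> = (\<lambda>i\<in>?I. X (real (Suc (\<rho> i)) * h) \<omega> $ j - X (real (\<rho> i) * h) \<omega> $ j)"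
    for \<rho> :: "nat \<Rightarrow> nat" and j \<omega>
  \<comment> \<open>The function \<open>\<phi>\<close> read on the whole array, \<open>z j i\<close>
    being increment \<open>i\<close> of coordinate \<open>j\<close>.\<close>
  define \<Psi> where "\<Psi> z = \<phi> (\<lambda>i\<in>?I. \<Sum>j\<in>UNIV. z j i * u $ j)" for z :: "'d \<Rightarrow> nat \<Rightarrow> real"
  have \<Psi>: "\<Psi> \<in> borel_measurable (Pi\<^sub>M UNIV (\<lambda>_ :: 'd. ?B))"
    unfolding \<Psi>_def
  proof (rule measurable_compose[OF _ \<phi>], rule measurable_restrict, intro borel_measurable_sum borel_measurable_times)
    fix i and j :: 'd assume "i \<in> ?I"
    then show "(\<lambda>z. z j i) \<in> borel_measurable (Pi\<^sub>M UNIV (\<lambda>_ :: 'd. ?B))"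
      by (intro measurable_compose[OF measurable_component_singleton[of j] measurable_component_singleton[of i]]) auto
  qed auto
  let ?N = "Pi\<^sub>M ?I (\<lambda>_. distr M borel (\<lambda>\<omega>. X h \<omega> $ undefined - X 0 \<omega> $ undefined))"
  have key: "(\<integral>\<omega>. \<phi> (\<lambda>i\<in>?I. step h u (\<rho> i) \<omega>) \<partial>M) =
      (\<integral>z. \<Psi> z \<partial>Pi\<^sub>M UNIV (\<lambda>_ :: 'd. ?N))"
    if \<rho>: "bij_betw \<rho> ?I ?I" and n: "n \<noteq> 0" for \<rho>
  proof -
    have V_meas: "V \<rho> j \<in> measurable M ?B" for j
      unfolding V_def using h by (intro measurable_restrict) auto
    have "indep_vars (\<lambda>_. ?B) (\<lambda>j \<omega>. (\<lambda>x. \<lambda>i\<in>?I. x (real (Suc (\<rho> i)) * h) - x (real (\<rho> i) * h))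
        (restrict (\<lambda>t. X t \<omega> $ j) {0..})) UNIV"
      using h by (intro indep_vars_compose2[OF indep] measurable_restrict borel_measurable_diff
          measurable_component_singleton) auto
    then have "indep_vars (\<lambda>_. ?B) (V \<rho>) UNIV"
      using h unfolding V_def by (simp add: mult_nonneg_nonneg)
    then have "distr M (Pi\<^sub>M UNIV (\<lambda>_. ?B)) (\<lambda>\<omega>. \<lambda>j\<in>UNIV. V \<rho> j \<omega>) = Pi\<^sub>M UNIV (\<lambda>j. distr M ?B (V \<rho> j))"
      using V_meas by (subst (asm) indep_vars_iff_distr_eq_PiM) auto
    also have "\<dots> = Pi\<^sub>M UNIV (\<lambda>_. ?N)"
      unfolding V_def by (intro PiM_cong refl distr_block h \<rho> n)
    finally have joint: "distr M (Pi\<^sub>M UNIV (\<lambda>_. ?B)) (\<lambda>\<omega>. \<lambda>j\<in>UNIV. V \<rho> j \<omega>) =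
      Pi\<^sub>M UNIV (\<lambda>_. ?N)" .
    have "\<phi> (\<lambda>i\<in>?I. step h u (\<rho> i) \<omega>) = \<Psi> (\<lambda>j\<in>UNIV. V \<rho> j \<omega>)" for \<omega>
      unfolding \<Psi>_def V_def step_def by (intro arg_cong[where f=\<phi>]) (auto simp: fun_eq_iff inner_vec_def)
    then have "(\<integral>\<omega>. \<phi> (\<lambda>i\<in>?I. step h u (\<rho> i) \<omega>) \<partial>M) = (\<integral>\<omega>. \<Psi> (\<lambda>j\<in>UNIV. V \<rho> j \<omega>) \<partial>M)" by simp
    also have "\<dots> = (\<integral>z. \<Psi> z \<partial>distr M (Pi\<^sub>M UNIV (\<lambda>_. ?B)) (\<lambda>\<omega>. \<lambda>j\<in>UNIV. V \<rho> j \<omega>))"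
      using \<Psi> by (intro integral_distr[symmetric] measurable_restrict V_meas)
    finally show ?thesis by (simp only: joint)
  qed
  show "(\<integral>\<omega>. \<phi> (\<lambda>i\<in>?I. step h u (\<rho> i) \<omega>) \<partial>M) = (\<integral>\<omega>. \<phi> (\<lambda>i\<in>?I. step h u i \<omega>) \<partial>M)"
  proof (cases "n = 0")
    case False
    then show ?thesis using key[OF \<rho>] key[of "\<lambda>i. i"] by (simp add: bij_betw_def)
  qed (simp add: restrict_def)
qed

lemma integrable_step: "0 \<le> h \<Longrightarrow> integrable M (step h u i)"
  unfolding step_def inner_diff_left by (intro Bochner_Integration.integrable_diff integrable_inner) auto

section \<open>The supremum as a limit of maxima over dyadic grids\<close>

definition dyadic_max :: "real^'d \<Rightarrow> nat \<Rightarrow> 'w \<Rightarrow> real" where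
  "dyadic_max u r \<omega> = pmax (\<lambda>i. step (1 / 2 ^ r) u i \<omega>) (2 ^ r)"

lemma integrable_dyadic_max: "integrable M (dyadic_max u r)"
  unfolding dyadic_max_def by (intro integrable_pmax integrable_step) simp

lemma dyadic_max_nonneg: "0 \<le> dyadic_max u r \<omega>"
  unfolding dyadic_max_def by (rule pmax_nonneg)

lemma dyadic_le_max:
  assumes "\<omega> \<in> space M" "k \<le> 2 ^ r" shows "X (real k / 2 ^ r) \<omega> \<bullet> u \<le> dyadic_max u r \<omega>"
  using psum_le_pmax[OF assms(2), of "\<lambda>i. step (1 / 2 ^ r) u i \<omega>"] psum_step[OF assms(1), of "1 / 2 ^ r" u k]
  by (simp add: dyadic_max_def)

lemma dyadic_max_least:
  assumes "\<omega> \<in> space M" "\<And>k. k \<le> 2 ^ r \<Longrightarrow> X (real k / 2 ^ r) \<omega> \<bullet> u \<le> c"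
  shows "dyadic_max u r \<omega> \<le> c"
  unfolding dyadic_max_def using assms by (intro pmax_least) (simp add: psum_step)

lemma dyadic_max_mono:
  assumes "\<omega> \<in> space M" shows "mono (\<lambda>r. dyadic_max u r \<omega>)"
proof (rule incseq_SucI, rule dyadic_max_least[OF assms])
  fix r k :: nat assume "k \<le> 2 ^ r"
  then show "X (real k / 2 ^ r) \<omega> \<bullet> u \<le> dyadic_max u (Suc r) \<omega>"
    using dyadic_le_max[OF assms, of "2 * k" "Suc r" u] by simp
qed

text \<open>This is c_\<alpha> times the \<alpha>-norm of \<open>u\<close>.\<close>

definition expected_sup :: "real^'d \<Rightarrow> 'd \<Rightarrow> real" where
  "expected_sup u j = \<alpha> / 2 * (\<integral>\<omega>. \<bar>X 1 \<omega> $ j\<bar> \<partial>M) * alpha_sum u powr (1 / \<alpha>)"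

lemma dyadic_max_expectation: "(\<lambda>r. \<integral>\<omega>. dyadic_max u r \<omega> \<partial>M) \<longlonglongrightarrow> expected_sup u j"
proof -
  define m where "m = (\<integral>\<omega>. \<bar>X 1 \<omega> $ j\<bar> \<partial>M)"
  let ?\<beta> = "1 / \<alpha>"
  let ?s = "\<lambda>n. \<Sum>k=1..n. (1 / real k) * (real k / real n) powr ?\<beta>"
  have eq: "(\<integral>\<omega>. dyadic_max u r \<omega> \<partial>M) = ?s (2 ^ r) * (alpha_sum u powr ?\<beta> * (m / 2))" for r
  proof -
    have "(\<integral>\<omega>. dyadic_max u r \<omega> \<partial>M) =
        (\<Sum>k=1..2 ^ r. 1 / real k * (\<integral>\<omega>. max 0 (psum (\<lambda>i. step (1 / 2 ^ r) u i \<omega>) k) \<partial>M))"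
      unfolding dyadic_max_def by (intro spitzer integrable_step exchangeable_step) auto
    also have "\<dots> = (\<Sum>k=1..2 ^ r. 1 / real k * (real k / real (2 ^ r)) powr ?\<beta> * (alpha_sum u powr ?\<beta> * (m / 2)))"
    proof (intro sum.cong refl)
      fix k
      have "(\<integral>\<omega>. max 0 (psum (\<lambda>i. step (1 / 2 ^ r) u i \<omega>) k) \<partial>M) = (\<integral>\<omega>. max 0 (X (real k * (1 / 2 ^ r)) \<omega> \<bullet> u) \<partial>M)"
        by (intro Bochner_Integration.integral_cong refl) (simp add: psum_step)
      also have "\<dots> = (real k / real (2 ^ r)) powr ?\<beta> * (alpha_sum u powr ?\<beta> * (m / 2))"
      proof -
        have "(real k * (1 / 2 ^ r) * alpha_sum u) powr ?\<beta> = (real k / real (2 ^ r)) powr ?\<beta> * alpha_sum u powr ?\<beta>"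
          by (subst powr_mult) (simp_all add: alpha_sum_nonneg)
        then show ?thesis
          unfolding m_def by (subst positive_part_inner[where j=j]) (simp_all only: mult.assoc, simp)
      qed
      finally show "1 / real k * (\<integral>\<omega>. max 0 (psum (\<lambda>i. step (1 / 2 ^ r) u i \<omega>) k) \<partial>M) =
          1 / real k * (real k / real (2 ^ r)) powr ?\<beta> * (alpha_sum u powr ?\<beta> * (m / 2))" by (simp only: mult.assoc)
    qed
    finally show ?thesis by (simp add: sum_distrib_right)
  qed
  have "?s \<longlonglongrightarrow> 1 / ?\<beta>" using alpha by (intro sum_powr_mean) auto
  moreover have "strict_mono (\<lambda>r. 2 ^ r :: nat)" by (rule strict_monoI_Suc) simp
  ultimately have "(\<lambda>r. ?s (2 ^ r)) \<longlonglongrightarrow> 1 / ?\<beta>" by (rule LIMSEQ_subseq_LIMSEQ[unfolded o_def])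
  then have "(\<lambda>r. ?s (2 ^ r) * (alpha_sum u powr ?\<beta> * (m / 2))) \<longlonglongrightarrow> 1 / ?\<beta> * (alpha_sum u powr ?\<beta> * (m / 2))"
    by (intro tendsto_intros)
  moreover have "1 / ?\<beta> * (alpha_sum u powr ?\<beta> * (m / 2)) = expected_sup u j"
    by (simp add: expected_sup_def m_def)
  ultimately show ?thesis by (simp only: eq)
qed

text \<open>The grids are nested, so the maxima increase while their means stay below a finite
  limit; by monotone convergence the supremum is almost surely finite. Natural numbers as bounds
  keep the event a countable union.\<close>

lemma AE_dyadic_max_bounded: "AE \<omega> in M. \<exists>B :: nat. \<forall>r. dyadic_max u r \<omega> \<le> real B"
proof -
  have [measurable]: "dyadic_max u r \<in> borel_measurable M" for r using integrable_dyadic_max by auto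
  obtain c where c: "(\<lambda>r. \<integral>\<omega>. dyadic_max u r \<omega> \<partial>M) \<longlonglongrightarrow> c" using dyadic_max_expectation by blast
  have "(\<integral>\<^sup>+\<omega>. (SUP r. ennreal (dyadic_max u r \<omega>)) \<partial>M) = (SUP r. \<integral>\<^sup>+\<omega>. ennreal (dyadic_max u r \<omega>) \<partial>M)"
    using dyadic_max_mono
    by (intro nn_integral_monotone_convergence_SUP_AE) (auto intro!: AE_I2 ennreal_leI simp: mono_def)
  also have "\<dots> = (SUP r. ennreal (\<integral>\<omega>. dyadic_max u r \<omega> \<partial>M))"
    by (intro SUP_cong refl nn_integral_eq_integral integrable_dyadic_max) (simp add: dyadic_max_nonneg)
  also have "\<dots> \<le> ennreal c"
  proof (intro SUP_least ennreal_leI incseq_le[OF _ c])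
    show "incseq (\<lambda>r. \<integral>\<omega>. dyadic_max u r \<omega> \<partial>M)"
      using dyadic_max_mono by (intro incseq_SucI integral_mono integrable_dyadic_max) (auto simp: mono_def)
  qed
  finally have "(\<integral>\<^sup>+\<omega>. (SUP r. ennreal (dyadic_max u r \<omega>)) \<partial>M) \<noteq> \<infinity>" by (auto simp: top_unique)
  then have "AE \<omega> in M. (SUP r. ennreal (dyadic_max u r \<omega>)) \<noteq> \<infinity>"
    by (intro nn_integral_PInf_AE) auto
  then show ?thesis
  proof eventually_elim
    case (elim \<omega>)
    then obtain b where b: "0 \<le> b" "(SUP r. ennreal (dyadic_max u r \<omega>)) = ennreal b"
      by (cases "SUP r. ennreal (dyadic_max u r \<omega>)") auto
    have "dyadic_max u r \<omega> \<le> b" for r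
    proof -
      have "ennreal (dyadic_max u r \<omega>) \<le> ennreal b" unfolding b(2)[symmetric] by (rule SUP_upper) simp
      then show ?thesis using b(1) by (simp add: ennreal_le_iff)
    qed
    moreover obtain B :: nat where "b \<le> real B" using real_arch_simple by blast
    ultimately show ?case by (meson order_trans)
  qed
qed

text \<open>As a pointwise \<open>lim\<close> this is measurable by construction; on the null set of
  unbounded dyadic maxima its value is arbitrary.\<close>

definition sup_value :: "real^'d \<Rightarrow> 'w \<Rightarrow> real" where
  "sup_value u \<omega> = lim (\<lambda>r. dyadic_max u r \<omega>)"

lemma sup_value_measurable: "sup_value u \<in> borel_measurable M"
proof -
  have [measurable]: "dyadic_max u r \<in> borel_measurable M" for r using integrable_dyadic_max by auto
  show ?thesis unfolding sup_value_def by measurable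
qed

lemma dyadic_max_tendsto:
  assumes "\<omega> \<in> space M" "\<And>r. dyadic_max u r \<omega> \<le> B"
  shows "(\<lambda>r. dyadic_max u r \<omega>) \<longlonglongrightarrow> sup_value u \<omega>" "dyadic_max u r \<omega> \<le> sup_value u \<omega>"
    "sup_value u \<omega> \<le> B"
proof -
  obtain L where L: "(\<lambda>r. dyadic_max u r \<omega>) \<longlonglongrightarrow> L"
    by (rule incseq_convergent[OF dyadic_max_mono[OF assms(1), of u], of B]) (simp add: assms(2), blast)
  then have "sup_value u \<omega> = L" unfolding sup_value_def by (rule limI)
  then show lim: "(\<lambda>r. dyadic_max u r \<omega>) \<longlonglongrightarrow> sup_value u \<omega>" using L by simp
  show "dyadic_max u r \<omega> \<le> sup_value u \<omega>" by (rule incseq_le[OF dyadic_max_mono[OF assms(1)] lim])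
  show "sup_value u \<omega> \<le> B" using lim assms(2) by (intro LIMSEQ_le_const2) auto
qed

lemma sup_value_expectation:
  "integrable M (sup_value u)" "(\<integral>\<omega>. sup_value u \<omega> \<partial>M) = expected_sup u j"
proof -
  have lim: "AE \<omega> in M. (\<lambda>r. dyadic_max u r \<omega>) \<longlonglongrightarrow> sup_value u \<omega>"
    using AE_dyadic_max_bounded[of u] AE_space
    by eventually_elim (auto intro: dyadic_max_tendsto(1))
  have mono: "AE \<omega> in M. mono (\<lambda>r. dyadic_max u r \<omega>)" using dyadic_max_mono by (intro AE_I2)
  show "integrable M (sup_value u)" "(\<integral>\<omega>. sup_value u \<omega> \<partial>M) = expected_sup u j"
    using integrable_monotone_convergence[OF integrable_dyadic_max mono lim dyadic_max_expectation sup_value_measurable]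
      integral_monotone_convergence[OF integrable_dyadic_max mono lim dyadic_max_expectation sup_value_measurable]
    by auto
qed

lemma inner_le_sup_value:
  assumes "\<omega> \<in> space M" "\<And>r. dyadic_max u r \<omega> \<le> B" "0 \<le> t" "t \<le> 1"
  shows "X t \<omega> \<bullet> u \<le> sup_value u \<omega>"
proof (rule right_continuous_le_if_dyadic[OF right_continuous[OF assms(1)] _ assms(3,4)])
  fix r k :: nat assume "k \<le> 2 ^ r"
  then show "X (real k / 2 ^ r) \<omega> \<bullet> u \<le> sup_value u \<omega>"
    using dyadic_le_max[OF assms(1), of k r u] dyadic_max_tendsto(2)[OF assms(1,2), of r] by linarith
qed

end

section \<open>The unit balls of the p-norms\<close>

lemma mem_lp_ball:
  assumes "1 < p"
  shows "b \<in> lp_ball p \<longleftrightarrow> powr_sum p b \<le> 1"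
proof -
  let ?s = "powr_sum p b"
  have "0 \<le> ?s" by (intro sum_nonneg) auto
  then have "?s powr (1 / p) \<le> 1 \<longleftrightarrow> ?s \<le> 1"
  proof (cases "?s \<le> 1")
    case True
    then show ?thesis using powr_mono2[of "1 / p" ?s 1] assms \<open>0 \<le> ?s\<close> by simp
  next
    case False
    then have "1 powr (1 / p) < ?s powr (1 / p)" using assms by (intro powr_less_mono2) auto
    then show ?thesis using False by simp
  qed
  then show ?thesis by (simp add: lp_ball_def)
qed

context
  fixes p q :: real
  assumes pq: "1 < p" "1 < q" "1 / p + 1 / q = 1"
begin

text \<open>Hoelder's inequality: divide \<open>u\<close> by its q-norm \<open>s\<close>, apply
  Young's inequality in each coordinate and sum up to 1 / p + 1 / q = 1.\<close>

lemma inner_le_if_mem_lp_ball: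
  fixes b u :: "real^'n"
  assumes "b \<in> lp_ball p"
  shows "b \<bullet> u \<le> powr_sum q u powr (1 / q)"
proof (cases "u = 0")
  case False
  let ?a = "powr_sum q u"
  obtain i where "u $ i \<noteq> 0" using False by (auto simp: vec_eq_iff)
  then have a: "0 < ?a" by (intro sum_pos2[of _ i]) auto
  define s where "s = ?a powr (1 / q)"
  have s: "0 < s" "s powr q = ?a" using a pq by (auto simp: s_def powr_powr)
  have "\<bar>b $ j\<bar> * (\<bar>u $ j\<bar> / s) \<le> \<bar>b $ j\<bar> powr p / p + \<bar>u $ j\<bar> powr q / ?a / q" for j
    using Youngs_inequality[OF pq, of "\<bar>b $ j\<bar>" "\<bar>u $ j\<bar> / s"] s by (simp add: powr_divide)
  then have "(\<Sum>j\<in>UNIV. \<bar>b $ j\<bar> * (\<bar>u $ j\<bar> / s)) \<le> (\<Sum>j\<in>UNIV. \<bar>b $ j\<bar> powr p / p + \<bar>u $ j\<bar> powr q / ?a / q)"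
    by (intro sum_mono)
  also have "\<dots> = powr_sum p b / p + ?a / ?a / q"
    by (simp only: sum.distrib sum_divide_distrib)
  also have "\<dots> \<le> 1 / p + 1 / q"
    using assms a pq by (intro add_mono divide_right_mono) (auto simp: mem_lp_ball)
  also have "(\<Sum>j\<in>UNIV. \<bar>b $ j\<bar> * (\<bar>u $ j\<bar> / s)) = (\<Sum>j\<in>UNIV. \<bar>b $ j\<bar> * \<bar>u $ j\<bar>) / s"
    by (simp add: sum_divide_distrib)
  finally have "(\<Sum>j\<in>UNIV. \<bar>b $ j\<bar> * \<bar>u $ j\<bar>) \<le> s" using s pq(3) by (simp add: divide_le_eq)
  moreover have "b \<bullet> u \<le> (\<Sum>j\<in>UNIV. \<bar>b $ j\<bar> * \<bar>u $ j\<bar>)"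
    unfolding inner_vec_def by (intro sum_mono) (simp add: abs_mult[symmetric])
  ultimately show ?thesis by (simp add: s_def)
qed simp

lemma lp_ball_extremal:
  fixes u :: "real^'n"
  shows "\<exists>b\<in>lp_ball p. b \<bullet> u = powr_sum q u powr (1 / q)"
proof (cases "u = 0")
  case True
  then show ?thesis using pq by (intro bexI[of _ 0]) (auto simp: mem_lp_ball)
next
  case False
  let ?a = "powr_sum q u"
  obtain i where "u $ i \<noteq> 0" using False by (auto simp: vec_eq_iff)
  then have a: "0 < ?a" by (intro sum_pos2[of _ i]) auto
  have conj: "(q - 1) * p = q" using pq by (simp add: field_simps)
  \<comment> \<open>The equality case of Hoelder's inequality, where the p-th powers of
    \<open>b\<close> are proportional to the q-th powers of \<open>u\<close>; the denominator
    normalizes \<open>b\<close> to p-norm 1.\<close>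
  define b :: "real^'n" where "b = (\<chi> j. sgn (u $ j) * \<bar>u $ j\<bar> powr (q - 1) / ?a powr (1 / p))"
  have "\<bar>b $ j\<bar> powr p = \<bar>u $ j\<bar> powr q / ?a" for j
  proof (cases "u $ j = 0")
    case False
    then have "\<bar>b $ j\<bar> = \<bar>u $ j\<bar> powr (q - 1) / ?a powr (1 / p)" by (simp add: b_def abs_mult abs_sgn_eq)
    then show ?thesis using a pq by (simp add: powr_divide powr_powr conj)
  qed (simp add: b_def)
  then have "powr_sum p b = ?a / ?a" by (simp only: sum_divide_distrib)
  then have "b \<in> lp_ball p" using a pq by (simp add: mem_lp_ball)
  moreover have "b \<bullet> u = ?a powr (1 / q)"
  proof -
    have "b $ j * u $ j = \<bar>u $ j\<bar> powr q / ?a powr (1 / p)" for j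
    proof (cases "u $ j = 0")
      case False
      have "sgn (u $ j) * u $ j = \<bar>u $ j\<bar>" by (simp add: abs_sgn)
      then have "b $ j * u $ j = \<bar>u $ j\<bar> powr (q - 1) * \<bar>u $ j\<bar> / ?a powr (1 / p)" by (simp add: b_def mult_ac)
      moreover have "\<bar>u $ j\<bar> powr (q - 1) * \<bar>u $ j\<bar> = \<bar>u $ j\<bar> powr q"
        using False powr_add[of "\<bar>u $ j\<bar>" "q - 1" 1] by simp
      ultimately show ?thesis by simp
    qed simp
    then have "b \<bullet> u = ?a / ?a powr (1 / p)" by (simp add: inner_vec_def sum_divide_distrib)
    also have "\<dots> = ?a powr (1 - 1 / p)" using a by (simp add: powr_diff)
    also have "1 - 1 / p = 1 / q" using pq by simp
    finally show ?thesis .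
  qed
  ultimately show ?thesis by blast
qed

text \<open>An intersection of closed half-spaces is closed and convex, which is what this form is
  for. For the inclusion from right to left, the direction extremal for \<open>b\<close> gives s
  \<le> s^(1/q) with s the sum of the p-th powers, and this forces s \<le> 1.\<close>

lemma lp_ball_eq_halfspaces:
  "lp_ball p = (\<Inter>u :: real^'n. {b. u \<bullet> b \<le> powr_sum q u powr (1 / q)})"
proof (intro equalityI subsetI)
  fix b :: "real^'n" assume "b \<in> lp_ball p"
  then show "b \<in> (\<Inter>u. {b. u \<bullet> b \<le> powr_sum q u powr (1 / q)})"
    using inner_le_if_mem_lp_ball by (auto simp: inner_commute[of _ b])
next
  fix b :: "real^'n" assume b: "b \<in> (\<Inter>u. {b. u \<bullet> b \<le> powr_sum q u powr (1 / q)})"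
  let ?s = "powr_sum p b"
  define u :: "real^'n" where "u = (\<chi> j. sgn (b $ j) * \<bar>b $ j\<bar> powr (p - 1))"
  have conj: "(p - 1) * q = p" using pq by (simp add: field_simps)
  have "u $ j * b $ j = \<bar>b $ j\<bar> powr p" for j
  proof (cases "b $ j = 0")
    case False
    have "sgn (b $ j) * b $ j = \<bar>b $ j\<bar>" by (simp add: abs_sgn)
    then have "u $ j * b $ j = \<bar>b $ j\<bar> powr (p - 1) * \<bar>b $ j\<bar>" by (simp add: u_def mult_ac)
    then show ?thesis using False powr_add[of "\<bar>b $ j\<bar>" "p - 1" 1] by simp
  qed simp
  then have "u \<bullet> b = ?s" by (simp add: inner_vec_def)
  moreover have "\<bar>u $ j\<bar> powr q = \<bar>b $ j\<bar> powr p" for j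
    by (cases "b $ j = 0") (simp_all add: u_def abs_mult abs_sgn_eq powr_powr conj)
  moreover have "u \<bullet> b \<le> powr_sum q u powr (1 / q)" using b by blast
  ultimately have le: "?s \<le> ?s powr (1 / q)" by (simp only:)
  have "?s \<le> 1"
  proof (rule ccontr)
    assume "\<not> ?s \<le> 1"
    then have "?s powr (1 / q) < ?s powr 1" using pq by (intro powr_less_mono) auto
    then show False using le \<open>\<not> ?s \<le> 1\<close> by simp
  qed
  then show "b \<in> lp_ball p" using pq by (simp add: mem_lp_ball)
qed

lemma convex_body_lp_ball: "convex_body (lp_ball p :: (real^'n) set)"
proof -
  have "norm b \<le> CARD('n)" if "b \<in> lp_ball p" for b :: "real^'n"
  proof -
    have "\<bar>b $ i\<bar> \<le> 1" for i
    proof (rule ccontr)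
      assume *: "\<not> \<bar>b $ i\<bar> \<le> 1"
      then have "1 < \<bar>b $ i\<bar> powr p" using pq by (intro gr_one_powr) auto
      also have "\<dots> \<le> powr_sum p b" by (intro member_le_sum) auto
      also have "\<dots> \<le> 1" using that pq by (simp add: mem_lp_ball)
      finally show False by simp
    qed
    then have "(\<Sum>i\<in>UNIV. \<bar>b $ i\<bar>) \<le> (\<Sum>i\<in>(UNIV :: 'n set). 1)" by (intro sum_mono)
    then show ?thesis using norm_le_l1_cart[of b] by simp
  qed
  then have "bounded (lp_ball p :: (real^'n) set)" by (auto simp: bounded_iff)
  moreover have "closed (lp_ball p :: (real^'n) set)"
    unfolding lp_ball_eq_halfspaces by (intro closed_INT ballI closed_halfspace_le)
  moreover have "convex (lp_ball p :: (real^'n) set)"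
    unfolding lp_ball_eq_halfspaces by (intro convex_INT convex_halfspace_le)
  moreover have "(0 :: real^'n) \<in> lp_ball p" using pq by (simp add: mem_lp_ball)
  ultimately show ?thesis by (auto simp: convex_body_def compact_eq_bounded_closed)
qed

lemma support_fun_lp_ball:
  "support_fun (lp_ball p) u = powr_sum q u powr (1 / q)" for u :: "real^'n"
proof (rule antisym)
  show "support_fun (lp_ball p) u \<le> powr_sum q u powr (1 / q)"
    by (intro support_fun_least convex_body_nonempty convex_body_lp_ball inner_le_if_mem_lp_ball)
  obtain b where b: "b \<in> lp_ball p" "b \<bullet> u = powr_sum q u powr (1 / q)"
    using lp_ball_extremal by blast
  show "powr_sum q u powr (1 / q) \<le> support_fun (lp_ball p) u"
    using support_fun_upper[OF convex_body_bounded[OF convex_body_lp_ball] b(1), of u] b(2) by simp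
qed

end

section \<open>The mean mixed volume of the convex hull of the path\<close>

text \<open>Half-spaces are closed and convex, so neither closure nor convex hull raises the
  supremum of a linear functional.\<close>

lemma support_fun_hull_closure:
  fixes S :: "'a::euclidean_space set"
  assumes "bounded S" "S \<noteq> {}"
  shows "support_fun (convex hull (closure S)) u = support_fun S u"
proof (rule antisym)
  have bdd: "bounded (convex hull (closure S))" using assms by (intro bounded_convex_hull bounded_closure)
  have "convex hull (closure S) \<subseteq> {x. u \<bullet> x \<le> support_fun S u}"
    using support_fun_upper[OF assms(1), of _ u]
    by (intro hull_minimal closure_minimal convex_halfspace_le closed_halfspace_le) (auto simp: inner_commute[of u])
  then show "support_fun (convex hull (closure S)) u \<le> support_fun S u"
    using assms by (intro support_fun_least) (auto simp: inner_commute[of _ u])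
  show "support_fun S u \<le> support_fun (convex hull (closure S)) u"
    using assms by (intro support_fun_least support_fun_upper bdd)
      (auto intro: hull_inc subsetD[OF closure_subset])
qed

context stable_levy
begin

definition hull_path :: "'w \<Rightarrow> (real^'d) set" where
  "hull_path \<omega> = convex hull (closure ((\<lambda>s. X s \<omega>) ` {0..1}))"

text \<open>Bounds in the finitely many directions \<open>b\<close> and \<open>- b\<close> confine
  the whole path, and countably many dyadic maxima make the event measurable.\<close>

definition bounded_path :: "'w \<Rightarrow> bool" where
  "bounded_path \<omega> \<longleftrightarrow> (\<forall>b\<in>Basis. (\<exists>B::nat. \<forall>r. dyadic_max b r \<omega> \<le> real B) \<and>
    (\<exists>B::nat. \<forall>r. dyadic_max (- b) r \<omega> \<le> real B))"

lemma AE_bounded_path: "AE \<omega> in M. bounded_path \<omega>"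
  unfolding bounded_path_def by (intro AE_finite_allI AE_conjI AE_dyadic_max_bounded finite_Basis)

lemma bounded_path_measurable: "{\<omega>\<in>space M. bounded_path \<omega>} \<in> sets M"
proof -
  have [measurable]: "dyadic_max u r \<in> borel_measurable M" for u r using integrable_dyadic_max by auto
  have "{\<omega>\<in>space M. \<exists>B::nat. \<forall>r. dyadic_max u r \<omega> \<le> real B} \<in> sets M" for u
    by measurable
  then show ?thesis
    unfolding bounded_path_def
    by (intro sets.sets_Collect_finite_All sets.sets_Collect_conj) simp_all
qed

lemma bounded_path_bounded:
  assumes "\<omega> \<in> space M" "bounded_path \<omega>" shows "bounded ((\<lambda>s. X s \<omega>) ` {0..1})"
proof -
  define R where "R = (\<Sum>b\<in>Basis. \<bar>sup_value b \<omega>\<bar> + \<bar>sup_value (- b) \<omega>\<bar>)"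
  have "norm (X t \<omega>) \<le> R" if t: "0 \<le> t" "t \<le> 1" for t
  proof -
    have "\<bar>X t \<omega> \<bullet> b\<bar> \<le> \<bar>sup_value b \<omega>\<bar> + \<bar>sup_value (- b) \<omega>\<bar>" if "b \<in> Basis" for b
    proof -
      obtain B C where "\<And>r. dyadic_max b r \<omega> \<le> real B" "\<And>r. dyadic_max (- b) r \<omega> \<le> real C"
        using assms(2) \<open>b \<in> Basis\<close> unfolding bounded_path_def by blast
      then have "X t \<omega> \<bullet> b \<le> sup_value b \<omega>" "X t \<omega> \<bullet> (- b) \<le> sup_value (- b) \<omega>"
        using inner_le_sup_value[OF assms(1) _ t] by blast+
      then show ?thesis by simp
    qed
    then have "(\<Sum>b\<in>Basis. \<bar>X t \<omega> \<bullet> b\<bar>) \<le> R" unfolding R_def by (intro sum_mono)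
    then show ?thesis using norm_le_l1[of "X t \<omega>"] by simp
  qed
  then show ?thesis by (auto simp: bounded_iff intro!: exI[of _ R])
qed

lemma convex_body_hull_path:
  assumes "\<omega> \<in> space M" "bounded_path \<omega>" shows "convex_body (hull_path \<omega>)"
  using bounded_path_bounded[OF assms]
  by (auto simp: convex_body_def hull_path_def compact_convex_hull compact_closure)

lemma support_fun_hull_path:
  assumes \<omega>: "\<omega> \<in> space M" "bounded_path \<omega>" shows "support_fun (hull_path \<omega>) u = sup_value u \<omega>"
proof -
  let ?S = "(\<lambda>s. X s \<omega>) ` {0..1}"
  note bdd = bounded_path_bounded[OF \<omega>]
  have max_le: "dyadic_max u r \<omega> \<le> support_fun ?S u" for r
  proof (rule dyadic_max_least[OF \<omega>(1)])
    fix k :: nat assume "k \<le> 2 ^ r"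
    then have "real k \<le> real (2 ^ r)" by (simp only: of_nat_le_iff)
    then show "X (real k / 2 ^ r) \<omega> \<bullet> u \<le> support_fun ?S u"
      by (intro support_fun_upper bdd imageI) (simp add: field_simps)
  qed
  have "support_fun ?S u = sup_value u \<omega>"
  proof (rule antisym)
    show "support_fun ?S u \<le> sup_value u \<omega>"
      using inner_le_sup_value[OF \<omega>(1) max_le] by (intro support_fun_least) auto
    show "sup_value u \<omega> \<le> support_fun ?S u" by (rule dyadic_max_tendsto(3)[OF \<omega>(1) max_le])
  qed
  then show ?thesis unfolding hull_path_def using bdd by (simp add: support_fun_hull_closure)
qed

text \<open>The exponent \<open>\<alpha> / (\<alpha> - 1)\<close> is conjugate to \<alpha>, so the
  mean support function of the hull is that of the ball scaled by the constant.\<close>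

lemma nn_integral_hull_path:
  assumes F: "monotone_additive_functional F"
  shows "(\<integral>\<^sup>+\<omega>. ennreal (F (hull_path \<omega>)) \<partial>M) =
    ennreal (\<alpha> / 2 * (\<integral>\<omega>. \<bar>X 1 \<omega> $ j\<bar> \<partial>M) * F (lp_ball (\<alpha> / (\<alpha> - 1))))"
proof -
  interpret F: monotone_additive_functional F by fact
  let ?c = "\<alpha> / 2 * (\<integral>\<omega>. \<bar>X 1 \<omega> $ j\<bar> \<partial>M)"
  let ?B = "lp_ball (\<alpha> / (\<alpha> - 1)) :: (real^'d) set"
  have pq: "1 < \<alpha> / (\<alpha> - 1)" "1 < \<alpha>" "1 / (\<alpha> / (\<alpha> - 1)) + 1 / \<alpha> = 1"
    using alpha by (auto simp: field_simps)
  have c: "0 \<le> ?c" using alpha by (intro mult_nonneg_nonneg Bochner_Integration.integral_nonneg) auto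
  note B = convex_body_lp_ball[OF pq]
  \<comment> \<open>The random-body theorem wants a convex body for every \<open>\<omega>\<close>,
    also outside the space; the exceptional values are set to \<open>{0}\<close>, which affects only
    a null set.\<close>
  define Z where "Z \<omega> = (if \<omega> \<in> space M \<and> bounded_path \<omega> then hull_path \<omega> else {0})" for \<omega>
  have ae: "AE \<omega> in M. \<omega> \<in> space M \<and> bounded_path \<omega>" using AE_bounded_path AE_space by eventually_elim simp
  have hZ: "support_fun (Z \<omega>) u = (if bounded_path \<omega> then sup_value u \<omega> else 0)" if "\<omega> \<in> space M" for \<omega> u
    using that by (simp add: Z_def support_fun_hull_path) (simp add: support_fun_def)
  have meas: "(\<lambda>\<omega>. support_fun (Z \<omega>) u) \<in> borel_measurable M" for u
  proof -
    have "(\<lambda>\<omega>. if bounded_path \<omega> then sup_value u \<omega> else 0) \<in> borel_measurable M"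
      by (intro measurable_If sup_value_measurable bounded_path_measurable) auto
    then show ?thesis by (simp add: hZ cong: measurable_cong)
  qed
  have aeZ: "AE \<omega> in M. support_fun (Z \<omega>) u = sup_value u \<omega>" for u
    using ae by eventually_elim (simp add: hZ)
  have "(\<integral>\<^sup>+\<omega>. ennreal (F (hull_path \<omega>)) \<partial>M) = (\<integral>\<^sup>+\<omega>. ennreal (F (Z \<omega>)) \<partial>M)"
  proof (rule nn_integral_cong_AE)
    show "AE \<omega> in M. ennreal (F (hull_path \<omega>)) = ennreal (F (Z \<omega>))"
      using ae by eventually_elim (simp add: Z_def)
  qed
  also have "\<dots> = ennreal (F ((*\<^sub>R) ?c ` ?B))"
  proof (rule F.nn_integral_random_body[OF prob_space_axioms])
    show "convex_body (Z \<omega>)" for \<omega>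
      using convex_body_hull_path by (simp add: Z_def) (simp add: convex_body_def)
    show "convex_body ((*\<^sub>R) ?c ` ?B)" by (rule convex_body_scaleR[OF B])
    show "integrable M (\<lambda>\<omega>. support_fun (Z \<omega>) u)" for u
      using integrable_cong_AE[OF meas sup_value_measurable aeZ[of u]] sup_value_expectation(1) by simp
    have "(\<integral>\<omega>. support_fun (Z \<omega>) u \<partial>M) = expected_sup u j" for u
      using integral_cong_AE[OF meas sup_value_measurable aeZ[of u]] sup_value_expectation(2)[of u j] by simp
    then show "(\<integral>\<omega>. support_fun (Z \<omega>) u \<partial>M) = support_fun ((*\<^sub>R) ?c ` ?B) u" for u
      unfolding support_fun_scaleR[OF B c] support_fun_lp_ball[OF pq] expected_sup_def alpha_sum_def .
  qed
  also have "F ((*\<^sub>R) ?c ` ?B) = ?c * F ?B" by (rule F.scale[OF B c])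
  finally show ?thesis .
qed

end

theorem theorem1:
  fixes M :: "'w measure" and \<alpha> :: real
    and X :: "real \<Rightarrow> 'w \<Rightarrow> real^'d"
    and K :: "nat \<Rightarrow> (real^'d) set"
    and j :: 'd
  assumes "prob_space M"
    and "1 < \<alpha>" and "\<alpha> \<le> 2"
    and "\<And>i. sym_stable_levy M \<alpha> (\<lambda>t \<omega>. X t \<omega> $ i)"
    and "prob_space.indep_vars M (\<lambda>_. Pi\<^sub>M {0..} (\<lambda>_. borel))
           (\<lambda>i \<omega>. restrict (\<lambda>t. X t \<omega> $ i) {0..}) UNIV"
    and "\<And>i. i < CARD('d) - 1 \<Longrightarrow> convex_body (K i)"
  shows "(\<integral>\<^sup>+\<omega>. ennreal (mixed_volume
            (\<lambda>i. if i < CARD('d) - 1 then K i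
                  else convex hull (closure ((\<lambda>s. X s \<omega>) ` {0..1})))) \<partial>M)
         = ennreal ((\<alpha> / 2 * (\<integral>\<omega>. \<bar>X 1 \<omega> $ j\<bar> \<partial>M)) *
              mixed_volume (\<lambda>i. if i < CARD('d) - 1 then K i
                                else lp_ball (\<alpha> / (\<alpha> - 1))))"
proof -
  interpret stable_levy M \<alpha> X
    by (intro stable_levy.intro stable_levy_axioms.intro assms)
  have "monotone_additive_functional (mv_last K)"
    by (intro monotone_additive_functional.intro mv_last_add[OF assms(6)]
        mv_last_scale[OF assms(6)] mv_last_mono[OF assms(6)]
        mv_last_nonneg[OF assms(6)])
  from nn_integral_hull_path[OF this, of j] show ?thesis
    unfolding mv_last_def hull_path_def .
qed

end
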